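(* Let $G=\mathrm{SL}_{2\ell}$ over $\mathbb{C}$ with diagram automorphism $\sigma$ of order $2$ (type $(A_{2\ell-1},2)$, so $\ell\ge 2$). For any $x\in\pi(\mathcal{M})$, the reduced fiber over $x$ of $\pi:\mathcal{M}\to\pi(\mathcal{M})$ satisfies $$\pi^{-1}(x)_{\rm red}\cong\{z\in\mathfrak{sp}_{2\ell}\mid xz+zx=0,\ z^2=0,\ \mathrm{rk}(z+\tfrac12x^2)\le1\}.$$ In particular, $\pi^{-1}(0)_{\rm red}$ is isomorphic to the closure of the nilpotent orbit $\mathcal{O}_{[21^{2\ell-2}]}$ in $\mathfrak{sp}_{2\ell}$, and $\dim\pi^{-1}(0)_{\rm red}=2\ell+1$.
   Context: $\sigma(A)=JA^{-T}J^{-1}$ on $G$, where $J$ is the antidiagonal $2\ell\times2\ell$ matrix with $J_{i,2\ell+1-i}=(-1)^{i-1}$. On $\mathfrak{sl}_{2\ell}$, $\sigma(A)=-JA^TJ^{-1}$; its $(+1)$-eigenspace is $\mathfrak{sp}_{2\ell}$ (with respect to $J$) and $\mathfrak p=\{A\in\mathfrak{sl}_{2\ell}:A=JA^TJ^{-1}\}$ is its $(-1)$-eigenspace. $\mathcal{O}=\mathbb{C}[[t]]$, $\mathcal{K}=\mathbb{C}((t))$, $\mathcal{O}^-=\mathbb{C}[t^{-1}]$, with $\sigma(t)=-t$, $\sigma|_{\mathbb C}=\mathrm{Id}$; $\sigma$ acts on $G(\mathcal K)$ etc. through both $G$ and $t$. $\mathcal{G}r=G(\mathcal{K})^\sigma/G(\mathcal{O})^\sigma$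 with base point $e_0$. Let $T$ be the diagonal torus. $X_*(T)_\sigma=X_*(T)/(\mathrm{Id}-\sigma)X_*(T)$ is identified with $\{a\in\mathbb{Z}^\ell:\sum a_i\in2\mathbb{Z}\}$ by sending the class $\bar\lambda$ of $\lambda=(b_1,\dots,b_{2\ell})$, $\sum b_i=0$, to $(a_i)$, $a_i=b_i-b_{2\ell+1-i}$. Put $n^\lambda=t^\lambda\sigma(t^\lambda)$ and, for $a_1\ge\dots\ge a_\ell\ge0$, $\mathcal{G}r_{\bar\lambda}=G(\mathcal{O})^\sigma n^\lambda\cdot e_0$. $\mathcal{G}r_0^-=G(\mathcal{O}^-)^\sigma\cdot e_0\simeq G(\mathcal{O}^-)_0^\sigma$, where $G(\mathcal{O}^-)_0$ is the kernel of evaluation at $t=\infty$; $\mathcal{M}_{\bar\lambda}=\mathcal{G}r_{\bar\lambda}\cap\mathcal{G}r_0^-$. A dominant weight is small if it is not $\succeq2\gamma_0$, where $\gamma_0=(1,1,0,\dots,0)$ is the highest short root of type $C_\ell$ (simple roots $e_i-e_{i+1}$, $2e_\ell$) and $\bar\lambda\succeq\bar\mu$ means that $\bar\lambda-\bar\mu$ is a sum of positive roots; the small ones are $(1^{2j}0^{\ell-2j})$, $0\le j\le\lfloor\ell/2\rfloor$, and $(2\,1^{2j}\,0^{\ell-2j-1})$, $0\le j\le\lfloor\frac{\ell-1}2\rfloor$. $\mathcal{M}$ is the union of $\mathcal{M}_{\bar\lambda}$ over small $\bar\lambda$. $\pi:\mathcal{G}r_0^-\to\mathfrak p$ sends $(I+xt^{-1}+yt^{-2}+\cdots)\cdot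 e_0$ to $x$ (for $I+xt^{-1}+\cdots\in G(\mathcal{O}^-)_0^\sigma$). For $x\in\pi(\mathcal{M})$, $\pi^{-1}(x)_{\rm red}$ denotes the fiber of $\pi:\mathcal{M}\to\pi(\mathcal{M})$ over $x$ with its reduced structure. $\mathcal{O}_{[21^{2\ell-2}]}$ is the $\mathrm{Sp}_{2\ell}$-adjoint orbit of nilpotent elements of $\mathfrak{sp}_{2\ell}$ with one Jordan block of size $2$ and $2\ell-2$ of size $1$.
   Formalization: The dimension of the reduced fiber over 0 is stated as 2ℓ instead of 2ℓ+1: the closure of the orbit O_[21^{2ℓ-2}] consists of the matrices v v^T J, i.e. C^{2ℓ}/±1, which has dimension 2ℓ (4 for ℓ=2), so the printed value is false. *)

theory Defs
  imports
    "HOL-Computational_Algebra.Formal_Laurent_Series"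
    "HOL-Algebra.Coset"
    "HOL-Analysis.Abstract_Topology"
    "HOL-Library.Extended_Nat"
    "Jordan_Normal_Form.Gauss_Jordan_Elimination"
    "Jordan_Normal_Form.Jordan_Normal_Form"
    "Jordan_Normal_Form.DL_Rank"
begin

section \<open>Reduced varieties as sets of points with coordinate functions\<close>

text \<open>
  A reduced (quasi-affine) complex variety is given by its set \<open>X\<close> of closed points together with
  a set \<open>C\<close> of complex-valued coordinate functions that embed \<open>X\<close> in an affine space.
\<close>

inductive_set polyfun :: "('a \<Rightarrow> complex) set \<Rightarrow> ('a \<Rightarrow> complex) set"
  for C :: "('a \<Rightarrow> complex) set" where
  const: "(\<lambda>_. c) \<in> polyfun C"
| coord: "f \<in> C \<Longrightarrow> f \<in> polyfun C"
| add: "f \<in> polyfun C \<Longrightarrow> g \<in> polyfun C \<Longrightarrow> (\<lambda>a. f a + g a) \<in> polyfun C"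
| mult: "f \<in> polyfun C \<Longrightarrow> g \<in> polyfun C \<Longrightarrow> (\<lambda>a. f a * g a) \<in> polyfun C"

definition zariski :: "('a \<Rightarrow> complex) set \<Rightarrow> 'a set \<Rightarrow> 'a topology" where
  "zariski C X =
     topology (\<lambda>U. \<exists>F \<subseteq> polyfun C. U = {a \<in> X. \<exists>f\<in>F. f a \<noteq> 0})"

lemma openin_zariski:
  "openin (zariski C X) U \<longleftrightarrow> (\<exists>F \<subseteq> polyfun C. U = {a \<in> X. \<exists>f\<in>F. f a \<noteq> 0})"
proof -
  let ?D = "\<lambda>F. {a \<in> X. \<exists>f\<in>F. f a \<noteq> 0}"
  let ?P = "\<lambda>U. \<exists>F \<subseteq> polyfun C. U = ?D F"
  have "istopology ?P"
    unfolding istopology_def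
  proof (intro conjI allI impI)
    fix S T assume "?P S" "?P T"
    then obtain F G where F: "F \<subseteq> polyfun C" "S = ?D F" and G: "G \<subseteq> polyfun C" "T = ?D G"
      by (elim exE conjE)
    let ?H = "(\<lambda>(f, g) a. f a * g a) ` (F \<times> G)"
    have "?H \<subseteq> polyfun C"
    proof
      fix h assume "h \<in> ?H"
      then obtain f g where "f \<in> F" "g \<in> G" "h = (\<lambda>a. f a * g a)" by auto
      then show "h \<in> polyfun C" using F(1) G(1) polyfun.mult[of f C g] by auto
    qed
    moreover have "S \<inter> T = ?D ?H"
      unfolding F(2) G(2) by auto
    ultimately show "?P (S \<inter> T)" by (intro exI[of _ ?H] conjI)
  next
    fix K assume K: "\<forall>S\<in>K. ?P S"
    then have "\<exists>F. \<forall>S\<in>K. F S \<subseteq> polyfun C \<and> S = ?D (F S)"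
      by (rule bchoice)
    then obtain F where F: "\<forall>S\<in>K. F S \<subseteq> polyfun C \<and> S = ?D (F S)"
      by (elim exE)
    have F1: "F S \<subseteq> polyfun C" and F2: "S = ?D (F S)" if "S \<in> K" for S
      using bspec[OF F that] by (rule conjunct1, rule conjunct2)
    have "\<Union>K = (\<Union>S\<in>K. S)" by simp
    also have "\<dots> = (\<Union>S\<in>K. ?D (F S))" by (rule SUP_cong[OF refl F2])
    also have "\<dots> = ?D (\<Union>S\<in>K. F S)" by auto
    finally have eq: "\<Union>K = ?D (\<Union>S\<in>K. F S)" .
    have "(\<Union>S\<in>K. F S) \<subseteq> polyfun C" using F1 by (rule UN_least)
    with eq show "?P (\<Union>K)" by (intro exI[of _ "\<Union>S\<in>K. F S"] conjI)
  qed
  then show ?thesis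
    unfolding zariski_def by (simp only: topology_inverse')
qed

definition regular_on ::
  "('a \<Rightarrow> complex) set \<Rightarrow> 'a set \<Rightarrow> 'a set \<Rightarrow> ('a \<Rightarrow> complex) \<Rightarrow> bool" where
  "regular_on C X U f \<longleftrightarrow>
     openin (zariski C X) U \<and>
     (\<forall>a\<in>U. \<exists>V p q. openin (zariski C X) V \<and> a \<in> V \<and> V \<subseteq> U \<and>
        p \<in> polyfun C \<and> q \<in> polyfun C \<and> (\<forall>b\<in>V. q b \<noteq> 0 \<and> f b = p b / q b))"

definition variety_morphism ::
  "('a \<Rightarrow> complex) set \<Rightarrow> 'a set \<Rightarrow> ('b \<Rightarrow> complex) set \<Rightarrow> 'b set \<Rightarrow> ('a \<Rightarrow> 'b) \<Rightarrow> bool" where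
  "variety_morphism C X D Y \<phi> \<longleftrightarrow>
     continuous_map (zariski C X) (zariski D Y) \<phi> \<and>
     (\<forall>V f. regular_on D Y V f \<longrightarrow> regular_on C X {a \<in> X. \<phi> a \<in> V} (f \<circ> \<phi>))"

definition variety_isomorphic ::
  "('a \<Rightarrow> complex) set \<Rightarrow> 'a set \<Rightarrow> ('b \<Rightarrow> complex) set \<Rightarrow> 'b set \<Rightarrow> bool" where
  "variety_isomorphic C X D Y \<longleftrightarrow>
     (\<exists>\<phi> \<psi>. variety_morphism C X D Y \<phi> \<and> variety_morphism D Y C X \<psi> \<and>
        (\<forall>a\<in>X. \<psi> (\<phi> a) = a) \<and> (\<forall>b\<in>Y. \<phi> (\<psi> b) = b))"

definition irreducible_in :: "'a topology \<Rightarrow> 'a set \<Rightarrow> bool" where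
  "irreducible_in T S \<longleftrightarrow>
     S \<subseteq> topspace T \<and> S \<noteq> {} \<and>
     (\<forall>A B. closedin T A \<and> closedin T B \<and> S \<subseteq> A \<union> B \<longrightarrow> S \<subseteq> A \<or> S \<subseteq> B)"

text \<open>The empty space gets dimension \<open>0\<close>, as the supremum of the empty set in \<open>enat\<close>.\<close>

definition krull_dim :: "'a topology \<Rightarrow> enat" where
  "krull_dim T =
     Sup {enat n | n. \<exists>Z :: nat \<Rightarrow> 'a set.
            (\<forall>i\<le>n. closedin T (Z i) \<and> irreducible_in T (Z i)) \<and> (\<forall>i<n. Z i \<subset> Z (Suc i))}"

section \<open>The group, its involution and the Lie algebra\<close>

text \<open>All matrix and weight indices start at \<open>0\<close>, so the index \<open>2\<ell> + 1 - i\<close> becomes \<open>2\<ell> - 1 - i\<close>.\<close>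

definition Jmat :: "nat \<Rightarrow> 'a::comm_ring_1 mat" where
  "Jmat l = mat (2*l) (2*l) (\<lambda>(i,j). if i + j = 2*l - 1 then (-1)^i else 0)"

definition SL :: "nat \<Rightarrow> 'a::comm_ring_1 set \<Rightarrow> 'a mat set" where
  "SL n R = {A \<in> carrier_mat n n. (\<forall>i<n. \<forall>j<n. A $$ (i,j) \<in> R) \<and> det A = 1}"

definition sigma_G :: "nat \<Rightarrow> 'a::field mat \<Rightarrow> 'a mat" where
  "sigma_G l A = Jmat l * transpose_mat (the (mat_inverse A)) * the (mat_inverse (Jmat l))"

definition Sp :: "nat \<Rightarrow> complex mat set" where
  "Sp l = {g \<in> SL (2*l) UNIV. sigma_G l g = g}"

definition sl :: "nat \<Rightarrow> complex mat set" where
  "sl n = {A \<in> carrier_mat n n. (\<Sum>i<n. A $$ (i,i)) = 0}"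

definition sigma_g :: "nat \<Rightarrow> complex mat \<Rightarrow> complex mat" where
  "sigma_g l A = - (Jmat l * transpose_mat A * the (mat_inverse (Jmat l)))"

definition sp :: "nat \<Rightarrow> complex mat set" where
  "sp l = {A \<in> sl (2*l). sigma_g l A = A}"

definition mat_coords :: "nat \<Rightarrow> (complex mat \<Rightarrow> complex) set" where
  "mat_coords n = {\<lambda>A. A $$ (i,j) | i j. i < n \<and> j < n}"

definition adjoint_orbit :: "nat \<Rightarrow> complex mat \<Rightarrow> complex mat set" where
  "adjoint_orbit l e = {g * e * the (mat_inverse g) | g. g \<in> Sp l}"

text \<open>
  There is exactly one orbit of this Jordan type. Its closure consists of the matrices
  \<open>v * v\<^sup>T * J\<close>, i.e. it is the quotient of affine \<open>2\<ell>\<close>-space by \<open>v \<mapsto> -v\<close>, so it has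
  dimension \<open>2\<ell>\<close>; the value \<open>2\<ell> + 1\<close> printed in the source for the fibre over \<open>0\<close> is off by one.
\<close>

definition orbit_21 :: "nat \<Rightarrow> complex mat set" where
  "orbit_21 l = (THE Orb. \<exists>e \<in> sp l.
     jordan_nf e ((2, 0) # replicate (2*l - 2) (1, 0)) \<and> Orb = adjoint_orbit l e)"

section \<open>The twisted affine Grassmannian\<close>

abbreviation ring_O :: "complex fls set" where
  "ring_O \<equiv> range fps_to_fls"

text \<open>
  A formal Laurent series has finitely many negative powers, so the following is the
  polynomial ring in the inverse of \<open>t\<close>.
\<close>

definition ring_Ominus :: "complex fls set" where
  "ring_Ominus = {f. \<forall>n>0. fls_nth f n = 0}"

definition sigma_loop :: "nat \<Rightarrow> complex fls mat \<Rightarrow> complex fls mat" where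
  "sigma_loop l A = sigma_G l (map_mat (\<lambda>f. fls_compose_fps f (- fps_X)) A)"

definition twisted :: "nat \<Rightarrow> complex fls set \<Rightarrow> complex fls mat set" where
  "twisted l R = {A \<in> SL (2*l) R. sigma_loop l A = A}"

definition loop_group :: "nat \<Rightarrow> complex fls mat monoid" where
  "loop_group l = \<lparr>carrier = twisted l UNIV, mult = (*), one = 1\<^sub>m (2*l)\<rparr>"

text \<open>Points of the Grassmannian are left cosets; this one is the translate by \<open>g\<close> of the base point.\<close>

definition gr_pt :: "nat \<Rightarrow> complex fls mat \<Rightarrow> complex fls mat set" where
  "gr_pt l g = g <#\<^bsub>loop_group l\<^esub> twisted l ring_O"

definition cochars :: "nat \<Rightarrow> (nat \<Rightarrow> int) set" where
  "cochars l = {b. (\<Sum>i<2*l. b i) = 0}"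

definition coinv_class :: "nat \<Rightarrow> (nat \<Rightarrow> int) \<Rightarrow> nat \<Rightarrow> int" where
  "coinv_class l b = (\<lambda>i. if i < l then b i - b (2*l - 1 - i) else 0)"

definition t_pow :: "nat \<Rightarrow> (nat \<Rightarrow> int) \<Rightarrow> complex fls mat" where
  "t_pow l b = mat_diag (2*l) (\<lambda>i. fls_X_intpow (b i))"

definition n_elt :: "nat \<Rightarrow> (nat \<Rightarrow> int) \<Rightarrow> complex fls mat" where
  "n_elt l b = t_pow l b * sigma_loop l (t_pow l b)"

text \<open>
  Representatives of the same class give the same orbit (their \<open>n_elt\<close> differ by a constant
  diagonal sign matrix fixed by the involution), so the union over representatives is that orbit.
\<close>

definition gr_orbit :: "nat \<Rightarrow> (nat \<Rightarrow> int) \<Rightarrow> complex fls mat set set" where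
  "gr_orbit l a =
     {gr_pt l (g * n_elt l b) | g b. g \<in> twisted l ring_O \<and> b \<in> cochars l \<and> coinv_class l b = a}"

definition gr_minus :: "nat \<Rightarrow> complex fls mat set set" where
  "gr_minus l = gr_pt l ` twisted l ring_Ominus"

text \<open>Evaluation at infinity of a polynomial in the inverse of \<open>t\<close> is its constant coefficient.\<close>

definition congruence_minus :: "nat \<Rightarrow> complex fls mat set" where
  "congruence_minus l =
     {A \<in> twisted l ring_Ominus. map_mat (\<lambda>f. fls_nth f 0) A = 1\<^sub>m (2*l)}"

definition gr_rep :: "nat \<Rightarrow> complex fls mat set \<Rightarrow> complex fls mat" where
  "gr_rep l p = (THE A. A \<in> congruence_minus l \<and> gr_pt l A = p)"

text \<open>
  The ind-variety structure of \<open>gr_minus\<close> is that of \<open>congruence_minus\<close>, whose coordinates are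
  the entries of the coefficients of all powers of the inverse of \<open>t\<close>. On subsets of bounded degree
  all but finitely many of these coordinates vanish, so such a subset carries the reduced structure
  it has in a finite-dimensional piece of the ind-variety.
\<close>

definition gr_coords :: "nat \<Rightarrow> (complex fls mat set \<Rightarrow> complex) set" where
  "gr_coords l =
     {\<lambda>p. fls_nth (gr_rep l p $$ (i,j)) (- int k) | i j k. i < 2*l \<and> j < 2*l}"

definition pi_map :: "nat \<Rightarrow> complex fls mat set \<Rightarrow> complex mat" where
  "pi_map l p = map_mat (\<lambda>f. fls_nth f (- 1)) (gr_rep l p)"

section \<open>Small dominant weights of type C\<close>

abbreviation unit_wt :: "nat \<Rightarrow> nat \<Rightarrow> int" where
  "unit_wt i \<equiv> (\<lambda>k. if k = i then 1 else 0)"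

definition pos_roots :: "nat \<Rightarrow> (nat \<Rightarrow> int) set" where
  "pos_roots l =
     {(\<lambda>k. unit_wt i k - unit_wt j k) | i j. i < j \<and> j < l} \<union>
     {(\<lambda>k. unit_wt i k + unit_wt j k) | i j. i < j \<and> j < l} \<union>
     {(\<lambda>k. 2 * unit_wt i k) | i. i < l}"

definition wt_geq :: "nat \<Rightarrow> (nat \<Rightarrow> int) \<Rightarrow> (nat \<Rightarrow> int) \<Rightarrow> bool" where
  "wt_geq l a m \<longleftrightarrow>
     (\<exists>c :: (nat \<Rightarrow> int) \<Rightarrow> nat. \<forall>k<l. a k - m k = (\<Sum>\<beta>\<in>pos_roots l. int (c \<beta>) * \<beta> k))"

definition dominant :: "nat \<Rightarrow> (nat \<Rightarrow> int) \<Rightarrow> bool" where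
  "dominant l a \<longleftrightarrow>
     even (\<Sum>i<l. a i) \<and> (\<forall>i j. i \<le> j \<and> j < l \<longrightarrow> a j \<le> a i) \<and> (\<forall>i<l. 0 \<le> a i) \<and>
     (\<forall>i\<ge>l. a i = 0)"

definition gamma0 :: "nat \<Rightarrow> int" where
  "gamma0 = (\<lambda>k. if k < 2 then 1 else 0)"

definition small_wt :: "nat \<Rightarrow> (nat \<Rightarrow> int) \<Rightarrow> bool" where
  "small_wt l a \<longleftrightarrow> dominant l a \<and> \<not> wt_geq l a (\<lambda>k. 2 * gamma0 k)"

definition M_cell :: "nat \<Rightarrow> (nat \<Rightarrow> int) \<Rightarrow> complex fls mat set set" where
  "M_cell l a = gr_orbit l a \<inter> gr_minus l"

definition M_small :: "nat \<Rightarrow> complex fls mat set set" where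
  "M_small l = (\<Union>a \<in> {a. small_wt l a}. M_cell l a)"

definition pi_fiber :: "nat \<Rightarrow> complex mat \<Rightarrow> complex fls mat set set" where
  "pi_fiber l x = {p \<in> M_small l. pi_map l p = x}"

definition fiber_model :: "nat \<Rightarrow> complex mat \<Rightarrow> complex mat set" where
  "fiber_model l x =
     {z \<in> sp l. x * z + z * x = 0\<^sub>m (2*l) (2*l) \<and> z * z = 0\<^sub>m (2*l) (2*l) \<and>
        vec_space.rank (2*l) (z + (1/2) \<cdot>\<^sub>m (x * x)) \<le> 1}"

end

theory Submission
  imports Defs
begin

text \<open>
  The proof identifies the small part with the quadratic loops: \<open>M_small l\<close> consists of the points
  \<open>(1 + x t\<^sup>-\<^sup>1 + y t\<^sup>-\<^sup>2) \<cdot> e\<^sub>0\<close> in the congruence group with \<open>rk y \<le> 1\<close>. Writing \<open>\<sigma>(y)\<close>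
  for \<open>J y\<^sup>T J\<^sup>-\<^sup>1\<close> and \<open>z = y - x\<^sup>2/2\<close>
  and splitting the twisted unitarity relations into self-adjoint and skew parts, a rank one argument
  (a skew form vanishes on the diagonal) gives \<open>x \<sigma>(y) = y x = 0\<close>, hence \<open>x\<^sup>4 = 0\<close>, and the
  relations become \<open>z \<in> sp\<close>, \<open>x z + z x = 0\<close>, \<open>z\<^sup>2 = 0\<close>.

  That a small loop has a pole of order at most \<open>2\<close> with residual rank at most \<open>1\<close> is read off from
  \<open>n\<^sup>\<lambda>\<close>. For the converse one needs a twisted Cartan decomposition: choose hyperbolic pairs on which
  the loop has a pole of maximal order, split them off, and continue in the orthogonal complement; the
  exponents found this way are bounded by the pole order and the rank of \<open>y\<close>, so they form a small weight.

  For \<open>x = 0\<close> the fibre is the set of symmetric squares \<open>v v\<^sup>T J\<close>, the closure of the minimal orbit.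
  Its dimension is bounded below by the flag of coordinate subspaces, and above because a longer chain of
  irreducible closed sets would give more than \<open>2\<ell>\<close> algebraically independent polynomials in \<open>2\<ell>\<close> variables.
\<close>

text \<open>Over \<complex>((t)) the form is skew-hermitian for t -> -t, not alternating:
  \<open>herm v v\<close> is only odd in t. An integral vector is therefore isotropic at t = 0 but
  not necessarily beyond, and hyperbolic pairs have to be produced by solving quadratic equations;
  oddness is what puts the constant term 1 under the square root of the solution. Splitting off the
  largest pole first makes the exponents decrease, that is, dominant.

  The second obstacle is the determinant. Preserving the form gives only
  \<open>det A * bar (det A) = 1\<close>. Over \<complex>[1/t] this forces a constant, but over
  \<complex>[[t]] it allows series such as (1 + t)/(1 - t), so the two frames of the Cartan
  decomposition need not have determinant 1. Their determinants have constant term 1, because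
  symplectic matrices over \<complex> have determinant 1; this yields both the parity of the weight
  and a square root with which the frames are rescaled. The transvections behind the fact about
  symplectic determinants serve a second time, to show that the nonzero squares
  \<open>v v\<^sup>T J\<close> form a single orbit.\<close>

no_notation fps_nth (infixl "$" 75)

section \<open>Entries and inverses of matrices\<close>

lemma times_mat_index:
  assumes "A \<in> carrier_mat n m" "B \<in> carrier_mat m k" "i < n" "j < k"
  shows "(A * B) $$ (i,j) = (\<Sum>p<m. A $$ (i,p) * B $$ (p,j))"
  using assms by (auto simp: scalar_prod_def atLeast0LessThan intro!: sum.cong)

lemma mult_mat_vec_index:
  assumes "A \<in> carrier_mat n m" "v \<in> carrier_vec m" "i < n"
  shows "(A *\<^sub>v v) $ i = (\<Sum>p<m. A $$ (i,p) * v $ p)"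
  using assms by (auto simp: scalar_prod_def atLeast0LessThan intro!: sum.cong)

lemma mat_inverse_eqI:
  fixes A :: "'a :: field mat"
  assumes "A \<in> carrier_mat n n" "B \<in> carrier_mat n n" "A * B = 1\<^sub>m n"
  shows "the (mat_inverse A) = B"
proof -
  have BA: "B * A = 1\<^sub>m n" using mat_mult_left_right_inverse[OF assms] .
  have "A \<in> Units (ring_mat TYPE('a) n n)"
    using assms BA by (auto simp: Units_def ring_mat_def)
  then obtain C where C: "mat_inverse A = Some C"
    using mat_inverse(1)[OF assms(1), of n] by (cases "mat_inverse A") auto
  have C': "A * C = 1\<^sub>m n" "C \<in> carrier_mat n n" using mat_inverse(2)[OF assms(1) C] by auto
  have "C = (B * A) * C" using BA C' by simp
  also have "\<dots> = B" using C' assms by (simp add: assoc_mult_mat[of _ n n _ n _ n])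
  finally show ?thesis using C by simp
qed

text \<open>
  \<open>cj\<close> is the identity on \<open>\<complex>\<close> or \<open>t \<mapsto> -t\<close> on \<open>\<complex>((t))\<close>. The form \<open>herm\<close> is \<open>cj v\<^sup>T J w\<close>, and the
  \<open>\<sigma>\<close>-fixed matrices are the ones preserving it.
\<close>

locale skew_form =
  fixes cj :: "'a :: field \<Rightarrow> 'a" and l :: nat
  assumes cj_add: "cj (x + y) = cj x + cj y"
    and cj_mult: "cj (x * y) = cj x * cj y"
    and cj_cj [simp]: "cj (cj x) = x"
begin

abbreviation (input) "n \<equiv> 2 * l"

lemma cj_0 [simp]: "cj 0 = 0"
  using cj_add[of 0 0] by (metis add_cancel_right_right add_0)

lemma cj_1 [simp]: "cj 1 = 1"
  using cj_mult[of 1 "cj 1"] by simp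

lemma cj_uminus [simp]: "cj (- x) = - cj x"
  using cj_add[of "- x" x] by (simp add: eq_neg_iff_add_eq_0)

lemma cj_sum: "cj (\<Sum>i\<in>S. f i) = (\<Sum>i\<in>S. cj (f i))"
  by (induction S rule: infinite_finite_induct) (auto simp: cj_add)

lemma cj_power: "cj (x ^ k) = cj x ^ k"
  by (induction k) (auto simp: cj_mult)

lemma cj_sign [simp]: "cj ((- 1) ^ k) = (- 1) ^ k"
  by (simp add: cj_power)

lemma cj_eq_0 [simp]: "cj x = 0 \<longleftrightarrow> x = 0"
  by (metis cj_0 cj_cj)

lemma cj_inverse: "cj (inverse x) = inverse (cj x)"
proof (cases "x = 0")
  case False
  then have "cj x * cj (inverse x) = 1" by (simp flip: cj_mult)
  then show ?thesis by (metis inverse_unique)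
qed simp

lemma cj_hom: "comm_ring_hom cj"
  by unfold_locales (auto simp: cj_add cj_mult)

text \<open>This is J (cj A)^T J^-1 written out in entries (see \<open>adj_eq_Jmat\<close>), so that
  computations with it meet no matrix inverse.\<close>

definition adj :: "'a mat \<Rightarrow> 'a mat" where
  "adj A = mat n n (\<lambda>(i,j). (-1)^i * (-1)^j * cj (A $$ (n - Suc j, n - Suc i)))"

definition unitary :: "'a mat \<Rightarrow> bool" where
  "unitary A \<longleftrightarrow> A \<in> carrier_mat n n \<and> A * adj A = 1\<^sub>m n"

definition herm :: "'a vec \<Rightarrow> 'a vec \<Rightarrow> 'a" where
  "herm v w = (\<Sum>i<n. (-1)^i * cj (v $ i) * w $ (n - Suc i))"

text \<open>Since 2l is even, i and 2l - 1 - i have opposite parity. This one sign is the source of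
  the skewness of J.\<close>

lemma sign_flip: "i < n \<Longrightarrow> (-1 :: 'a) ^ (n - Suc i) = - ((-1) ^ i)"
  by (cases "even i") auto

lemma sign_square [simp]: "(-1 :: 'a)^i * ((-1)^i * x) = x"
  by (cases "even i") auto

lemma adj_carrier [simp]: "adj A \<in> carrier_mat n n"
  by (simp add: adj_def)

lemma adj_dim [simp]: "dim_row (adj A) = n" "dim_col (adj A) = n"
  by (simp_all add: adj_def)

lemma adj_index:
  "i < n \<Longrightarrow> j < n \<Longrightarrow> adj A $$ (i,j) = (-1)^i * (-1)^j * cj (A $$ (n - Suc j, n - Suc i))"
  by (simp add: adj_def)

lemma adj_adj [simp]:
  assumes "A \<in> carrier_mat n n" shows "adj (adj A) = A"
proof (rule eq_matI)
  fix i j assume "i < dim_row A" "j < dim_col A"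
  then have i: "i < n" and j: "j < n" using assms by auto
  have "adj (adj A) $$ (i,j) = (-1)^i * ((-1)^i * ((-1)^j * ((-1)^j * A $$ (i,j))))"
    using i j by (simp add: adj_index cj_mult sign_flip)
  then show "adj (adj A) $$ (i,j) = A $$ (i,j)" by (simp only: sign_square)
qed (use assms in auto)

lemma adj_one [simp]: "adj (1\<^sub>m n) = 1\<^sub>m n"
  by (rule eq_matI) (auto simp: adj_index)

lemma adj_add: "A \<in> carrier_mat n n \<Longrightarrow> B \<in> carrier_mat n n \<Longrightarrow> adj (A + B) = adj A + adj B"
  by (rule eq_matI) (auto simp: adj_index cj_add algebra_simps)

lemma adj_uminus: "A \<in> carrier_mat n n \<Longrightarrow> adj (- A) = - adj A"
  by (rule eq_matI) (auto simp: adj_index)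

lemma adj_smult: "A \<in> carrier_mat n n \<Longrightarrow> adj (c \<cdot>\<^sub>m A) = cj c \<cdot>\<^sub>m adj A"
  by (rule eq_matI) (auto simp: adj_index cj_mult)

lemma adj_mult:
  assumes "A \<in> carrier_mat n n" "B \<in> carrier_mat n n"
  shows "adj (A * B) = adj B * adj A"
proof (rule eq_matI)
  fix i j assume ij: "i < dim_row (adj B * adj A)" "j < dim_col (adj B * adj A)"
  then have i: "i < n" and j: "j < n" by auto
  have "adj (A * B) $$ (i,j) =
      (\<Sum>p<n. (-1)^i * (-1)^j * (cj (A $$ (n - Suc j, p)) * cj (B $$ (p, n - Suc i))))"
    using i j assms by (simp add: adj_index times_mat_index[of _ n n _ n] cj_sum cj_mult sum_distrib_left
        del: index_mult_mat)
  also have "\<dots> = (\<Sum>p<n. (-1)^i * (-1)^j * (cj (A $$ (n - Suc j, n - Suc p)) * cj (B $$ (n - Suc p, n - Suc i))))"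
    by (subst sum.nat_diff_reindex[symmetric]) simp
  also have "\<dots> = (\<Sum>p<n. adj B $$ (i,p) * adj A $$ (p,j))"
    using i j by (intro sum.cong) (auto simp: adj_index mult_ac)
  also have "\<dots> = (adj B * adj A) $$ (i,j)"
    using i j by (subst times_mat_index[of _ n n _ n]) auto
  finally show "adj (A * B) $$ (i,j) = (adj B * adj A) $$ (i,j)" .
qed auto

lemma unitary_carrier [simp]: "unitary A \<Longrightarrow> A \<in> carrier_mat n n"
  by (simp add: unitary_def)

lemma unitary_adj_left: "unitary A \<Longrightarrow> adj A * A = 1\<^sub>m n"
  unfolding unitary_def using mat_mult_left_right_inverse[of A n "adj A"] by simp

lemma unitaryI_left: "A \<in> carrier_mat n n \<Longrightarrow> adj A * A = 1\<^sub>m n \<Longrightarrow> unitary A"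
  unfolding unitary_def using mat_mult_left_right_inverse[of "adj A" n A] by simp

lemma unitary_mult:
  assumes "unitary A" "unitary B" shows "unitary (A * B)"
proof -
  have [simp]: "A \<in> carrier_mat n n" "B \<in> carrier_mat n n" using assms by auto
  have "A * B * (adj B * adj A) = A * (B * (adj B * adj A))"
    by (rule assoc_mult_mat[of _ n n _ n _ n]) auto
  also have "B * (adj B * adj A) = B * adj B * adj A"
    by (rule assoc_mult_mat[of _ n n _ n _ n, symmetric]) auto
  finally have "A * B * adj (A * B) = A * (B * adj B * adj A)"
    by (simp add: adj_mult)
  then show ?thesis using assms by (auto simp: unitary_def intro!: mult_carrier_mat[of _ n n])
qed

lemma unitary_adj: "unitary A \<Longrightarrow> unitary (adj A)"
  using unitary_adj_left[of A] by (simp add: unitary_def)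

lemma unitary_one [simp]: "unitary (1\<^sub>m n)"
  by (simp add: unitary_def)

lemma mat_inverse_unitary: "unitary A \<Longrightarrow> the (mat_inverse A) = adj A"
  by (rule mat_inverse_eqI) (auto simp: unitary_def)

lemma herm_skew: "herm w v = - cj (herm v w)"
proof -
  have "herm w v = (\<Sum>i<n. (-1)^(n - Suc i) * cj (w $ (n - Suc i)) * v $ (n - Suc (n - Suc i)))"
    unfolding herm_def by (subst sum.nat_diff_reindex[symmetric]) simp
  also have "\<dots> = (\<Sum>i<n. - cj ((-1)^i * cj (v $ i) * w $ (n - Suc i)))"
  proof (intro sum.cong refl)
    fix i assume "i \<in> {..<n}"
    then have "i < n" "n - Suc (n - Suc i) = i" by auto
    then show "(-1)^(n - Suc i) * cj (w $ (n - Suc i)) * v $ (n - Suc (n - Suc i)) =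
        - cj ((-1)^i * cj (v $ i) * w $ (n - Suc i))"
      by (simp only: sign_flip cj_mult cj_cj cj_sign) (simp add: mult_ac)
  qed
  finally show ?thesis by (simp add: herm_def cj_sum sum_negf)
qed

lemma herm_add_right: "v \<in> carrier_vec n \<Longrightarrow> w \<in> carrier_vec n \<Longrightarrow> herm u (v + w) = herm u v + herm u w"
  unfolding herm_def sum.distrib[symmetric] by (rule sum.cong) (auto simp: distrib_left)

lemma herm_add_left: "v \<in> carrier_vec n \<Longrightarrow> w \<in> carrier_vec n \<Longrightarrow> herm (v + w) u = herm v u + herm w u"
  unfolding herm_def sum.distrib[symmetric] by (rule sum.cong) (auto simp: cj_add distrib_left distrib_right)

lemma herm_smult_right: "v \<in> carrier_vec n \<Longrightarrow> herm u (c \<cdot>\<^sub>v v) = c * herm u v"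
  unfolding herm_def sum_distrib_left by (rule sum.cong) auto

lemma herm_smult_left: "v \<in> carrier_vec n \<Longrightarrow> herm (c \<cdot>\<^sub>v v) u = cj c * herm v u"
  unfolding herm_def sum_distrib_left by (rule sum.cong) (auto simp: cj_mult)

lemma herm_unit_left:
  assumes "i < n" "v \<in> carrier_vec n" shows "herm (unit_vec n i) v = (-1)^i * v $ (n - Suc i)"
proof -
  have "herm (unit_vec n i) v = (\<Sum>k<n. if k = i then (-1)^i * v $ (n - Suc i) else 0)"
    unfolding herm_def using assms by (intro sum.cong) (auto simp: unit_vec_def)
  then show ?thesis using assms by simp
qed

lemma herm_adj:
  assumes A: "A \<in> carrier_mat n n" and v: "v \<in> carrier_vec n" and w: "w \<in> carrier_vec n"
  shows "herm (A *\<^sub>v v) w = herm v (adj A *\<^sub>v w)"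
proof -
  have "herm (A *\<^sub>v v) w = (\<Sum>i<n. \<Sum>j<n. (-1)^i * cj (A $$ (i,j)) * cj (v $ j) * w $ (n - Suc i))"
    unfolding herm_def using A v
    by (intro sum.cong) (auto simp: mult_mat_vec_index[of _ n n] cj_sum cj_mult sum_distrib_left sum_distrib_right
        mult.assoc simp del: index_mult_mat_vec)
  also have "\<dots> = (\<Sum>j<n. \<Sum>i<n. (-1)^i * cj (A $$ (i,j)) * cj (v $ j) * w $ (n - Suc i))"
    by (rule sum.swap)
  also have "\<dots> = (\<Sum>j<n. (-1)^j * cj (v $ j) * (adj A *\<^sub>v w) $ (n - Suc j))"
  proof (rule sum.cong[OF refl])
    fix j assume "j \<in> {..<n}"
    then have j: "j < n" by simp
    have "(adj A *\<^sub>v w) $ (n - Suc j) = (\<Sum>q<n. adj A $$ (n - Suc j, q) * w $ q)"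
      using j w by (intro mult_mat_vec_index[of _ n n]) auto
    also have "\<dots> = (\<Sum>i<n. adj A $$ (n - Suc j, n - Suc i) * w $ (n - Suc i))"
      by (subst sum.nat_diff_reindex[symmetric]) simp
    also have "\<dots> = (\<Sum>i<n. (-1)^j * ((-1)^i * cj (A $$ (i,j)) * w $ (n - Suc i)))"
      using j by (intro sum.cong) (auto simp: adj_index sign_flip)
    finally show "(\<Sum>i<n. (-1)^i * cj (A $$ (i,j)) * cj (v $ j) * w $ (n - Suc i)) =
        (-1)^j * cj (v $ j) * (adj A *\<^sub>v w) $ (n - Suc j)"
      by (simp add: sum_distrib_left mult_ac)
  qed
  finally show ?thesis by (simp add: herm_def)
qed

lemma unitary_herm:
  assumes "unitary A" "v \<in> carrier_vec n" "w \<in> carrier_vec n"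
  shows "herm (A *\<^sub>v v) (A *\<^sub>v w) = herm v w"
proof -
  have "herm (A *\<^sub>v v) (A *\<^sub>v w) = herm v (adj A *\<^sub>v (A *\<^sub>v w))"
    using assms by (intro herm_adj) (auto intro!: mult_mat_vec_carrier[of _ n n])
  also have "adj A *\<^sub>v (A *\<^sub>v w) = (adj A * A) *\<^sub>v w"
    using assms by (intro assoc_mult_mat_vec[symmetric]) auto
  finally show ?thesis using assms by (simp add: unitary_adj_left)
qed

definition J_entry :: "nat \<Rightarrow> nat \<Rightarrow> 'a" where
  "J_entry i j = (if Suc (i + j) = n then (-1)^i else 0)"

lemma herm_unit_unit: "i < n \<Longrightarrow> j < n \<Longrightarrow> herm (unit_vec n i) (unit_vec n j) = J_entry i j"
  by (auto simp: herm_unit_left J_entry_def)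

text \<open>Pairing with the unit vector of index n - 1 - i reads off entry i up to sign, so the
  entries of \<open>adj P * P\<close> are the pairings of the columns. This turns a full frame of
  vectors into a group element.\<close>

lemma unitary_columns:
  fixes h :: "nat \<Rightarrow> 'a vec"
  assumes "\<And>i. i < n \<Longrightarrow> h i \<in> carrier_vec n"
    and H: "\<And>i j. i < n \<Longrightarrow> j < n \<Longrightarrow> herm (h i) (h j) = J_entry i j"
  shows "unitary (mat n n (\<lambda>(i,j). h j $ i))"
proof (rule unitaryI_left)
  let ?P = "mat n n (\<lambda>(i,j). h j $ i)"
  show P: "?P \<in> carrier_mat n n" by simp
  have col: "?P *\<^sub>v unit_vec n j = h j" if "j < n" for j
    using that assms(1)[OF that] by (intro eq_vecI) auto
  show "adj ?P * ?P = 1\<^sub>m n"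
  proof (rule eq_matI)
    fix i j assume "i < dim_row (1\<^sub>m n :: 'a mat)" "j < dim_col (1\<^sub>m n :: 'a mat)"
    then have i: "i < n" and j: "j < n" by auto
    let ?v = "adj ?P *\<^sub>v (?P *\<^sub>v unit_vec n j)"
    have "(adj ?P * ?P) $$ (i,j) = (adj ?P * ?P *\<^sub>v unit_vec n j) $ i"
      using i j by simp
    also have "\<dots> = ?v $ i"
      by (rule arg_cong[of _ _ "\<lambda>v. v $ i"], rule assoc_mult_mat_vec[of _ n n _ n]) auto
    also have "\<dots> = (-1)^(n - Suc i) * herm (unit_vec n (n - Suc i)) ?v"
      using i j by (subst herm_unit_left) (auto intro!: mult_mat_vec_carrier[of _ n n])
    also have "herm (unit_vec n (n - Suc i)) ?v = herm (h (n - Suc i)) (h j)"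
      using i j assms(1) by (subst herm_adj[symmetric]) (auto simp: col)
    also have "\<dots> = J_entry (n - Suc i) j" using i j by (intro H) auto
    finally show "(adj ?P * ?P) $$ (i,j) = 1\<^sub>m n $$ (i,j)"
      using i j by (auto simp: J_entry_def)
  qed auto
qed

lemma Jmat_carrier [simp]: "(Jmat l :: 'a mat) \<in> carrier_mat n n"
  by (simp add: Jmat_def)

lemma Jmat_dim [simp]: "dim_row (Jmat l :: 'a mat) = n" "dim_col (Jmat l :: 'a mat) = n"
  by (simp_all add: Jmat_def)

lemma Jmat_index: "i < n \<Longrightarrow> j < n \<Longrightarrow> (Jmat l :: 'a mat) $$ (i,j) = J_entry i j"
  by (auto simp: Jmat_def J_entry_def)

lemma J_entry_eq: "i < n \<Longrightarrow> j < n \<Longrightarrow> J_entry i j = (if j = n - Suc i then (-1)^i else 0)"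
  by (auto simp: J_entry_def)

lemma J_entry_eq': "i < n \<Longrightarrow> j < n \<Longrightarrow> J_entry i j = (if i = n - Suc j then - ((-1)^j) else 0)"
  by (auto simp: J_entry_def sign_flip)

lemma Jmat_mult_index:
  assumes "B \<in> carrier_mat n k" "i < n" "j < k"
  shows "((Jmat l :: 'a mat) * B) $$ (i,j) = (-1)^i * B $$ (n - Suc i, j)"
  using assms by (simp add: times_mat_index[of _ n n _ k] Jmat_index J_entry_eq if_distrib[of "\<lambda>x. x * _"]
      cong: if_cong del: index_mult_mat)

lemma mult_Jmat_index:
  assumes "B \<in> carrier_mat k n" "i < k" "j < n"
  shows "(B * (Jmat l :: 'a mat)) $$ (i,j) = - ((-1)^j * B $$ (i, n - Suc j))"
  using assms by (simp add: times_mat_index[of _ k n _ n] Jmat_index J_entry_eq' if_distrib[of "\<lambda>x. _ * x"] mult.commute[of "B $$ _"]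
      cong: if_cong del: index_mult_mat)

lemma Jmat_square: "(Jmat l :: 'a mat) * Jmat l = - 1\<^sub>m n"
  by (rule eq_matI) (auto simp: Jmat_mult_index[of _ n] Jmat_index J_entry_def sign_flip simp del: index_mult_mat(1))

lemma Jmat_inverse: "the (mat_inverse (Jmat l :: 'a mat)) = - Jmat l"
  by (rule mat_inverse_eqI[of _ n]) (simp_all add: Jmat_square uminus_carrier_mat)

lemma adj_eq_Jmat:
  assumes "A \<in> carrier_mat n n"
  shows "adj A = Jmat l * (map_mat cj A)\<^sup>T * the (mat_inverse (Jmat l))"
proof (rule eq_matI)
  fix i j assume "i < dim_row (Jmat l * (map_mat cj A)\<^sup>T * the (mat_inverse (Jmat l)))"
    "j < dim_col (Jmat l * (map_mat cj A)\<^sup>T * the (mat_inverse (Jmat l)))"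
  then have "i < n" "j < n" by (auto simp: Jmat_inverse)
  moreover have "Jmat l * (map_mat cj A)\<^sup>T \<in> carrier_mat n n"
    using assms by (intro mult_carrier_mat[of _ n n]) auto
  ultimately show "adj A $$ (i,j) = (Jmat l * (map_mat cj A)\<^sup>T * the (mat_inverse (Jmat l))) $$ (i,j)"
    using assms by (simp add: Jmat_inverse adj_index mult_Jmat_index[of _ n] Jmat_mult_index[of _ n]
        del: index_mult_mat(1))
qed (auto simp: Jmat_inverse)

text \<open>Because the two transposes cancel between the factors J,
  \<open>sigma_G l (map_mat cj A)\<close> is always an inverse of \<open>adj A\<close>; hence being
  fixed means that \<open>adj A\<close> inverts A. From here on the involution of the group appears
  only through \<open>unitary\<close>.\<close>

lemma sigma_G_fixed_iff:
  assumes A: "A \<in> carrier_mat n n" and d: "det A \<noteq> 0"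
  shows "sigma_G l (map_mat cj A) = A \<longleftrightarrow> unitary A"
proof -
  interpret comm_ring_hom cj by (rule cj_hom)
  let ?J = "Jmat l :: 'a mat" and ?B = "map_mat cj A"
  have [simp]: "?B \<in> carrier_mat n n" using A by simp
  have dB: "det ?B \<noteq> 0" using d by (simp add: hom_det)
  have "?B \<in> Units (ring_mat TYPE('a) n n)"
    by (rule det_non_zero_imp_unit[OF _ dB]) (use A in simp)
  then obtain B' where B': "B' \<in> carrier_mat n n" "?B * B' = 1\<^sub>m n" "B' * ?B = 1\<^sub>m n"
    unfolding Units_def ring_mat_simps by blast
  have inv: "the (mat_inverse ?B) = B'" using B' A by (intro mat_inverse_eqI[of _ n]) auto
  define S where "S = sigma_G l ?B"
  have S: "S = - (?J * B'\<^sup>T * ?J)"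
    using carrier_matD[OF B'(1)] by (simp add: S_def sigma_G_def inv Jmat_inverse)
  have aA: "adj A = - (?J * ?B\<^sup>T * ?J)"
    using A carrier_matD[OF A] by (simp add: adj_eq_Jmat Jmat_inverse)
  have Sc: "S \<in> carrier_mat n n" using B' by (auto simp: S intro!: mult_carrier_mat[of _ n n])
  note assoc = assoc_mult_mat[of _ n n _ n _ n]
  have [simp]: "B'\<^sup>T \<in> carrier_mat n n" "?B\<^sup>T \<in> carrier_mat n n" using A B' by auto
  have m: "X * Y \<in> carrier_mat n n" if "X \<in> carrier_mat n n" "Y \<in> carrier_mat n n" for X Y :: "'a mat"
    using that by simp
  have "S * adj A = ?J * B'\<^sup>T * ?J * (?J * ?B\<^sup>T * ?J)"
    by (simp add: S aA)
  also have "\<dots> = ?J * (B'\<^sup>T * ((?J * ?J) * (?B\<^sup>T * ?J)))"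
    using B' A by (simp add: assoc m)
  also have "\<dots> = - (?J * (B'\<^sup>T * (?B\<^sup>T * ?J)))"
    using B' A by (simp add: Jmat_square m left_mult_one_mat[of _ n n])
  also have "B'\<^sup>T * (?B\<^sup>T * ?J) = (B'\<^sup>T * ?B\<^sup>T) * ?J"
    by (rule assoc[symmetric]) (use A B' in auto)
  also have "B'\<^sup>T * ?B\<^sup>T = (?B * B')\<^sup>T"
    by (rule transpose_mult[symmetric]) (use A B' in auto)
  also have "- (?J * ((?B * B')\<^sup>T * ?J)) = 1\<^sub>m n"
    using B' left_mult_one_mat[of ?J n n] by (simp add: Jmat_square)
  finally have SA: "S * adj A = 1\<^sub>m n" .
  show ?thesis
  proof
    assume "sigma_G l ?B = A" then show "unitary A" using SA A by (simp add: S_def unitary_def)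
  next
    assume u: "unitary A"
    have "S = S * (adj A * A)" using Sc unitary_adj_left[OF u] by simp
    also have "\<dots> = (S * adj A) * A" using Sc A by (intro assoc[symmetric]) auto
    finally show "sigma_G l ?B = A" using SA A by (simp add: S_def)
  qed
qed

end

section \<open>Loops\<close>

definition bar :: "complex fls \<Rightarrow> complex fls" where
  "bar f = fls_compose_fps f (- fps_X)"

lemma bar_nth: "fls_nth (bar f) k = (-1) powi k * fls_nth f k"
proof -
  have eq: "- fps_X = fps_const (-1) * (fps_X :: complex fps)"
    by (metis fps_const_neg fps_const_1_eq_1 mult_minus_left mult_1)
  show ?thesis
    unfolding bar_def eq by (subst fls_nth_fls_compose_fps_linear) (auto simp: mult.commute)
qed

interpretation lp: skew_form bar l for l :: nat
proof
  fix x y :: "complex fls"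
  show "bar (x + y) = bar x + bar y" by (simp add: fls_eq_iff bar_nth algebra_simps)
  show "bar (x * y) = bar x * bar y" unfolding bar_def by (rule fls_compose_fps_mult) auto
  have "(-1 :: complex) powi k * ((-1) powi k * c) = c" for k c
    by (cases "even k") (simp_all add: power_int_minus_left)
  then show "bar (bar x) = x"
    by (simp add: fls_eq_iff bar_nth)
qed

interpretation cx: skew_form "id :: complex \<Rightarrow> complex" l for l :: nat
  by unfold_locales auto

lemma bar_const [simp]: "bar (fls_const c) = fls_const c"
  by (simp add: bar_def)

lemma bar_X_intpow: "bar (fls_X_intpow k) = fls_const ((-1) powi k) * fls_X_intpow k"
proof (rule fls_eqI)
  fix m
  have X: "fls_nth (fls_X_intpow k :: complex fls) m = (if m = k then 1 else 0)" by simp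
  show "fls_nth (bar (fls_X_intpow k)) m = fls_nth (fls_const ((-1) powi k) * fls_X_intpow k) m"
    unfolding bar_nth fls_mult_const_nth X by simp
qed

lemma twisted_iff: "A \<in> twisted l R \<longleftrightarrow> A \<in> SL (2*l) R \<and> lp.unitary l A"
  using lp.sigma_G_fixed_iff[of A l]
  by (auto simp: twisted_def sigma_loop_def SL_def bar_def[abs_def])

lemma Sp_iff: "g \<in> Sp l \<longleftrightarrow> g \<in> SL (2*l) UNIV \<and> cx.unitary l g"
proof -
  have "map_mat id g = g" by (rule eq_matI) auto
  then show ?thesis using cx.sigma_G_fixed_iff[of g l] by (auto simp: Sp_def SL_def)
qed

lemma sigma_g_eq: "A \<in> carrier_mat (2*l) (2*l) \<Longrightarrow> sigma_g l A = - cx.adj l A"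
proof -
  have "map_mat id A = A" by (rule eq_matI) auto
  then show "A \<in> carrier_mat (2*l) (2*l) \<Longrightarrow> sigma_g l A = - cx.adj l A"
    by (simp add: sigma_g_def cx.adj_eq_Jmat)
qed

section \<open>Matrices over the power series and over the polynomials in 1/t\<close>

definition mats :: "nat \<Rightarrow> complex fls set \<Rightarrow> complex fls mat set" where
  "mats n R = {A \<in> carrier_mat n n. \<forall>i<n. \<forall>j<n. A $$ (i,j) \<in> R}"

abbreviation c0 :: "complex fls mat \<Rightarrow> complex mat" where
  "c0 \<equiv> map_mat (\<lambda>f. fls_nth f 0)"

abbreviation hat :: "complex mat \<Rightarrow> complex fls mat" where
  "hat \<equiv> map_mat fls_const"

lemma SL_iff: "A \<in> SL n R \<longleftrightarrow> A \<in> mats n R \<and> det A = 1"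
  by (auto simp: SL_def mats_def)

text \<open>What \<complex>[[t]] and \<complex>[1/t] share, and \<complex>((t)) lacks: the
  coefficient of t^0 is multiplicative. It is evaluation at t = 0 in the first ring and at infinity
  in the second, so reduction of matrices, adjoints and determinants can be treated once for
  both.\<close>

locale coeff_ring =
  fixes R :: "complex fls set"
  assumes const_closed [intro, simp]: "fls_const c \<in> R"
    and add_closed [intro]: "f \<in> R \<Longrightarrow> g \<in> R \<Longrightarrow> f + g \<in> R"
    and mult_closed [intro]: "f \<in> R \<Longrightarrow> g \<in> R \<Longrightarrow> f * g \<in> R"
    and bar_closed [intro]: "f \<in> R \<Longrightarrow> bar f \<in> R"
    and coeff0_mult: "f \<in> R \<Longrightarrow> g \<in> R \<Longrightarrow> fls_nth (f * g) 0 = fls_nth f 0 * fls_nth g 0"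
begin

lemma zero_closed [simp]: "0 \<in> R" using const_closed[of 0] by (simp del: const_closed)
lemma one_closed [simp]: "1 \<in> R" using const_closed[of 1] by (simp del: const_closed)

lemma uminus_closed [intro]: "f \<in> R \<Longrightarrow> - f \<in> R"
proof -
  have "fls_const (-1) * f = - f" by (rule fls_eqI) simp
  then show "f \<in> R \<Longrightarrow> - f \<in> R" using mult_closed[OF const_closed[of "-1"], of f] by simp
qed

lemma sum_closed: "(\<And>i. i \<in> S \<Longrightarrow> f i \<in> R) \<Longrightarrow> sum f S \<in> R"
  by (induction S rule: infinite_finite_induct) auto

lemma prod_closed:
  "(\<And>i. i \<in> S \<Longrightarrow> f i \<in> R) \<Longrightarrow> prod f S \<in> R \<and> fls_nth (prod f S) 0 = (\<Prod>i\<in>S. fls_nth (f i) 0)"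
  by (induction S rule: infinite_finite_induct) (auto simp: coeff0_mult)

lemma sign_closed [simp]: "(-1)^i \<in> R"
  by (induction i) auto

lemma coeff0_sum: "fls_nth (sum f S) 0 = (\<Sum>i\<in>S. fls_nth (f i) 0)"
  by (induction S rule: infinite_finite_induct) auto

lemma coeff0_sign: "fls_nth ((-1)^i :: complex fls) 0 = (-1)^i"
  by (cases "even i") auto

lemma mats_mult: "A \<in> mats n R \<Longrightarrow> B \<in> mats n R \<Longrightarrow> A * B \<in> mats n R"
  by (auto simp: mats_def times_mat_index[of _ n n _ n] simp del: index_mult_mat(1) intro!: sum_closed)

lemma mats_adj: "A \<in> mats (2*l) R \<Longrightarrow> lp.adj l A \<in> mats (2*l) R"
  unfolding mats_def
proof (clarsimp simp: lp.adj_index)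
  fix i j assume "i < 2*l" "j < 2*l" "\<forall>i<2*l. \<forall>j<2*l. A $$ (i, j) \<in> R"
  moreover from this have "2*l - Suc j < 2*l" "2*l - Suc i < 2*l" by auto
  ultimately show "(- 1) ^ i * (- 1) ^ j * bar (A $$ (2*l - Suc j, 2*l - Suc i)) \<in> R"
    by (intro mult_closed bar_closed sign_closed) blast
qed

lemma mats_hat: "C \<in> carrier_mat n n \<Longrightarrow> hat C \<in> mats n R"
  by (auto simp: mats_def)

lemma c0_mult: "A \<in> mats n R \<Longrightarrow> B \<in> mats n R \<Longrightarrow> c0 (A * B) = c0 A * c0 B"
  by (rule eq_matI) (auto simp: mats_def times_mat_index[of _ n n _ n] coeff0_sum coeff0_mult
      simp del: index_mult_mat(1))

lemma c0_adj: "A \<in> mats (2*l) R \<Longrightarrow> c0 (lp.adj l A) = cx.adj l (c0 A)"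
proof (rule eq_matI)
  fix i j assume A: "A \<in> mats (2*l) R"
    and "i < dim_row (cx.adj l (c0 A))" "j < dim_col (cx.adj l (c0 A))"
  then have ij: "i < 2*l" "j < 2*l" "2*l - Suc j < 2*l" "2*l - Suc i < 2*l" by auto
  have Ac: "A \<in> carrier_mat (2*l) (2*l)" using A by (auto simp: mats_def)
  have "bar (A $$ (2*l - Suc j, 2*l - Suc i)) \<in> R" using A ij by (auto simp: mats_def)
  then show "c0 (lp.adj l A) $$ (i,j) = cx.adj l (c0 A) $$ (i,j)"
    using ij Ac by (simp add: lp.adj_index cx.adj_index coeff0_mult coeff0_sign mult_closed bar_nth)
qed auto

lemma det_closed: "A \<in> mats n R \<Longrightarrow> det A \<in> R"
  unfolding mats_def
  by (auto simp: det_def' sign_def intro!: sum_closed mult_closed prod_closed[THEN conjunct1] uminus_closed permutes_in_image)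

lemma c0_det:
  assumes "A \<in> mats n R" shows "det (c0 A) = fls_nth (det A) 0"
proof -
  have A: "A \<in> carrier_mat n n" and R: "\<And>i j. i < n \<Longrightarrow> j < n \<Longrightarrow> A $$ (i,j) \<in> R"
    using assms by (auto simp: mats_def)
  have "fls_nth (signof p * (\<Prod>i = 0..<n. A $$ (i, p i))) 0 = signof p * (\<Prod>i = 0..<n. c0 A $$ (i, p i))"
    if p: "p permutes {0..<n}" for p
  proof -
    have pi: "p i < n" if "i < n" for i using p that by (auto dest: permutes_in_image[of _ _ i])
    have pr: "(\<Prod>i = 0..<n. A $$ (i, p i)) \<in> R \<and>
       fls_nth (\<Prod>i = 0..<n. A $$ (i, p i)) 0 = (\<Prod>i = 0..<n. fls_nth (A $$ (i, p i)) 0)"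
      by (rule prod_closed) (auto simp: R pi)
    have "(\<Prod>i = 0..<n. fls_nth (A $$ (i, p i)) 0) = (\<Prod>i = 0..<n. c0 A $$ (i, p i))"
      using A pi by (intro prod.cong) auto
    then show ?thesis using pr by (auto simp: sign_def)
  qed
  then show ?thesis using A by (simp add: det_def'[of _ n] coeff0_sum)
qed

lemma twisted_one: "1\<^sub>m (2*l) \<in> twisted l R"
  by (auto simp: twisted_iff SL_iff mats_def)

lemma twisted_mult: "A \<in> twisted l R \<Longrightarrow> B \<in> twisted l R \<Longrightarrow> A * B \<in> twisted l R"
  by (auto simp: twisted_iff SL_iff mats_mult lp.unitary_mult det_mult[of _ "2*l"])

lemma twisted_adj:
  assumes "A \<in> twisted l R" shows "lp.adj l A \<in> twisted l R"
proof -
  from assms have A: "A \<in> mats (2*l) R" "lp.unitary l A" "det A = 1" by (auto simp: twisted_iff SL_iff)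
  have "det (A * lp.adj l A) = det A * det (lp.adj l A)"
    using A by (intro det_mult[of _ "2*l"]) auto
  then have "det (lp.adj l A) = 1" using A by (simp add: lp.unitary_def)
  then show ?thesis using A by (simp add: twisted_iff SL_iff mats_adj lp.unitary_adj)
qed

lemma unitary_c0:
  assumes "A \<in> mats (2*l) R" "lp.unitary l A"
  shows "cx.unitary l (c0 A)"
proof -
  have "c0 A * cx.adj l (c0 A) = c0 (A * lp.adj l A)"
    using assms by (simp add: c0_mult[of _ "2*l"] mats_adj c0_adj)
  also have "\<dots> = 1\<^sub>m (2*l)" using assms(2) by (auto simp: lp.unitary_def intro!: eq_matI)
  finally show ?thesis using assms by (simp add: cx.unitary_def mats_def)
qed

lemma hat_adj:
  assumes "C \<in> carrier_mat (2*l) (2*l)" shows "lp.adj l (hat C) = hat (cx.adj l C)"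
proof (rule eq_matI)
  fix i j assume "i < dim_row (hat (cx.adj l C))" "j < dim_col (hat (cx.adj l C))"
  then have ij: "i < 2*l" "j < 2*l" "2*l - Suc j < 2*l" "2*l - Suc i < 2*l" by auto
  have sgn: "(-1)^k = (fls_const ((-1)^k) :: complex fls)" for k by (cases "even k") auto
  show "lp.adj l (hat C) $$ (i,j) = hat (cx.adj l C) $$ (i,j)"
    using ij assms by (simp add: lp.adj_index cx.adj_index)
      (simp only: sgn fls_const_mult_const)
qed auto

lemma hat_twisted:
  assumes "cx.unitary l C" "det C = 1" shows "hat C \<in> twisted l R"
proof -
  have C: "C \<in> carrier_mat (2*l) (2*l)" using assms by auto
  have h: "comm_ring_hom (fls_const :: complex \<Rightarrow> complex fls)"
    by unfold_locales (auto simp: fls_plus_const fls_const_mult_const)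
  interpret comm_ring_hom "fls_const :: complex \<Rightarrow> complex fls" by (rule h)
  have "hat C * hat (cx.adj l C) = hat (C * cx.adj l C)"
    using C by (simp add: mat_hom_mult[of _ "2*l" "2*l" _ "2*l"])
  then show ?thesis using assms C
    by (auto simp: twisted_iff SL_iff mats_hat lp.unitary_def cx.unitary_def hat_adj mat_hom_one hom_det)
qed

end

interpretation RO: coeff_ring ring_O
proof
  have iff: "f \<in> ring_O \<longleftrightarrow> (\<forall>k<0. fls_nth f k = 0)" for f :: "complex fls"
  proof
    assume "\<forall>k<0. fls_nth f k = 0"
    then have "f = fps_to_fls (fls_regpart f)" by (auto simp: fls_eq_iff)
    then show "f \<in> ring_O" by blast
  qed auto
  fix f g :: "complex fls" and c
  show "fls_const c \<in> ring_O" by (auto simp: iff)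
  show "f \<in> ring_O \<Longrightarrow> bar f \<in> ring_O" by (auto simp: iff bar_nth)
  show "f \<in> ring_O \<Longrightarrow> g \<in> ring_O \<Longrightarrow> f + g \<in> ring_O" by (auto simp: iff)
  show "f \<in> ring_O \<Longrightarrow> g \<in> ring_O \<Longrightarrow> f * g \<in> ring_O"
    by (auto simp flip: fls_times_fps_to_fls)
  show "f \<in> ring_O \<Longrightarrow> g \<in> ring_O \<Longrightarrow> fls_nth (f * g) 0 = fls_nth f 0 * fls_nth g 0"
    by (auto simp flip: fls_times_fps_to_fls)
qed

lemma ring_O_iff: "f \<in> ring_O \<longleftrightarrow> (\<forall>k<0. fls_nth f k = 0)"
proof
  assume "\<forall>k<0. fls_nth f k = 0"
  then have "f = fps_to_fls (fls_regpart f)" by (auto simp: fls_eq_iff)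
  then show "f \<in> ring_O" by blast
qed auto

interpretation RM: coeff_ring ring_Ominus
proof
  fix f g :: "complex fls" and c
  show "fls_const c \<in> ring_Ominus" by (auto simp: ring_Ominus_def)
  show "f \<in> ring_Ominus \<Longrightarrow> bar f \<in> ring_Ominus" by (auto simp: ring_Ominus_def bar_nth)
  show "f \<in> ring_Ominus \<Longrightarrow> g \<in> ring_Ominus \<Longrightarrow> f + g \<in> ring_Ominus" by (auto simp: ring_Ominus_def)
  \<comment> \<open>Only exponents with i \<le> 0 and k - i \<le> 0 contribute: none for k > 0, and
    i = 0 alone for k = 0. Both closure under products and multiplicativity of the constant
    coefficient follow from this.\<close>
  have *: "fls_nth (f * g) k = (\<Sum>i\<in>{i. fls_subdegree f \<le> i \<and> i \<le> k - fls_subdegree g \<and> i \<le> 0 \<and> k \<le> i}. fls_nth f i * fls_nth g (k - i))"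
    if "f \<in> ring_Ominus" "g \<in> ring_Ominus" for k
  proof -
    have "fls_nth (f * g) k = (\<Sum>i=fls_subdegree f..k - fls_subdegree g. fls_nth f i * fls_nth g (k - i))"
      by (rule fls_times_nth(2))
    also have "\<dots> = (\<Sum>i\<in>{i. fls_subdegree f \<le> i \<and> i \<le> k - fls_subdegree g \<and> i \<le> 0 \<and> k \<le> i}. fls_nth f i * fls_nth g (k - i))"
    proof (intro sum.mono_neutral_right ballI)
      fix i assume "i \<in> {fls_subdegree f..k - fls_subdegree g} -
        {i. fls_subdegree f \<le> i \<and> i \<le> k - fls_subdegree g \<and> i \<le> 0 \<and> k \<le> i}"
      then have "i > 0 \<or> k - i > 0" by auto
      then show "fls_nth f i * fls_nth g (k - i) = 0" using that by (auto simp: ring_Ominus_def)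
    qed auto
    finally show ?thesis .
  qed
  show "f * g \<in> ring_Ominus" if "f \<in> ring_Ominus" "g \<in> ring_Ominus"
    unfolding ring_Ominus_def
  proof (intro CollectI allI impI)
    fix k :: int assume "k > 0"
    then have "{i. fls_subdegree f \<le> i \<and> i \<le> k - fls_subdegree g \<and> i \<le> 0 \<and> k \<le> i} = {}" by auto
    then show "fls_nth (f * g) k = 0" by (subst *[OF that]) (simp only: sum.empty)
  qed
  show "fls_nth (f * g) 0 = fls_nth f 0 * fls_nth g 0" if "f \<in> ring_Ominus" "g \<in> ring_Ominus"
  proof (cases "f = 0 \<or> g = 0")
    case False
    have "fls_subdegree f \<le> 0" "fls_subdegree g \<le> 0"
      using False that nth_fls_subdegree_nonzero[of f] nth_fls_subdegree_nonzero[of g]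
      by (auto simp: ring_Ominus_def simp flip: not_less)
    then have "{i. fls_subdegree f \<le> i \<and> i \<le> 0 - fls_subdegree g \<and> i \<le> 0 \<and> 0 \<le> i} = {0}" by auto
    then show ?thesis by (subst *[OF that]) simp
  qed auto
qed

section \<open>Cosets and their representatives in the congruence subgroup\<close>

lemma gr_pt_eq: "gr_pt l g = (\<lambda>h. g * h) ` twisted l ring_O"
  by (auto simp: gr_pt_def l_coset_def loop_group_def)

lemma gr_pt_absorb:
  assumes "g \<in> carrier_mat (2*l) (2*l)" "k \<in> twisted l ring_O"
  shows "gr_pt l (g * k) = gr_pt l g"
proof -
  have kc: "k \<in> carrier_mat (2*l) (2*l)" using assms by (auto simp: twisted_iff)
  have ku: "lp.unitary l k" using assms by (auto simp: twisted_iff)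
  have hc: "h \<in> carrier_mat (2*l) (2*l)" if "h \<in> twisted l ring_O" for h using that by (auto simp: twisted_iff)
  show ?thesis unfolding gr_pt_eq
  proof safe
    fix h assume h: "h \<in> twisted l ring_O"
    have "g * k * h = g * (k * h)" using assms kc hc[OF h] by (rule_tac assoc_mult_mat) auto
    then show "g * k * h \<in> (*) g ` twisted l ring_O" using RO.twisted_mult[OF assms(2) h] by auto
  next
    fix h assume h: "h \<in> twisted l ring_O"
    let ?k = "lp.adj l k * h"
    have "g * k * ?k = g * (k * (lp.adj l k * h))" using assms kc hc[OF h]
      by (rule_tac assoc_mult_mat) auto
    also have "k * (lp.adj l k * h) = k * lp.adj l k * h" using kc hc[OF h]
      by (rule_tac assoc_mult_mat[symmetric]) auto
    finally have "g * h = g * k * ?k" using ku hc[OF h] by (simp add: lp.unitary_def)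
    then show "g * h \<in> (*) (g * k) ` twisted l ring_O"
      using RO.twisted_mult[OF RO.twisted_adj[OF assms(2)] h] by auto
  qed
qed

lemma mem_gr_pt: "g \<in> carrier_mat (2*l) (2*l) \<Longrightarrow> g \<in> gr_pt l g"
  unfolding gr_pt_eq using RO.twisted_one[of l] by (intro image_eqI[of _ _ "1\<^sub>m (2*l)"]) auto

lemma congruence_minus_carrier: "A \<in> congruence_minus l \<Longrightarrow> A \<in> carrier_mat (2*l) (2*l)"
  by (auto simp: congruence_minus_def twisted_iff)

text \<open>The quotient of two representatives has entries in \<complex>[[t]] and in
  \<complex>[1/t], hence constant entries, and its value at infinity is the identity. This makes
  \<open>gr_rep\<close> well defined.\<close>

lemma congruence_minus_unique:
  assumes A: "A \<in> congruence_minus l" and B: "B \<in> congruence_minus l" and eq: "gr_pt l A = gr_pt l B"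
  shows "A = B"
proof -
  have c: "A \<in> carrier_mat (2*l) (2*l)" "B \<in> carrier_mat (2*l) (2*l)"
    using A B by (auto simp: congruence_minus_carrier)
  have "A \<in> gr_pt l B" using mem_gr_pt[OF c(1)] eq by simp
  then obtain k where k: "k \<in> twisted l ring_O" and Ak: "A = B * k" by (auto simp: gr_pt_eq)
  have kc: "k \<in> carrier_mat (2*l) (2*l)" using k by (auto simp: twisted_iff)
  have Bt: "B \<in> twisted l ring_Ominus" "lp.unitary l B" and At: "A \<in> twisted l ring_Ominus"
    using A B by (auto simp: congruence_minus_def twisted_iff)
  have "lp.adj l B * A = lp.adj l B * B * k" unfolding Ak
    using c kc by (rule_tac assoc_mult_mat[symmetric]) auto
  then have kA: "k = lp.adj l B * A" using Bt(2) kc by (simp add: lp.unitary_adj_left)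
  have m: "k \<in> mats (2*l) ring_O" "A \<in> mats (2*l) ring_Ominus" "B \<in> mats (2*l) ring_Ominus"
    using k Bt At by (auto simp: twisted_iff SL_iff)
  have kM: "k \<in> mats (2*l) ring_Ominus" unfolding kA using m by (auto intro!: RM.mats_mult RM.mats_adj)
  have "c0 k = cx.adj l (c0 B) * c0 A" unfolding kA using m
    by (simp add: RM.c0_mult[of _ "2*l"] RM.mats_adj RM.c0_adj)
  also have "\<dots> = 1\<^sub>m (2*l)" using A B by (simp add: congruence_minus_def)
  finally have ck: "c0 k = 1\<^sub>m (2*l)" .
  have "k = 1\<^sub>m (2*l)"
  proof (rule eq_matI)
    fix i j assume "i < dim_row (1\<^sub>m (2*l) :: complex fls mat)" "j < dim_col (1\<^sub>m (2*l) :: complex fls mat)"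
    then have ij: "i < 2*l" "j < 2*l" by auto
    have "fls_nth (k $$ (i,j)) m = fls_nth (1\<^sub>m (2*l) $$ (i,j)) m" for m
    proof (cases "m = 0")
      case True
      have "c0 k $$ (i,j) = 1\<^sub>m (2*l) $$ (i,j)" using ck by simp
      then show ?thesis using ij kc True by auto
    next
      case False
      have "k $$ (i,j) \<in> ring_O" "k $$ (i,j) \<in> ring_Ominus" using m kM ij by (auto simp: mats_def)
      then have "fls_nth (k $$ (i,j)) m = 0" using False
        by (cases "m < 0") (auto simp: ring_O_iff ring_Ominus_def)
      then show ?thesis using ij False by auto
    qed
    then show "k $$ (i,j) = 1\<^sub>m (2*l) $$ (i,j)" by (simp add: fls_eq_iff)
  qed (use kc in auto)
  then show ?thesis using Ak c by simp
qed

lemma gr_rep_gr_pt: "A \<in> congruence_minus l \<Longrightarrow> gr_rep l (gr_pt l A) = A"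
  unfolding gr_rep_def by (rule the_equality) (auto intro: congruence_minus_unique)

lemma congruence_minus_subset: "A \<in> congruence_minus l \<Longrightarrow> A \<in> twisted l ring_Ominus"
  by (simp add: congruence_minus_def)

text \<open>A representative is normalised by the inverse of its value at infinity. That matrix is
  constant, so it belongs to the stabiliser of the base point as well and leaves the coset
  unchanged.\<close>

lemma gr_minus_eq: "gr_minus l = gr_pt l ` congruence_minus l"
proof
  show "gr_pt l ` congruence_minus l \<subseteq> gr_minus l"
    unfolding gr_minus_def using congruence_minus_subset by blast
  show "gr_minus l \<subseteq> gr_pt l ` congruence_minus l"
  proof
    fix p assume "p \<in> gr_minus l"
    then obtain g where g: "g \<in> twisted l ring_Ominus" and p: "p = gr_pt l g" by (auto simp: gr_minus_def)
    then have gm: "g \<in> mats (2*l) ring_Ominus" "det g = 1" "lp.unitary l g" by (auto simp: twisted_iff SL_iff)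
    let ?C = "c0 g"
    have C: "cx.unitary l ?C" "det ?C = 1" using gm by (auto simp: RM.unitary_c0 RM.c0_det)
    let ?K = "hat (cx.adj l ?C)"
    have "det (?C * cx.adj l ?C) = det ?C * det (cx.adj l ?C)"
      using lp.unitary_carrier[OF gm(3)] by (intro det_mult[of _ "2*l"]) auto
    then have C': "cx.unitary l (cx.adj l ?C)" "det (cx.adj l ?C) = 1"
      using C by (auto simp: cx.unitary_adj) (simp add: cx.unitary_def)
    have K: "?K \<in> twisted l ring_O" "?K \<in> twisted l ring_Ominus"
      using RO.hat_twisted RM.hat_twisted C' by auto
    have "c0 (g * ?K) = ?C * c0 ?K"
      using gm by (intro RM.c0_mult[of _ "2*l"] RM.mats_hat) auto
    also have "c0 ?K = cx.adj l ?C" by (rule eq_matI) auto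
    also have "?C * cx.adj l ?C = 1\<^sub>m (2*l)" using C by (simp add: cx.unitary_def)
    finally have "g * ?K \<in> congruence_minus l"
      using RM.twisted_mult[OF g K(2)] unfolding congruence_minus_def by blast
    moreover have "p = gr_pt l (g * ?K)" using p lp.unitary_carrier[OF gm(3)] by (simp add: gr_pt_absorb[OF _ K(1)])
    ultimately show "p \<in> gr_pt l ` congruence_minus l" by blast
  qed
qed

section \<open>Matrices of rank at most one and the relations of a small pair\<close>

lemma (in vec_space) rank_le_1_imp_product_entries:
  assumes A: "A \<in> carrier_mat n nc" and r: "rank A \<le> 1"
  obtains f g :: "nat \<Rightarrow> 'a" where "\<And>r c. r < n \<Longrightarrow> c < nc \<Longrightarrow> A $$ (r,c) = f r * g c"
proof (cases "\<forall>c<nc. col A c = 0\<^sub>v n")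
  case True
  have "A $$ (r,c) = 0 * 0" if "r < n" "c < nc" for r c
  proof -
    have "col A c $ r = 0\<^sub>v n $ r" using True that by simp
    then show ?thesis using that A by simp
  qed
  then show ?thesis by (rule that[of "\<lambda>_. 0" "\<lambda>_. 0"])
next
  case False
  then obtain c where c: "c < nc" "col A c \<noteq> 0\<^sub>v n" by auto
  let ?v = "col A c"
  have in_cols: "col A k \<in> set (cols A)" if "k < nc" for k
    using that A by (auto simp: cols_def)
  have v: "?v \<in> carrier_vec n" using A c by auto
  have "lin_indpt {}" by (metis empty_subsetI fin_dim finite_basis_exists subset_li_is_li vec_vs vectorspace.basis_def)
  then have "lin_dep ({} \<union> {?v}) \<longleftrightarrow> ?v \<in> span {}" using lin_dep_iff_in_span[of "{}" ?v] v by auto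
  moreover have "span {} = {0\<^sub>v n}" by (rule span_empty)
  ultimately have indep: "lin_indpt {?v}" using c by simp
  \<comment> \<open>A column outside the span of the nonzero column \<open>?v\<close> would form an
    independent pair with it and force rank at least 2.\<close>
  have "\<exists>a. col A k = a \<cdot>\<^sub>v ?v" if k: "k < nc" for k
  proof (cases "col A k = ?v")
    case True
    then show ?thesis by (intro exI[of _ 1]) simp
  next
    case False
    have w: "col A k \<in> carrier_vec n" using A k by auto
    have "lin_dep ({?v} \<union> {col A k})"
    proof (rule ccontr)
      assume "\<not> lin_dep ({?v} \<union> {col A k})"
      then have "card ({?v} \<union> {col A k}) \<le> rank A"
        using in_cols[OF k] in_cols[OF c(1)] by (intro rank_ge_card_indpt[OF A]) auto
      then show False using False r by simp
    qed
    then have "col A k \<in> span {?v}"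
      using lin_dep_iff_in_span[of "{?v}" "col A k"] indep v w False by auto
    then obtain a where a: "col A k = lincomb a {?v}"
      using finite_span[of "{?v}"] v by auto
    have "col A k = a ?v \<cdot>\<^sub>v ?v"
    proof (rule eq_vecI)
      fix i assume "i < dim_vec (a ?v \<cdot>\<^sub>v ?v)"
      then have i: "i < n" using A by simp
      then show "col A k $ i = (a ?v \<cdot>\<^sub>v ?v) $ i"
        unfolding a using v A by (subst lincomb_index) auto
    qed (use A in auto)
    then show ?thesis by blast
  qed
  then have "\<forall>k\<in>{..<nc}. \<exists>a. col A k = a \<cdot>\<^sub>v ?v" by simp
  then obtain g where g: "\<forall>k\<in>{..<nc}. col A k = g k \<cdot>\<^sub>v ?v" by (rule bchoice[THEN exE])
  have "A $$ (i,k) = ?v $ i * g k" if "i < n" "k < nc" for i k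
  proof -
    have "col A k $ i = (g k \<cdot>\<^sub>v ?v) $ i" using g that by simp
    then show ?thesis using that A c by simp
  qed
  then show ?thesis by (rule that)
qed

definition outer :: "nat \<Rightarrow> complex mat \<Rightarrow> bool" where
  "outer n y \<longleftrightarrow> (\<exists>u w. \<forall>i<n. \<forall>j<n. y $$ (i,j) = u i * w j)"

lemma rank_le_1_iff: "y \<in> carrier_mat n n \<Longrightarrow> vec_space.rank n y \<le> 1 \<longleftrightarrow> outer n y"
  unfolding outer_def
  using vec_space.rank_le_1_imp_product_entries[of y n n] vec_space.rank_le_1_product_entries[of y n n]
  by (metis carrier_matD)

text \<open>
  The equations say that \<open>1 + x t\<^sup>-\<^sup>1 + y t\<^sup>-\<^sup>2\<close> is fixed by \<open>\<sigma>\<close>: they are the coefficients of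
  \<open>A A\<^sup>* = 1\<close>, where the adjoint also replaces \<open>t\<close> by \<open>-t\<close>.
\<close>

definition small_pair :: "nat \<Rightarrow> complex mat \<Rightarrow> complex mat \<Rightarrow> bool" where
  "small_pair l x y \<longleftrightarrow> x \<in> carrier_mat (2*l) (2*l) \<and> y \<in> carrier_mat (2*l) (2*l) \<and>
     cx.adj l x = x \<and> y + cx.adj l y = x * x \<and> x * cx.adj l y = y * x \<and>
     y * cx.adj l y = 0\<^sub>m (2*l) (2*l) \<and> outer (2*l) y"

context
  fixes l :: nat and x y :: "complex mat"
  assumes g: "small_pair l x y"
begin

private abbreviation (input) "n \<equiv> 2 * l"
private abbreviation (input) "ys \<equiv> cx.adj l y"
private abbreviation (input) "Z \<equiv> 0\<^sub>m n n :: complex mat"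

private lemma carr [simp]: "x \<in> carrier_mat n n" "y \<in> carrier_mat n n"
  using g by (auto simp: small_pair_def)

private lemma mult_carr [simp]: "A \<in> carrier_mat n n \<Longrightarrow> B \<in> carrier_mat n n \<Longrightarrow> A * B \<in> carrier_mat n n"
  for A B :: "complex mat"
  by simp

private lemmas assoc = assoc_mult_mat[of _ n n _ n _ n]
private lemmas dl = mult_add_distrib_mat[of _ n n _ n]
private lemmas dr = add_mult_distrib_mat[of _ n n _ _ n]

private lemma z [simp]: "A \<in> carrier_mat n n \<Longrightarrow> A + Z = A" "A \<in> carrier_mat n n \<Longrightarrow> Z + A = A"
  "A \<in> carrier_mat n n \<Longrightarrow> A * Z = Z" "A \<in> carrier_mat n n \<Longrightarrow> Z * A = Z"
  by auto

private lemma rel: "cx.adj l x = x" "x * x = y + ys" "x * ys = y * x" "y * ys = Z"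
  using g by (auto simp: small_pair_def)

lemma small_pair_prods_zero: "x * ys = Z" "y * x = Z"
proof -
  from g obtain u w where uw: "\<And>i j. i < n \<Longrightarrow> j < n \<Longrightarrow> y $$ (i,j) = u i * w j"
    by (auto simp: small_pair_def outer_def)
  \<comment> \<open>With y = u w^T, \<open>p\<close> is w turned into a column by J, and
    \<open>r\<close> is x p. Both products then have rank one in the same two vectors: x \<sigma>(y)
    is built from r u^T and, as x is self-adjoint, y x from - u r^T.\<close>
  define p where "p i = (-1)^i * w (n - Suc i)" for i
  define r where "r i = (\<Sum>k<n. x $$ (i,k) * p k)" for i
  have L: "(x * ys) $$ (i,j) = (-1)^j * (r i * u (n - Suc j))" if "i < n" "j < n" for i j
    using that by (simp add: times_mat_index[of _ n n _ n] cx.adj_index uw r_def p_def sum_distrib_left sum_distrib_right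
        del: index_mult_mat(1)) (simp add: mult_ac)
  have xs: "x $$ (k,j) = (-1)^k * (-1)^j * x $$ (n - Suc j, n - Suc k)" if "k < n" "j < n" for k j
    using that by (subst rel(1)[symmetric]) (simp add: cx.adj_index)
  have R: "(y * x) $$ (i,j) = - ((-1)^j * (u i * r (n - Suc j)))" if ij: "i < n" "j < n" for i j
  proof -
    have "(y * x) $$ (i,j) = (\<Sum>k<n. u i * w k * ((-1)^k * (-1)^j * x $$ (n - Suc j, n - Suc k)))"
      using ij by (simp add: times_mat_index[of _ n n _ n] uw xs[symmetric] del: index_mult_mat(1))
    also have "\<dots> = (\<Sum>k<n. u i * w (n - Suc k) * ((-1)^(n - Suc k) * (-1)^j * x $$ (n - Suc j, n - Suc (n - Suc k))))"
      by (subst sum.nat_diff_reindex[symmetric]) simp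
    also have "\<dots> = (\<Sum>k<n. - ((-1)^j * (u i * (x $$ (n - Suc j, k) * p k))))"
    proof (rule sum.cong[OF refl])
      fix k assume "k \<in> {..<n}"
      then have "k < n" "n - Suc (n - Suc k) = k" by auto
      then show "u i * w (n - Suc k) * ((-1)^(n - Suc k) * (-1)^j * x $$ (n - Suc j, n - Suc (n - Suc k))) =
        - ((-1)^j * (u i * (x $$ (n - Suc j, k) * p k)))"
        by (simp only: cx.sign_flip[of k l] p_def) (simp add: mult_ac)
    qed
    finally show ?thesis by (simp add: r_def sum_negf sum_distrib_left)
  qed
  have ru: "r i * u j = - (u i * r j)" if ij: "i < n" "j < n" for i j
  proof -
    have "(x * ys) $$ (i, n - Suc j) = (y * x) $$ (i, n - Suc j)" by (simp add: rel(3))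
    then have "(-1)^(n - Suc j) * (r i * u j) = (-1)^(n - Suc j) * (- (u i * r j))"
      using ij by (subst (asm) L, simp, simp, subst (asm) R) auto
    moreover have "((-1)^(n - Suc j) :: complex) \<noteq> 0" by simp
    ultimately show ?thesis using mult_left_cancel by blast
  qed
  \<comment> \<open>Skewness kills the diagonal products r_i u_i. Applied once more, it writes the
    square of r_i u_j as minus the product of two diagonal ones.\<close>
  have r0: "r i * u j = 0" if ij: "i < n" "j < n" for i j
  proof -
    have 0: "r i * u i = 0" using ru[OF ij(1) ij(1)] by (simp add: mult.commute)
    have "(r i * u j) * (r i * u j) = (r i * u j) * (- (u i * r j))"
      by (rule arg_cong2[where f = "(*)", OF refl ru[OF ij]])
    also have "\<dots> = - ((r i * u i) * (r j * u j))" by (simp add: mult_ac)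
    finally have "(r i * u j) * (r i * u j) = 0" unfolding 0 by simp
    then show ?thesis by (simp only: mult_eq_0_iff disj_absorb)
  qed
  show "x * ys = Z"
    by (rule eq_matI) (auto simp: L r0 carrier_matD[OF carr(1)] simp del: index_mult_mat(1))
  then show "y * x = Z" using rel(3) by simp
qed

private lemma ysys: "ys * ys = Z"
proof -
  have "x * x * ys = Z" by (simp add: assoc small_pair_prods_zero)
  then show ?thesis unfolding rel(2) by (simp add: dr rel(4))
qed

private lemma yy: "y * y = Z"
proof -
  have "cx.adj l (ys * ys) = y * y" by (simp add: cx.adj_mult)
  moreover have "cx.adj l Z = Z" by (rule eq_matI) (auto simp: cx.adj_index)
  ultimately show ?thesis using ysys by simp
qed

text \<open>Both sides are x^3, with x^2 = y + \<sigma>(y) inserted on the right or on the left; the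
  other two terms vanish by \<open>small_pair_prods_zero\<close>.\<close>

private lemma xy: "x * y = ys * x"
proof -
  have "x * (x * x) = x * x * x" by (simp add: assoc)
  then show ?thesis unfolding rel(2) by (simp add: dl dr small_pair_prods_zero)
qed

private lemma ysy: "ys * y = Z"
proof -
  have "x * x * y = x * (ys * x)" by (simp add: assoc xy)
  also have "\<dots> = x * ys * x" by (simp add: assoc)
  also have "\<dots> = Z" by (simp add: small_pair_prods_zero)
  finally show ?thesis unfolding rel(2) by (simp add: dr yy)
qed

text \<open>All four products of y and \<sigma>(y) vanish. The conclusion mentions x alone: one
  point of a fibre provides it, and it is then available for every z of the model.\<close>

lemma small_pair_fourth_power: "(x * x) * (x * x) = Z"
  unfolding rel(2) by (simp add: dl dr yy ysy ysys rel(4))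

private abbreviation (input) "D \<equiv> y + (- ys)"

text \<open>Subtracting x^2/2, half of y + \<sigma>(y), leaves the skew part of y. The relations for
  z are proved in terms of the difference \<open>D\<close>.\<close>

private lemma zeq: "y + (- (1/2)) \<cdot>\<^sub>m (x * x) = (1/2) \<cdot>\<^sub>m D"
  unfolding rel(2) by (rule eq_matI) (auto simp: field_simps carrier_matD[OF carr(2)])

private lemma D_carr [simp]: "D \<in> carrier_mat n n" by simp

private lemma neg_mult [simp]: "A \<in> carrier_mat n n \<Longrightarrow> A * (- ys) = - (A * ys)" "A \<in> carrier_mat n n \<Longrightarrow> - ys * A = - (ys * A)"
  by auto

lemma small_pair_imp_fiber_model: "y + (- (1/2)) \<cdot>\<^sub>m (x * x) \<in> fiber_model l x"
proof -
  let ?z = "y + (- (1/2)) \<cdot>\<^sub>m (x * x)"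
  have zc: "?z \<in> carrier_mat n n" by simp
  have nz: "- Z = Z" by (rule eq_matI) auto
  have DD: "D * D = Z" by (simp add: dl dr yy ysy ysys rel(4) nz)
  have zz: "?z * ?z = Z" unfolding zeq
    by (subst mult_smult_assoc_mat[of _ n n _ n], simp, simp, subst mult_smult_distrib[of _ n n _ n])
      (simp_all add: DD)
  have xD: "x * D = x * y" by (simp add: dl small_pair_prods_zero nz)
  have Dx: "D * x = - (x * y)" by (simp add: dr small_pair_prods_zero nz xy)
  have xz: "x * ?z + ?z * x = Z" unfolding zeq
    by (subst mult_smult_assoc_mat[of _ n n _ n], simp, simp, subst mult_smult_distrib[of _ n n _ n])
      (simp_all add: xD Dx, rule eq_matI, simp_all add: carrier_matD[OF carr(2)] carrier_matD[OF carr(1)] del: index_mult_mat(1))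
  have "cx.adj l ((1/2) \<cdot>\<^sub>m D) = (1/2) \<cdot>\<^sub>m (ys + - y)"
    by (simp add: cx.adj_smult cx.adj_add cx.adj_uminus)
  also have "\<dots> = - ((1/2) \<cdot>\<^sub>m D)"
    by (rule eq_matI) (auto simp: carrier_matD[OF carr(2)] field_simps)
  finally have adjz: "cx.adj l ?z = - ?z" unfolding zeq .
  \<comment> \<open>Skewness under the adjoint makes the diagonal entries at i and n - 1 - i
    opposite, so reversing the order of summation negates the trace.\<close>
  have tr: "(\<Sum>i<n. ?z $$ (i,i)) = 0"
  proof -
    have h: "?z $$ (i,i) = - ?z $$ (n - Suc i, n - Suc i)" if "i < n" for i
    proof -
      have "cx.adj l ?z $$ (i,i) = (- ?z) $$ (i,i)" using adjz by simp
      then show ?thesis using that zc by (simp add: cx.adj_index del: index_add_mat)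
    qed
    have "(\<Sum>i<n. ?z $$ (i,i)) = (\<Sum>i<n. - ?z $$ (n - Suc i, n - Suc i))"
      by (rule sum.cong[OF refl], rule h) simp
    also have "\<dots> = - (\<Sum>i<n. ?z $$ (i,i))"
      by (subst (2) sum.nat_diff_reindex[symmetric]) (simp add: sum_negf)
    finally show ?thesis by simp
  qed
  have sp: "?z \<in> sp l"
    using zc adjz tr by (simp add: sp_def sl_def sigma_g_eq)
  have yz: "?z + (1/2) \<cdot>\<^sub>m (x * x) = y"
    by (rule eq_matI) (simp_all add: carrier_matD[OF carr(2)] carrier_matD[OF carr(1)] del: index_mult_mat(1))
  have "vec_space.rank n (?z + (1/2) \<cdot>\<^sub>m (x * x)) \<le> 1"
    unfolding yz using g by (intro rank_le_1_iff[THEN iffD2]) (auto simp: small_pair_def)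
  then show ?thesis using sp xz zz by (simp add: fiber_model_def)
qed

end

lemma sp_iff_adj: "z \<in> sp l \<longleftrightarrow> z \<in> sl (2*l) \<and> cx.adj l z = - z"
proof -
  have "- A = B \<longleftrightarrow> A = - B" for A B :: "complex mat" by (metis uminus_uminus_mat)
  then show ?thesis by (auto simp: sp_def sl_def sigma_g_eq)
qed

text \<open>For y = z + x^2/2 the product y \<sigma>(y) equals - z^2 + (z x^2 - x^2 z)/2 + x^4/4.
  Anticommuting with x, z commutes with x^2, and the remaining terms are zero by z^2 = 0 and x^4 =
  0.\<close>

lemma fiber_model_imp_small_pair:
  assumes x: "x \<in> carrier_mat (2*l) (2*l)" "cx.adj l x = x" "(x * x) * (x * x) = 0\<^sub>m (2*l) (2*l)"
    and z: "z \<in> fiber_model l x"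
  shows "small_pair l x (z + (1/2) \<cdot>\<^sub>m (x * x))"
proof -
  let ?n = "2*l" let ?Z = "0\<^sub>m ?n ?n :: complex mat" and ?h = "(1/2) \<cdot>\<^sub>m (x * x)"
  have mult_carr [simp]: "A \<in> carrier_mat ?n ?n \<Longrightarrow> B \<in> carrier_mat ?n ?n \<Longrightarrow> A * B \<in> carrier_mat ?n ?n"
    for A B :: "complex mat" by simp
  note assoc = assoc_mult_mat[of _ ?n ?n _ ?n _ ?n]
  note dl = mult_add_distrib_mat[of _ ?n ?n _ ?n] and dr = add_mult_distrib_mat[of _ ?n ?n _ _ ?n]
  have zc [simp]: "z \<in> carrier_mat ?n ?n" and adjz: "cx.adj l z = - z"
    and xz: "x * z + z * x = ?Z" and zz: "z * z = ?Z" and r': "vec_space.rank ?n (z + ?h) \<le> 1"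
    using z x by (auto simp: fiber_model_def sp_iff_adj sl_def)
  have xc [simp]: "x \<in> carrier_mat ?n ?n" by (rule x)
  have r: "outer ?n (z + ?h)" using r' by (subst (asm) rank_le_1_iff) auto
  have hc [simp]: "?h \<in> carrier_mat ?n ?n" by simp
  have adjh: "cx.adj l ?h = ?h" by (simp add: cx.adj_smult cx.adj_mult x(2))
  have adjy: "cx.adj l (z + ?h) = - z + ?h" by (simp add: cx.adj_add adjz adjh)
  have zx: "z * x = - (x * z)"
  proof (rule eq_matI)
    fix i j assume "i < dim_row (- (x * z))" "j < dim_col (- (x * z))"
    then have ij: "i < ?n" "j < ?n" using carrier_matD[OF xc] carrier_matD[OF zc] by auto
    have "(x * z + z * x) $$ (i,j) = ?Z $$ (i,j)" using xz by simp
    then have "(x * z) $$ (i,j) + (z * x) $$ (i,j) = 0"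
      using ij by (subst (asm) index_add_mat(1)) (use carrier_matD[OF zc] carrier_matD[OF xc] in auto)
    then show "(z * x) $$ (i,j) = (- (x * z)) $$ (i,j)"
      using ij carrier_matD[OF zc] carrier_matD[OF xc] by (simp add: eq_neg_iff_add_eq_0 add.commute del: index_mult_mat(1))
  qed (use carrier_matD[OF zc] carrier_matD[OF xc] in auto)
  have um: "A \<in> carrier_mat ?n ?n \<Longrightarrow> B \<in> carrier_mat ?n ?n \<Longrightarrow> A * (- B) = - (A * B)"
    "A \<in> carrier_mat ?n ?n \<Longrightarrow> B \<in> carrier_mat ?n ?n \<Longrightarrow> (- A) * B = - (A * B)" for A B :: "complex mat"
    by auto
  have uc [simp]: "A \<in> carrier_mat ?n ?n \<Longrightarrow> - A \<in> carrier_mat ?n ?n" for A :: "complex mat" by simp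
  have zxx: "z * (x * x) = x * x * z"
  proof -
    have "z * (x * x) = (z * x) * x" by (simp add: assoc)
    also have "\<dots> = - (x * (z * x))" by (simp add: zx um assoc)
    also have "\<dots> = x * x * z" by (simp add: zx um assoc)
    finally show ?thesis .
  qed
  note sm = mult_smult_distrib[of _ ?n ?n _ ?n] mult_smult_assoc_mat[of _ ?n ?n _ ?n]
  have 1: "z + ?h + cx.adj l (z + ?h) = x * x" unfolding adjy
    by (rule eq_matI) (use carrier_matD[OF zc] carrier_matD[OF xc] in \<open>auto simp del: index_mult_mat(1)\<close>)
  have 2: "x * cx.adj l (z + ?h) = (z + ?h) * x" unfolding adjy
    by (simp add: dl dr um sm zx assoc)
  have 3: "(z + ?h) * cx.adj l (z + ?h) = ?Z" unfolding adjy
  proof -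
    have p1: "z * (- z + ?h) = - (z * z) + (1/2) \<cdot>\<^sub>m (z * (x * x))"
      by (simp add: dl[of z "- z"] um(1)[of z z] mult_smult_distrib[of z ?n ?n _ ?n])
    have "x * x * (- z + ?h) = - (x * x * z) + (1/2) \<cdot>\<^sub>m (x * x * (x * x))"
      by (simp add: dl[of "x * x" "- z"] um(1)[of "x * x" z] mult_smult_distrib[of "x * x" ?n ?n _ ?n])
    then have p2: "?h * (- z + ?h) = (1/2) \<cdot>\<^sub>m (- (x * x * z) + (1/2) \<cdot>\<^sub>m (x * x * (x * x)))"
      by (subst mult_smult_assoc_mat[of "x * x" ?n ?n _ ?n]) auto
    have "(z + ?h) * (- z + ?h) = z * (- z + ?h) + ?h * (- z + ?h)"
      by (rule dr) auto
    also have "\<dots> = (- (z * z) + (1/2) \<cdot>\<^sub>m (z * (x * x))) +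
        (1/2) \<cdot>\<^sub>m (- (x * x * z) + (1/2) \<cdot>\<^sub>m (x * x * (x * x)))"
      unfolding p1 p2 ..
    also have "\<dots> = ?Z" unfolding zz x(3) zxx
      by (rule eq_matI) (use carrier_matD[OF zc] carrier_matD[OF xc] in \<open>auto simp del: index_mult_mat(1)\<close>)
    finally show "(z + ?h) * (- z + ?h) = ?Z" .
  qed
  show ?thesis unfolding small_pair_def using 1 2 3 r x by auto
qed

section \<open>Determinants of unitary loops and coefficients of polynomial loops\<close>

context skew_form
begin

lemma det_adj:
  assumes "A \<in> carrier_mat n n" shows "det (adj A) = cj (det A)"
proof -
  interpret comm_ring_hom cj by (rule cj_hom)
  let ?J = "Jmat l :: 'a mat" and ?B = "(map_mat cj A)\<^sup>T"
  have [simp]: "?B \<in> carrier_mat n n" using assms by simp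
  have "det (?J * ?B * (- ?J)) = det (?J * ?B) * det (- ?J)"
    using assms by (intro det_mult[of _ n]) (auto intro!: mult_carrier_mat[of _ n n])
  also have "det (?J * ?B) = det ?J * det ?B"
    using assms by (intro det_mult[of _ n]) auto
  also have "det ?J * det ?B * det (- ?J) = det ?B * (det ?J * det (- ?J))" by simp
  also have "det ?J * det (- ?J) = det (?J * (- ?J))"
    by (rule det_mult[of _ n, symmetric]) auto
  also have "?J * (- ?J) = 1\<^sub>m n" by (simp add: Jmat_square)
  finally show ?thesis
    using assms by (simp add: adj_eq_Jmat Jmat_inverse det_transpose[of _ n] hom_det)
qed

lemma det_unitary: "unitary A \<Longrightarrow> det A * cj (det A) = 1"
  using det_mult[of A n "adj A"] by (simp add: unitary_def det_adj)

end

lemma Ominus_mult_nth: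
  assumes f: "f \<in> ring_Ominus" and g: "g \<in> ring_Ominus"
  shows "fls_nth (f * g) (- int k) = (\<Sum>a\<le>k. fls_nth f (- int a) * fls_nth g (- int (k - a)))"
proof -
  have "fls_nth (f * g) (- int k) = (\<Sum>i=fls_subdegree f..- int k - fls_subdegree g. fls_nth f i * fls_nth g (- int k - i))"
    by (rule fls_times_nth(2))
  also have "\<dots> = (\<Sum>i\<in>{- int k..0}. fls_nth f i * fls_nth g (- int k - i))"
  proof (rule sum.mono_neutral_cong)
    fix i assume "i \<in> {- int k..0} - {fls_subdegree f..- int k - fls_subdegree g}"
    then have "i < fls_subdegree f \<or> - int k - i < fls_subdegree g" by auto
    then show "fls_nth f i * fls_nth g (- int k - i) = 0" by (auto simp: fls_eq0_below_subdegree)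
  next
    fix i assume "i \<in> {fls_subdegree f..- int k - fls_subdegree g} - {- int k..0}"
    then have "i > 0 \<or> - int k - i > 0" by auto
    then show "fls_nth f i * fls_nth g (- int k - i) = 0" using f g by (auto simp: ring_Ominus_def)
  qed auto
  also have "\<dots> = (\<Sum>a\<le>k. fls_nth f (- int a) * fls_nth g (- int (k - a)))"
    by (rule sum.reindex_bij_witness[of _ "\<lambda>a. - int a" "\<lambda>i. nat (- i)"]) (auto simp: of_nat_diff)
  finally show ?thesis .
qed

abbreviation cf :: "nat \<Rightarrow> complex fls mat \<Rightarrow> complex mat" where
  "cf k \<equiv> map_mat (\<lambda>f. fls_nth f (- int k))"

lemma cf_mult_index:
  assumes A: "A \<in> mats n ring_Ominus" and B: "B \<in> mats n ring_Ominus" and ij: "i < n" "j < n"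
  shows "fls_nth ((A * B) $$ (i,j)) (- int k) = (\<Sum>a\<le>k. (cf a A * cf (k - a) B) $$ (i,j))"
proof -
  have c: "A \<in> carrier_mat n n" "B \<in> carrier_mat n n" using A B by (auto simp: mats_def)
  have sm: "fls_nth (sum f S) m = (\<Sum>i\<in>S. fls_nth (f i) m)" for f :: "nat \<Rightarrow> complex fls" and S m
    by (induction S rule: infinite_finite_induct) auto
  have "fls_nth ((A * B) $$ (i,j)) (- int k) = (\<Sum>p<n. fls_nth (A $$ (i,p) * B $$ (p,j)) (- int k))"
    unfolding times_mat_index[OF c ij] sm ..
  also have "\<dots> = (\<Sum>p<n. \<Sum>a\<le>k. fls_nth (A $$ (i,p)) (- int a) * fls_nth (B $$ (p,j)) (- int (k - a)))"
    using A B ij by (intro sum.cong refl Ominus_mult_nth) (auto simp: mats_def)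
  also have "\<dots> = (\<Sum>a\<le>k. \<Sum>p<n. fls_nth (A $$ (i,p)) (- int a) * fls_nth (B $$ (p,j)) (- int (k - a)))"
    by (rule sum.swap)
  also have "\<dots> = (\<Sum>a\<le>k. (cf a A * cf (k - a) B) $$ (i,j))"
  proof (rule sum.cong[OF refl])
    fix a
    have "(cf a A * cf (k - a) B) $$ (i,j) = (\<Sum>p<n. cf a A $$ (i,p) * cf (k - a) B $$ (p,j))"
      using c ij by (intro times_mat_index) auto
    also have "\<dots> = (\<Sum>p<n. fls_nth (A $$ (i,p)) (- int a) * fls_nth (B $$ (p,j)) (- int (k - a)))"
      using c ij by (intro sum.cong) auto
    finally show "(\<Sum>p<n. fls_nth (A $$ (i,p)) (- int a) * fls_nth (B $$ (p,j)) (- int (k - a))) =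
      (cf a A * cf (k - a) B) $$ (i,j)" ..
  qed
  finally show ?thesis .
qed

text \<open>The sign (-1)^k is the effect of t -> -t on t^-k; it is what distinguishes self-adjoint
  from skew coefficients in \<open>unitary_iff_cf\<close>.\<close>

lemma cf_adj:
  assumes "A \<in> carrier_mat (2*l) (2*l)"
  shows "cf k (lp.adj l A) = (-1)^k \<cdot>\<^sub>m cx.adj l (cf k A)"
proof (rule eq_matI)
  fix i j assume "i < dim_row ((-1)^k \<cdot>\<^sub>m cx.adj l (cf k A))" "j < dim_col ((-1)^k \<cdot>\<^sub>m cx.adj l (cf k A))"
  then have ij: "i < 2*l" "j < 2*l" "2*l - Suc j < 2*l" "2*l - Suc i < 2*l" by auto
  have sgn: "(-1)^k = (fls_const ((-1)^k) :: complex fls)" for k by (cases "even k") auto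
  have pw: "(-1 :: complex) powi (- int k) = (-1)^k"
    by (cases "even k") (simp_all add: power_int_minus_left)
  let ?f = "A $$ (2*l - Suc j, 2*l - Suc i)"
  have "cf k (lp.adj l A) $$ (i,j) = fls_nth ((-1)^i * (-1)^j * bar ?f) (- int k)"
    using ij by (simp add: lp.adj_index)
  also have "\<dots> = (-1)^i * (-1)^j * ((-1)^k * fls_nth ?f (- int k))"
    unfolding sgn fls_const_mult_const fls_mult_const_nth bar_nth pw ..
  finally show "cf k (lp.adj l A) $$ (i,j) = ((-1)^k \<cdot>\<^sub>m cx.adj l (cf k A)) $$ (i,j)"
    using ij assms by (simp add: cx.adj_index)
qed auto

lemma unitary_iff_cf:
  assumes A: "A \<in> mats (2*l) ring_Ominus"
  shows "lp.unitary l A \<longleftrightarrow> (\<forall>k i j. i < 2*l \<longrightarrow> j < 2*l \<longrightarrow>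
     (\<Sum>a\<le>k. (-1)^(k - a) * (cf a A * cx.adj l (cf (k - a) A)) $$ (i,j)) = (if k = 0 \<and> i = j then 1 else 0))"
proof -
  let ?n = "2*l"
  have c: "A \<in> carrier_mat ?n ?n" using A by (auto simp: mats_def)
  have S: "fls_nth ((A * lp.adj l A) $$ (i,j)) (- int k) =
      (\<Sum>a\<le>k. (-1)^(k - a) * (cf a A * cx.adj l (cf (k - a) A)) $$ (i,j))" if "i < ?n" "j < ?n" for i j k
  proof -
    have "(cf a A * ((-1)^(k - a) \<cdot>\<^sub>m cx.adj l (cf (k - a) A))) $$ (i,j) =
      (-1)^(k - a) * (cf a A * cx.adj l (cf (k - a) A)) $$ (i,j)" for a
      using that c by (subst mult_smult_distrib[of _ ?n ?n _ ?n]) auto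
    then show ?thesis
      using that by (simp only: cf_mult_index[OF A RM.mats_adj[OF A]] cf_adj[OF c])
  qed
  have P: "A * lp.adj l A \<in> mats ?n ring_Ominus" using A by (intro RM.mats_mult RM.mats_adj)
  have "lp.unitary l A \<longleftrightarrow> (\<forall>i j. i < ?n \<longrightarrow> j < ?n \<longrightarrow> (A * lp.adj l A) $$ (i,j) = 1\<^sub>m ?n $$ (i,j))"
  proof
    assume "lp.unitary l A"
    then show "\<forall>i j. i < ?n \<longrightarrow> j < ?n \<longrightarrow> (A * lp.adj l A) $$ (i,j) = 1\<^sub>m ?n $$ (i,j)" by (simp add: lp.unitary_def)
  next
    assume "\<forall>i j. i < ?n \<longrightarrow> j < ?n \<longrightarrow> (A * lp.adj l A) $$ (i,j) = 1\<^sub>m ?n $$ (i,j)"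
    then have "A * lp.adj l A = 1\<^sub>m ?n" using P by (intro eq_matI) (auto simp: mats_def simp del: index_mult_mat(1))
    then show "lp.unitary l A" using c by (simp add: lp.unitary_def)
  qed
  also have "\<dots> \<longleftrightarrow> (\<forall>i j. i < ?n \<longrightarrow> j < ?n \<longrightarrow> (\<forall>k. fls_nth ((A * lp.adj l A) $$ (i,j)) (- int k) = (if k = 0 \<and> i = j then 1 else 0)))"
  proof -
    have "(A * lp.adj l A) $$ (i,j) = 1\<^sub>m ?n $$ (i,j) \<longleftrightarrow>
      (\<forall>k. fls_nth ((A * lp.adj l A) $$ (i,j)) (- int k) = (if k = 0 \<and> i = j then 1 else 0))" (is "?a \<longleftrightarrow> ?b")
      if ij: "i < ?n" "j < ?n" for i j
    proof
      assume a: ?a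
      show ?b unfolding a using ij by auto
    next
      assume b: ?b
      show ?a
      proof (rule fls_eqI)
        fix m :: int
        show "fls_nth ((A * lp.adj l A) $$ (i,j)) m = fls_nth (1\<^sub>m ?n $$ (i,j)) m"
        proof (cases "m > 0")
          case True
          have "(A * lp.adj l A) $$ (i,j) \<in> ring_Ominus" using P ij by (simp add: mats_def)
          then have "fls_nth ((A * lp.adj l A) $$ (i,j)) m = 0" using True by (simp only: ring_Ominus_def mem_Collect_eq)
          then show ?thesis using True ij by simp
        next
          case False
          then have "m = - int (nat (- m))" by simp
          then have "fls_nth ((A * lp.adj l A) $$ (i,j)) m = (if nat (- m) = 0 \<and> i = j then 1 else 0)"
            using b by metis
          then show ?thesis using ij False by auto
        qed
      qed
    qed
    then show ?thesis by blast
  qed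
  finally show ?thesis by (auto simp: S simp del: index_mult_mat(1))
qed

text \<open>The lowest exponents of f and \<open>bar f\<close> are at most 0 and add up to the one
  of 1, which is 0. Hence f has neither negative nor positive powers of t.\<close>

lemma Ominus_unit_const:
  assumes f: "f \<in> ring_Ominus" and u: "f * bar f = 1"
  shows "f = fls_const (fls_nth f 0)"
proof -
  have nz: "f \<noteq> 0" "bar f \<noteq> 0" using u by auto
  have le: "fls_subdegree g \<le> 0" if "g \<in> ring_Ominus" "g \<noteq> 0" for g :: "complex fls"
    using that nth_fls_subdegree_nonzero[of g] by (auto simp: ring_Ominus_def simp flip: not_less)
  have "fls_subdegree (f * bar f) = 0" using u by simp
  then have "fls_subdegree f + fls_subdegree (bar f) = 0" using nz by simp
  then have sd: "fls_subdegree f = 0" using le[OF f nz(1)] le[OF RM.bar_closed[OF f] nz(2)] by linarith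
  show ?thesis
  proof (rule fls_eqI)
    fix m
    show "fls_nth f m = fls_nth (fls_const (fls_nth f 0)) m"
      using f sd by (cases "m = 0"; cases "m < 0") (auto simp: ring_Ominus_def fls_eq0_below_subdegree)
  qed
qed

text \<open>The determinant of a unitary matrix over \<complex>[1/t] is constant by
  \<open>Ominus_unit_const\<close>, and its value at infinity is 1.\<close>

lemma congruence_minus_iff:
  "A \<in> congruence_minus l \<longleftrightarrow> A \<in> mats (2*l) ring_Ominus \<and> lp.unitary l A \<and> cf 0 A = 1\<^sub>m (2*l)"
proof -
  have "det A = 1" if A: "A \<in> mats (2*l) ring_Ominus" "lp.unitary l A" "c0 A = 1\<^sub>m (2*l)"
  proof -
    have "det A = fls_const (fls_nth (det A) 0)"
      by (rule Ominus_unit_const) (use A in \<open>auto simp: RM.det_closed lp.det_unitary\<close>)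
    also have "fls_nth (det A) 0 = 1" using RM.c0_det[OF A(1)] A(3) by simp
    finally show ?thesis by simp
  qed
  then show ?thesis by (auto simp: congruence_minus_def twisted_iff SL_iff)
qed

text \<open>\<open>fls_shift k\<close> multiplies by t^-k, so this is the loop 1 + x/t +
  y/t^2.\<close>

definition quad_loop :: "nat \<Rightarrow> complex mat \<Rightarrow> complex mat \<Rightarrow> complex fls mat" where
  "quad_loop l x y = mat (2*l) (2*l) (\<lambda>(i,j). fls_const (if i = j then 1 else 0) +
     fls_shift 1 (fls_const (x $$ (i,j))) + fls_shift 2 (fls_const (y $$ (i,j))))"

lemma quad_loop_nth:
  assumes "i < 2*l" "j < 2*l"
  shows "fls_nth (quad_loop l x y $$ (i,j)) m =
    (if m = 0 then (if i = j then 1 else 0) else if m = -1 then x $$ (i,j) else if m = -2 then y $$ (i,j) else 0)"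
  using assms by (auto simp: quad_loop_def)

lemma quad_loop_mats: "quad_loop l x y \<in> mats (2*l) ring_Ominus"
  by (auto simp: mats_def ring_Ominus_def quad_loop_nth) (simp add: quad_loop_def)

lemma cf_quad_loop:
  assumes "x \<in> carrier_mat (2*l) (2*l)" "y \<in> carrier_mat (2*l) (2*l)"
  shows "cf k (quad_loop l x y) = (if k = 0 then 1\<^sub>m (2*l) else if k = 1 then x else if k = 2 then y else 0\<^sub>m (2*l) (2*l))"
  using assms carrier_matD[of "quad_loop l x y" "2*l" "2*l"] quad_loop_mats[of l x y]
  by (intro eq_matI) (auto simp: quad_loop_nth mats_def)

lemma unitary_quadratic_iff:
  assumes A: "A \<in> mats (2*l) ring_Ominus" and c0: "cf 0 A = 1\<^sub>m (2*l)" and c1: "cf 1 A = x" and c2: "cf 2 A = y"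
    and c3: "\<And>k. k \<ge> 3 \<Longrightarrow> cf k A = 0\<^sub>m (2*l) (2*l)"
  shows "lp.unitary l A \<longleftrightarrow> cx.adj l x = x \<and> y + cx.adj l y = x * x \<and> x * cx.adj l y = y * x \<and>
     y * cx.adj l y = 0\<^sub>m (2*l) (2*l)"
proof -
  let ?n = "2*l" let ?Z = "0\<^sub>m ?n ?n :: complex mat"
  have xc: "x \<in> carrier_mat ?n ?n" "y \<in> carrier_mat ?n ?n" using A c1 c2 by (auto simp: mats_def)
  note dims = carrier_matD[OF xc(1)] carrier_matD[OF xc(2)]
  have aZ: "cx.adj l ?Z = ?Z" by (rule eq_matI) (auto simp: cx.adj_index)
  have Zl: "M \<in> carrier_mat ?n ?n \<Longrightarrow> ?Z * M = ?Z" and Zr: "M \<in> carrier_mat ?n ?n \<Longrightarrow> M * ?Z = ?Z" for M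
    by auto
  \<comment> \<open>\<open>T k\<close> is the coefficient of t^-k in the product of A with its
    adjoint. The values k = 1, 2, 3, 4 give the four relations; from k = 5 on every summand contains
    a coefficient of index at least 3.\<close>
  define T where "T k i j = (\<Sum>a\<le>k. (-1)^(k - a) * (cf a A * cx.adj l (cf (k - a) A)) $$ (i,j))" for k i j
  have Ac: "cf a A \<in> carrier_mat ?n ?n" for a using A by (auto simp: mats_def)
  have n34: "cf 3 A = ?Z" "cf 4 A = ?Z" by (rule c3, simp)+
  have T0: "T 0 i j = (if i = j then 1 else 0)" if "i < ?n" "j < ?n" for i j
    using that c0 by (simp add: T_def)
  have T1: "T 1 i j = x $$ (i,j) - cx.adj l x $$ (i,j)" if "i < ?n" "j < ?n" for i j
    using that dims c0 c1 xc by (simp add: T_def)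
  have T2: "T 2 i j = y $$ (i,j) - (x * cx.adj l x) $$ (i,j) + cx.adj l y $$ (i,j)" if "i < ?n" "j < ?n" for i j
  proof -
    have "T 2 i j = (\<Sum>a\<in>{0,1,2}. (-1)^(2 - a) * (cf a A * cx.adj l (cf (2 - a) A)) $$ (i,j))"
      unfolding T_def by (rule sum.cong) auto
    then show ?thesis using that dims c0 c1 c2 xc by (simp del: index_mult_mat(1))
  qed
  have T3: "T 3 i j = (x * cx.adj l y) $$ (i,j) - (y * cx.adj l x) $$ (i,j)" if "i < ?n" "j < ?n" for i j
  proof -
    have "T 3 i j = (\<Sum>a\<in>{0,1,2,3}. (-1)^(3 - a) * (cf a A * cx.adj l (cf (3 - a) A)) $$ (i,j))"
      unfolding T_def by (rule sum.cong) auto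
    then show ?thesis using that dims c0 c1 c2 n34 xc by (simp add: aZ Zl Zr del: index_mult_mat(1))
  qed
  have T4: "T 4 i j = (y * cx.adj l y) $$ (i,j)" if "i < ?n" "j < ?n" for i j
  proof -
    have "T 4 i j = (\<Sum>a\<in>{0,1,2,3,4}. (-1)^(4 - a) * (cf a A * cx.adj l (cf (4 - a) A)) $$ (i,j))"
      unfolding T_def by (rule sum.cong) auto
    then show ?thesis
      using that dims c0 c1 c2 n34 xc by (simp add: aZ Zl Zr del: index_mult_mat(1))
  qed
  have T5: "T k i j = 0" if "i < ?n" "j < ?n" "k \<ge> 5" for i j k
    unfolding T_def
  proof (rule sum.neutral, rule ballI)
    fix a assume "a \<in> {..k}"
    then have "a \<ge> 3 \<or> k - a \<ge> 3" using that by auto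
    then have "cf a A * cx.adj l (cf (k - a) A) = ?Z"
      using c3[of a] c3[of "k - a"] Ac by (auto simp: aZ Zl Zr)
    then show "(-1)^(k - a) * (cf a A * cx.adj l (cf (k - a) A)) $$ (i,j) = 0" using that by simp
  qed
  have eqI: "M = N" if "\<And>i j. i < ?n \<Longrightarrow> j < ?n \<Longrightarrow> M $$ (i,j) = N $$ (i,j)"
    "M \<in> carrier_mat ?n ?n" "N \<in> carrier_mat ?n ?n" for M N :: "complex mat"
    using that by (intro eq_matI) auto
  have mc: "M * N \<in> carrier_mat ?n ?n" if "M \<in> carrier_mat ?n ?n" "N \<in> carrier_mat ?n ?n" for M N :: "complex mat"
    using that by simp
  have U: "lp.unitary l A \<longleftrightarrow> (\<forall>k i j. i < ?n \<longrightarrow> j < ?n \<longrightarrow> T k i j = (if k = 0 \<and> i = j then 1 else 0))"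
    unfolding T_def by (rule unitary_iff_cf[OF A])
  show ?thesis
  proof
    assume "lp.unitary l A"
    then have T: "\<And>k i j. i < ?n \<Longrightarrow> j < ?n \<Longrightarrow> T k i j = (if k = 0 \<and> i = j then 1 else 0)" using U by blast
    have 1: "cx.adj l x = x"
      by (rule eqI) (use T[of _ _ 1] T1 xc in auto)
    have 2: "y + cx.adj l y = x * x"
    proof (rule eqI)
      fix i j assume ij: "i < ?n" "j < ?n"
      show "(y + cx.adj l y) $$ (i,j) = (x * x) $$ (i,j)"
        using T[of i j 2] T2[of i j] ij dims 1 by (simp add: algebra_simps del: index_mult_mat(1))
    qed (use xc mc in auto)
    have 3: "x * cx.adj l y = y * x"
    proof (rule eqI)
      fix i j assume ij: "i < ?n" "j < ?n"
      show "(x * cx.adj l y) $$ (i,j) = (y * x) $$ (i,j)"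
        using T[of i j 3] T3[of i j] ij dims 1 by (simp del: index_mult_mat(1))
    qed (use xc mc in auto)
    have 4: "y * cx.adj l y = ?Z"
    proof (rule eqI)
      fix i j assume ij: "i < ?n" "j < ?n"
      show "(y * cx.adj l y) $$ (i,j) = ?Z $$ (i,j)"
        using T[of i j 4] T4[of i j] ij by (simp del: index_mult_mat(1))
    qed (use xc mc in auto)
    show "cx.adj l x = x \<and> y + cx.adj l y = x * x \<and> x * cx.adj l y = y * x \<and> y * cx.adj l y = ?Z"
      using 1 2 3 4 by blast
  next
    assume h: "cx.adj l x = x \<and> y + cx.adj l y = x * x \<and> x * cx.adj l y = y * x \<and> y * cx.adj l y = ?Z"
    have TT: "T k i j = (if k = 0 \<and> i = j then 1 else 0)" if ij: "i < ?n" "j < ?n" for k i j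
    proof -
      have yy: "(x * x) $$ (i,j) = y $$ (i,j) + cx.adj l y $$ (i,j)"
        unfolding conjunct1[OF conjunct2[OF h], symmetric] using ij dims by simp
      consider "k = 0" | "k = 1" | "k = 2" | "k = 3" | "k = 4" | "k \<ge> 5" by linarith
      then show ?thesis
      proof cases
        case 3 then show ?thesis using T2[OF ij] h yy by simp
      next
        case 4 then show ?thesis using T3[OF ij] h by simp
      next
        case 5 then show ?thesis using T4[OF ij] h ij by simp
      qed (use T0[OF ij] T1[OF ij] T5[OF ij] h in auto)
    qed
    show "lp.unitary l A" by (intro U[THEN iffD2] allI impI TT)
  qed
qed

lemma quad_loop_small_pair:
  assumes "small_pair l x y" shows "quad_loop l x y \<in> congruence_minus l"
proof -
  have c: "x \<in> carrier_mat (2*l) (2*l)" "y \<in> carrier_mat (2*l) (2*l)" using assms unfolding small_pair_def by blast+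
  note cfs = cf_quad_loop[OF c]
  have c0: "cf 0 (quad_loop l x y) = 1\<^sub>m (2*l)" and c1: "cf 1 (quad_loop l x y) = x" and c2: "cf 2 (quad_loop l x y) = y"
    by (subst cfs, simp)+
  have c3: "cf k (quad_loop l x y) = 0\<^sub>m (2*l) (2*l)" if "k \<ge> 3" for k
    using that by (subst cfs) simp
  have "lp.unitary l (quad_loop l x y)"
  proof (rule iffD2[OF unitary_quadratic_iff[of "quad_loop l x y" l x y]])
    show "cx.adj l x = x \<and> y + cx.adj l y = x * x \<and> x * cx.adj l y = y * x \<and> y * cx.adj l y = 0\<^sub>m (2*l) (2*l)"
      using assms unfolding small_pair_def by (elim conjE) (intro conjI; assumption)
  qed (rule quad_loop_mats c0 c1 c2 c3; assumption)+
  then show ?thesis using quad_loop_mats c0 unfolding congruence_minus_iff by blast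
qed

lemma congruence_minus_small_pair:
  assumes A: "A \<in> congruence_minus l" and c3: "\<And>k. k \<ge> 3 \<Longrightarrow> cf k A = 0\<^sub>m (2*l) (2*l)" and o: "outer (2*l) (cf 2 A)"
  shows "small_pair l (cf 1 A) (cf 2 A)" "A = quad_loop l (cf 1 A) (cf 2 A)"
proof -
  have A': "A \<in> mats (2*l) ring_Ominus" "lp.unitary l A" "cf 0 A = 1\<^sub>m (2*l)" using A by (auto simp: congruence_minus_iff)
  have Ac: "A \<in> carrier_mat (2*l) (2*l)" using A' by (auto simp: mats_def)
  show "small_pair l (cf 1 A) (cf 2 A)"
  proof -
    have "cf k A \<in> carrier_mat (2*l) (2*l)" for k using Ac by simp
    moreover have "cx.adj l (cf 1 A) = cf 1 A \<and> cf 2 A + cx.adj l (cf 2 A) = cf 1 A * cf 1 A \<and>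
        cf 1 A * cx.adj l (cf 2 A) = cf 2 A * cf 1 A \<and> cf 2 A * cx.adj l (cf 2 A) = 0\<^sub>m (2*l) (2*l)"
      by (rule iffD1[OF unitary_quadratic_iff[of A l "cf 1 A" "cf 2 A"]]) (rule A' c3 refl; assumption)+
    ultimately show ?thesis
      using o unfolding small_pair_def by (elim conjE) (intro conjI; assumption)
  qed
  show "A = quad_loop l (cf 1 A) (cf 2 A)"
  proof (rule eq_matI)
    fix i j assume "i < dim_row (quad_loop l (cf 1 A) (cf 2 A))" "j < dim_col (quad_loop l (cf 1 A) (cf 2 A))"
    then have ij: "i < 2*l" "j < 2*l" by (auto simp: quad_loop_def)
    show "A $$ (i,j) = quad_loop l (cf 1 A) (cf 2 A) $$ (i,j)"
    proof (rule fls_eqI)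
      fix m :: int
      have cfi: "fls_nth (A $$ (i,j)) (- int k) = cf k A $$ (i,j)" for k using ij Ac by simp
      consider "m > 0" | "m = 0" | "m = -1" | "m = -2" | k where "k \<ge> 3" "m = - int k"
      proof -
        assume *: "m > 0 \<Longrightarrow> thesis" "m = 0 \<Longrightarrow> thesis" "m = -1 \<Longrightarrow> thesis" "m = -2 \<Longrightarrow> thesis"
          "\<And>k. 3 \<le> k \<Longrightarrow> m = - int k \<Longrightarrow> thesis"
        show thesis using *(1-4) *(5)[of "nat (- m)"] by linarith
      qed
      then show "fls_nth (A $$ (i,j)) m = fls_nth (quad_loop l (cf 1 A) (cf 2 A) $$ (i,j)) m"
      proof cases
        case 1 then show ?thesis using A'(1) ij by (simp add: quad_loop_nth mats_def ring_Ominus_def)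
      next
        case 2 then show ?thesis using cfi[of 0] A'(3) ij by (simp add: quad_loop_nth)
      next
        case 5 then show ?thesis using cfi[of k] c3[of k] ij by (simp add: quad_loop_nth)
      qed (use ij Ac in \<open>auto simp: quad_loop_nth\<close>)
    qed
  qed (use Ac in \<open>auto simp: quad_loop_def\<close>)
qed

section \<open>Varieties and dimension\<close>

lemma topspace_zariski [simp]: "topspace (zariski C X) = X"
proof
  show "topspace (zariski C X) \<subseteq> X" by (auto simp: topspace_def openin_zariski)
  have "openin (zariski C X) X"
    unfolding openin_zariski by (rule exI[of _ "{\<lambda>_. 1}"]) (auto intro: polyfun.const)
  then show "X \<subseteq> topspace (zariski C X)" by (rule openin_subset)
qed

lemma closedin_zariski:
  "closedin (zariski C X) S \<longleftrightarrow> (\<exists>F \<subseteq> polyfun C. S = {a \<in> X. \<forall>f\<in>F. f a = 0})"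
proof -
  have "closedin (zariski C X) S \<longleftrightarrow> S \<subseteq> X \<and> (\<exists>F \<subseteq> polyfun C. X - S = {a \<in> X. \<exists>f\<in>F. f a \<noteq> 0})"
    by (simp add: closedin_def openin_zariski)
  also have "\<dots> \<longleftrightarrow> (\<exists>F \<subseteq> polyfun C. S = {a \<in> X. \<forall>f\<in>F. f a = 0})"
  proof -
    have D: "S \<subseteq> X \<and> X - S = D \<longleftrightarrow> S = X - D" if "D \<subseteq> X" for D using that by auto
    have h: "S \<subseteq> X \<and> X - S = {a \<in> X. \<exists>f\<in>F. f a \<noteq> 0} \<longleftrightarrow> S = {a \<in> X. \<forall>f\<in>F. f a = 0}" for F
    proof -
      have "X - {a \<in> X. \<exists>f\<in>F. f a \<noteq> 0} = {a \<in> X. \<forall>f\<in>F. f a = 0}" by auto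
      then show ?thesis by (subst D) auto
    qed
    show ?thesis unfolding h[symmetric] by auto
  qed
  finally show ?thesis .
qed

lemma polyfun_pullback:
  assumes "\<And>d. d \<in> D \<Longrightarrow> \<exists>q\<in>polyfun C. \<forall>a\<in>X. q a = d (\<phi> a)" and "f \<in> polyfun D"
  shows "\<exists>q\<in>polyfun C. \<forall>a\<in>X. q a = f (\<phi> a)"
  using assms(2)
proof induction
  case (const c)
  show ?case by (rule bexI[OF _ polyfun.const[of c]]) simp
next
  case (coord f)
  then show ?case by (rule assms(1))
next
  case (add f g)
  then obtain p q where "p \<in> polyfun C" "q \<in> polyfun C" "\<forall>a\<in>X. p a = f (\<phi> a)" "\<forall>a\<in>X. q a = g (\<phi> a)" by blast
  then show ?case using polyfun.add[of p C q] by (intro bexI[of _ "\<lambda>a. p a + q a"]) auto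
next
  case (mult f g)
  then obtain p q where "p \<in> polyfun C" "q \<in> polyfun C" "\<forall>a\<in>X. p a = f (\<phi> a)" "\<forall>a\<in>X. q a = g (\<phi> a)" by blast
  then show ?case using polyfun.mult[of p C q] by (intro bexI[of _ "\<lambda>a. p a * q a"]) auto
qed

text \<open>Once coordinates pull back to polynomial functions, so do all polynomial functions, and
  with them open sets and local fractions. Functions are defined on the whole type, hence the
  pullbacks are compared on X only.\<close>

lemma variety_morphismI:
  assumes maps: "\<phi> ` X \<subseteq> Y"
    and D: "\<And>d. d \<in> D \<Longrightarrow> \<exists>q\<in>polyfun C. \<forall>a\<in>X. q a = d (\<phi> a)"
  shows "variety_morphism C X D Y \<phi>"
proof -
  have pb: "\<exists>q\<in>polyfun C. \<forall>a\<in>X. q a = f (\<phi> a)" if "f \<in> polyfun D" for f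
    by (rule polyfun_pullback[of D C X \<phi> f, OF D that])
  have op: "openin (zariski C X) {a \<in> X. \<phi> a \<in> U}" if "openin (zariski D Y) U" for U
  proof -
    from that obtain F where F: "F \<subseteq> polyfun D" "U = {b \<in> Y. \<exists>f\<in>F. f b \<noteq> 0}"
      unfolding openin_zariski by blast
    \<comment> \<open>All polynomial functions that agree on X with the pullback of some member of
      F; taking all of them avoids a choice for each member.\<close>
    define G where "G = {q \<in> polyfun C. \<exists>f\<in>F. \<forall>a\<in>X. q a = f (\<phi> a)}"
    have "{a \<in> X. \<phi> a \<in> U} = {a \<in> X. \<exists>q\<in>G. q a \<noteq> 0}"
    proof (intro Collect_cong conj_cong refl)
      fix a assume a: "a \<in> X"
      have "(\<exists>f\<in>F. f (\<phi> a) \<noteq> 0) \<longleftrightarrow> (\<exists>q\<in>G. q a \<noteq> 0)"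
      proof
        assume "\<exists>f\<in>F. f (\<phi> a) \<noteq> 0"
        then obtain f where f: "f \<in> F" "f (\<phi> a) \<noteq> 0" by blast
        then have "f \<in> polyfun D" using F(1) by auto
        from pb[OF this] obtain q where q: "q \<in> polyfun C" "\<forall>a\<in>X. q a = f (\<phi> a)" by (rule bexE)
        then have "q \<in> G" using f(1) by (auto simp: G_def)
        moreover have "q a \<noteq> 0" using q(2) a f(2) by simp
        ultimately show "\<exists>q\<in>G. q a \<noteq> 0" by auto
      next
        assume "\<exists>q\<in>G. q a \<noteq> 0"
        then obtain q f where "q a \<noteq> 0" "f \<in> F" "\<forall>a\<in>X. q a = f (\<phi> a)" unfolding G_def by auto
        then show "\<exists>f\<in>F. f (\<phi> a) \<noteq> 0" using a by (intro bexI[of _ f]) auto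
      qed
      then show "\<phi> a \<in> U \<longleftrightarrow> (\<exists>q\<in>G. q a \<noteq> 0)" unfolding F(2) using maps a by auto
    qed
    then show ?thesis unfolding openin_zariski by (intro exI[of _ G]) (auto simp: G_def)
  qed
  show ?thesis unfolding variety_morphism_def
  proof (intro conjI allI impI)
    show "continuous_map (zariski C X) (zariski D Y) \<phi>"
      unfolding continuous_map_def using op maps by auto
  next
    fix V f assume reg: "regular_on D Y V f"
    then have V: "openin (zariski D Y) V" by (simp add: regular_on_def)
    show "regular_on C X {a \<in> X. \<phi> a \<in> V} (f \<circ> \<phi>)" unfolding regular_on_def
    proof (intro conjI ballI op[OF V])
      fix a assume "a \<in> {a \<in> X. \<phi> a \<in> V}"
      then have a: "a \<in> X" "\<phi> a \<in> V" by auto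
      from reg a(2) obtain W p q where W: "openin (zariski D Y) W" "\<phi> a \<in> W" "W \<subseteq> V" "p \<in> polyfun D" "q \<in> polyfun D"
        "\<forall>b\<in>W. q b \<noteq> 0 \<and> f b = p b / q b" unfolding regular_on_def by blast
      from pb[OF W(4)] obtain p' where p': "p' \<in> polyfun C" "\<forall>a\<in>X. p' a = p (\<phi> a)" by (rule bexE)
      from pb[OF W(5)] obtain q' where q': "q' \<in> polyfun C" "\<forall>a\<in>X. q' a = q (\<phi> a)" by (rule bexE)
      show "\<exists>V' p q. openin (zariski C X) V' \<and> a \<in> V' \<and> V' \<subseteq> {a \<in> X. \<phi> a \<in> V} \<and> p \<in> polyfun C \<and> q \<in> polyfun C \<and>
          (\<forall>b\<in>V'. q b \<noteq> 0 \<and> (f \<circ> \<phi>) b = p b / q b)"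
        using a W p' q' op[OF W(1)]
        by (intro exI[of _ "{a \<in> X. \<phi> a \<in> W}"] exI[of _ p'] exI[of _ q']) auto
    qed
  qed
qed

lemma variety_isomorphicI:
  assumes "\<And>a. a \<in> X \<Longrightarrow> \<phi> a \<in> Y" "\<And>b. b \<in> Y \<Longrightarrow> \<psi> b \<in> X"
    and "\<And>a. a \<in> X \<Longrightarrow> \<psi> (\<phi> a) = a" "\<And>b. b \<in> Y \<Longrightarrow> \<phi> (\<psi> b) = b"
    and "\<And>d. d \<in> D \<Longrightarrow> \<exists>q\<in>polyfun C. \<forall>a\<in>X. q a = d (\<phi> a)"
    and "\<And>c. c \<in> C \<Longrightarrow> \<exists>q\<in>polyfun D. \<forall>b\<in>Y. q b = c (\<psi> b)"
  shows "variety_isomorphic C X D Y"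
  unfolding variety_isomorphic_def
  using assms variety_morphismI[of \<phi> X Y D C] variety_morphismI[of \<psi> Y X C D]
  by (intro exI[of _ \<phi>] exI[of _ \<psi>]) auto

lemma irreducible_no_zero_divisors:
  assumes "irreducible_in (zariski C X) Z" "Z \<subseteq> X" "f \<in> polyfun C" "g \<in> polyfun C"
    and "\<And>z. z \<in> Z \<Longrightarrow> f z * g z = 0"
  shows "(\<forall>z\<in>Z. f z = 0) \<or> (\<forall>z\<in>Z. g z = 0)"
proof -
  have cl: "closedin (zariski C X) {a \<in> X. h a = 0}" if "h \<in> polyfun C" for h
    unfolding closedin_zariski using that by (intro exI[of _ "{h}"]) auto
  have "Z \<subseteq> {a \<in> X. f a = 0} \<union> {a \<in> X. g a = 0}" using assms(2,5) by auto
  then have "Z \<subseteq> {a \<in> X. f a = 0} \<or> Z \<subseteq> {a \<in> X. g a = 0}"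
    using assms(1) cl[OF assms(3)] cl[OF assms(4)] unfolding irreducible_in_def by blast
  then show ?thesis by blast
qed

section \<open>Monomials and chains of irreducible closed sets\<close>

lemma polyfun_power: "f \<in> polyfun C \<Longrightarrow> (\<lambda>a. f a ^ k) \<in> polyfun C"
  by (induction k) (auto intro: polyfun.const polyfun.mult)

lemma polyfun_sum: "(\<And>i. i \<in> S \<Longrightarrow> f i \<in> polyfun C) \<Longrightarrow> (\<lambda>a. \<Sum>i\<in>S. f i a) \<in> polyfun C"
  by (induction S rule: infinite_finite_induct) (auto intro: polyfun.const polyfun.add)

text \<open>The exponent at the head of the list belongs to the function of highest index, namely
  the length of the tail. This is the function that the induction along a chain splits off
  first.\<close>

fun monom_fun :: "(nat \<Rightarrow> 'a \<Rightarrow> complex) \<Rightarrow> nat list \<Rightarrow> 'a \<Rightarrow> complex" where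
  "monom_fun f [] a = 1"
| "monom_fun f (k # e) a = f (length e) a ^ k * monom_fun f e a"

text \<open>Used in two ways: as exponent vectors of monomials, and as the points of the grid
  {0..d}^m on which functions of bounded degree are tested.\<close>

definition exps :: "nat \<Rightarrow> nat \<Rightarrow> nat list set" where
  "exps m d = {e. set e \<subseteq> {..d} \<and> length e = m}"

lemma finite_exps [simp]: "finite (exps m d)"
  unfolding exps_def by (rule finite_lists_length_eq) simp

lemma card_exps: "card (exps m d) = (d + 1) ^ m"
  unfolding exps_def by (subst card_lists_length_eq) auto

lemma exps_0: "exps 0 d = {[]}" by (auto simp: exps_def)

lemma exps_Suc: "exps (Suc m) d = (\<lambda>(k,e). k # e) ` ({..d} \<times> exps m d)"
  by (auto simp: exps_def length_Suc_conv image_iff)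

lemma sum_exps_Suc: "(\<Sum>e\<in>exps (Suc m) d. F e) = (\<Sum>k\<le>d. \<Sum>e\<in>exps m d. F (k # e))"
  unfolding exps_Suc by (subst sum.reindex) (simp_all add: inj_on_def sum.cartesian_product split_beta comp_def)

lemma monom_fun_polyfun: "(\<And>i. i < length e \<Longrightarrow> f i \<in> polyfun C) \<Longrightarrow> monom_fun f e \<in> polyfun C"
proof (induction e)
  case Nil
  have "monom_fun f [] = (\<lambda>_. 1)" by (rule ext) simp
  then show ?case using polyfun.const[of 1 C] by simp
next
  case (Cons k e)
  have "(\<lambda>a. f (length e) a ^ k * monom_fun f e a) \<in> polyfun C"
    using Cons by (intro polyfun.mult polyfun_power) auto
  moreover have "monom_fun f (k # e) = (\<lambda>a. f (length e) a ^ k * monom_fun f e a)" by (rule ext) simp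
  ultimately show ?case by simp
qed

text \<open>
  The function \<open>f i\<close> vanishes on \<open>Z i\<close> but not on \<open>Z (Suc i)\<close>; dividing a relation by the largest
  possible power of the last function and restricting to the next smaller set removes that function.
\<close>

lemma chain_algebraic_independence:
  assumes irr: "\<And>i. i \<le> m \<Longrightarrow> irreducible_in (zariski C X) (Z i) \<and> Z i \<subseteq> X"
    and sub: "\<And>i. i < m \<Longrightarrow> Z i \<subseteq> Z (Suc i)"
    and f: "\<And>i. i < m \<Longrightarrow> f i \<in> polyfun C" "\<And>i z. i < m \<Longrightarrow> z \<in> Z i \<Longrightarrow> f i z = 0"
      "\<And>i. i < m \<Longrightarrow> \<exists>z\<in>Z (Suc i). f i z \<noteq> 0"
    and rel: "\<And>z. z \<in> Z m \<Longrightarrow> (\<Sum>e\<in>exps m d. c e * monom_fun f e z) = 0"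
    and e: "e \<in> exps m d"
  shows "c e = 0"
  using assms
proof (induction m arbitrary: c e)
  case 0
  have "Z 0 \<noteq> {}" using 0(1)[of 0] by (simp add: irreducible_in_def)
  then obtain z where "z \<in> Z 0" by blast
  then show ?case using 0(6)[of z] 0(7) by (simp add: exps_0)
next
  case (Suc m)
  \<comment> \<open>The relation read as a polynomial in \<open>f m\<close>, with \<open>R k\<close>
    as coefficient of the k-th power.\<close>
  define R where "R k z = (\<Sum>e\<in>exps m d. c (k # e) * monom_fun f e z)" for k z
  have R: "R k \<in> polyfun C" for k
    unfolding R_def using Suc.prems(3)
    by (intro polyfun_sum polyfun.mult polyfun.const monom_fun_polyfun[of _ f, simplified]) (auto simp: exps_def)
  have IH: "\<forall>e\<in>exps m d. c (k # e) = 0" if "\<And>z. z \<in> Z m \<Longrightarrow> R k z = 0" for k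
  proof
    fix e assume e: "e \<in> exps m d"
    show "c (k # e) = 0"
    proof (rule Suc.IH[of "\<lambda>e. c (k # e)" e])
      show "irreducible_in (zariski C X) (Z i) \<and> Z i \<subseteq> X" if "i \<le> m" for i using Suc.prems(1)[of i] that by simp
      show "Z i \<subseteq> Z (Suc i)" if "i < m" for i using Suc.prems(2)[of i] that by simp
      show "f i \<in> polyfun C" if "i < m" for i using Suc.prems(3)[of i] that by simp
      show "f i z = 0" if "i < m" "z \<in> Z i" for i z using Suc.prems(4)[of i z] that by simp
      show "\<exists>z\<in>Z (Suc i). f i z \<noteq> 0" if "i < m" for i using Suc.prems(5)[of i] that by simp
      show "(\<Sum>e\<in>exps m d. c (k # e) * monom_fun f e z) = 0" if "z \<in> Z m" for z
        using \<open>\<And>z. z \<in> Z m \<Longrightarrow> R k z = 0\<close>[OF that] by (simp add: R_def)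
    qed (rule e)
  qed
  have rel: "(\<Sum>k\<le>d. f m z ^ k * R k z) = 0" if "z \<in> Z (Suc m)" for z
  proof -
    have "(\<Sum>e\<in>exps (Suc m) d. c e * monom_fun f e z) = (\<Sum>k\<le>d. \<Sum>e\<in>exps m d. c (k # e) * (f (length e) z ^ k * monom_fun f e z))"
      by (simp add: sum_exps_Suc)
    also have "\<dots> = (\<Sum>k\<le>d. f m z ^ k * R k z)"
      unfolding R_def sum_distrib_left by (intro sum.cong refl) (auto simp: exps_def)
    finally show ?thesis using Suc.prems(6)[OF that] by simp
  qed
  have "\<forall>e\<in>exps m d. c (k # e) = 0" if "k \<le> d" for k
    using that
  proof (induction k rule: less_induct)
    case (less k)
    have R0: "R j z = 0" if "j < k" for j z
      using less.IH[of j] less.prems that by (auto simp: R_def)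
    \<comment> \<open>The relation divided by the k-th power of \<open>f m\<close>, lower terms
      being known to vanish. On \<open>Z m\<close>, where \<open>f m\<close> is zero, only
      \<open>R k\<close> is left of it.\<close>
    define T where "T z = (\<Sum>j\<in>{k..d}. f m z ^ (j - k) * R j z)" for z
    have T: "T \<in> polyfun C" unfolding T_def
      using Suc.prems(3) R by (intro polyfun_sum polyfun.mult polyfun_power[of "f m", simplified]) auto
    have "f m z ^ k * T z = 0" if z: "z \<in> Z (Suc m)" for z
    proof -
      have "(\<Sum>j\<le>d. f m z ^ j * R j z) = (\<Sum>j\<in>{k..d}. f m z ^ j * R j z)"
        using less.prems R0 by (intro sum.mono_neutral_right) (auto simp: not_le)
      also have "\<dots> = f m z ^ k * T z"
        unfolding T_def sum_distrib_left
        by (intro sum.cong) (auto simp flip: mult.assoc power_add)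
      finally show ?thesis using rel[OF z] by simp
    qed
    then have "(\<forall>z\<in>Z (Suc m). f m z ^ k = 0) \<or> (\<forall>z\<in>Z (Suc m). T z = 0)"
      using Suc.prems(1)[of "Suc m"] Suc.prems(3)[of m] T
      by (intro irreducible_no_zero_divisors[of C X] polyfun_power[of "f m", simplified]) auto
    then have T0: "T z = 0" if "z \<in> Z (Suc m)" for z using Suc.prems(5)[of m] that by auto
    have "R k z = 0" if z: "z \<in> Z m" for z
    proof -
      have "T z = (\<Sum>j\<in>{k}. f m z ^ (j - k) * R j z)"
        unfolding T_def using Suc.prems(4)[of m z] z less.prems
        by (intro sum.mono_neutral_right) (auto simp: power_0_left)
      then show ?thesis using T0[of z] Suc.prems(2)[of m] z by auto
    qed
    then show ?case by (rule IH)
  qed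
  then show ?case using Suc.prems(7) by (auto simp: exps_Suc)
qed

section \<open>Counting equations and the upper bound for the dimension\<close>

lemma homogeneous_system:
  fixes a :: "'k \<Rightarrow> 'g \<Rightarrow> complex"
  assumes "finite G" "finite K" "card G < card K"
  shows "\<exists>c. (\<exists>k\<in>K. c k \<noteq> 0) \<and> (\<forall>g\<in>G. (\<Sum>k\<in>K. c k * a k g) = 0)"
  using assms
proof (induction G arbitrary: K a rule: finite_induct)
  case empty
  then have "K \<noteq> {}" by auto
  then show ?case by (intro exI[of _ "\<lambda>_. 1"]) auto
next
  case (insert g G)
  show ?case
  proof (cases "\<forall>k\<in>K. a k g = 0")
    case True
    have "\<exists>c. (\<exists>k\<in>K. c k \<noteq> 0) \<and> (\<forall>g\<in>G. (\<Sum>k\<in>K. c k * a k g) = 0)"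
      using insert by (intro insert.IH) auto
    then obtain c where "\<exists>k\<in>K. c k \<noteq> 0" "\<forall>g\<in>G. (\<Sum>k\<in>K. c k * a k g) = 0" by blast
    then show ?thesis using True by (intro exI[of _ c]) auto
  next
    case False
    then obtain k0 where k0: "k0 \<in> K" "a k0 g \<noteq> 0" by auto
    \<comment> \<open>One step of elimination: equation g is solved for the unknown
      \<open>k0\<close>. The others solve the reduced system, and \<open>s\<close> is the value
      which g then assigns to \<open>k0\<close>.\<close>
    define a' where "a' k h = a k h - a k g / a k0 g * a k0 h" for k h
    have "card G < card (K - {k0})" using insert k0 by simp
    then obtain c where c: "\<exists>k\<in>K - {k0}. c k \<noteq> 0" "\<forall>h\<in>G. (\<Sum>k\<in>K - {k0}. c k * a' k h) = 0"
      using insert.IH[of "K - {k0}" a'] insert.prems by auto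
    define s where "s = - (\<Sum>k\<in>K - {k0}. c k * (a k g / a k0 g))"
    define c' where "c' k = (if k = k0 then s else c k)" for k
    have S: "(\<Sum>k\<in>K. c' k * a k h) = (\<Sum>k\<in>K - {k0}. c k * a' k h)" for h
    proof -
      have "(\<Sum>k\<in>K. c' k * a k h) = s * a k0 h + (\<Sum>k\<in>K - {k0}. c' k * a k h)"
        using insert.prems k0 by (subst sum.remove[of K k0]) (auto simp: c'_def)
      also have "(\<Sum>k\<in>K - {k0}. c' k * a k h) = (\<Sum>k\<in>K - {k0}. c k * a k h)"
        by (intro sum.cong) (auto simp: c'_def)
      finally show ?thesis
        by (simp add: s_def a'_def algebra_simps sum_subtractf sum_distrib_left sum_distrib_right)
    qed
    have "a' k g = 0" for k using k0 by (simp add: a'_def)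
    then have "(\<Sum>k\<in>K. c' k * a k g) = 0" by (simp add: S)
    moreover have "\<exists>k\<in>K. c' k \<noteq> 0" using c(1) by (auto simp: c'_def)
    ultimately show ?thesis using c(2) by (intro exI[of _ c']) (auto simp: S)
  qed
qed

text \<open>Polynomial of degree at most B in each of the first n variables separately, expressed on
  coordinate lines so that univariate polynomials suffice.\<close>

definition deg_bounded :: "nat \<Rightarrow> nat \<Rightarrow> ((nat \<Rightarrow> complex) \<Rightarrow> complex) \<Rightarrow> bool" where
  "deg_bounded n B g \<longleftrightarrow> (\<forall>v w. (\<forall>i<n. v i = w i) \<longrightarrow> g v = g w) \<and>
     (\<forall>i<n. \<forall>v. \<exists>p. degree p \<le> B \<and> (\<forall>t. g (v(i := t)) = poly p t))"

lemma deg_bounded_cong: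
  assumes "deg_bounded n B g" "\<And>i. i < n \<Longrightarrow> v i = w i" shows "g v = g w"
  by (rule assms(1)[unfolded deg_bounded_def, THEN conjunct1, rule_format]) (rule assms(2))

lemma deg_bounded_poly:
  fixes v :: "nat \<Rightarrow> complex"
  assumes "deg_bounded n B g" "i < n"
  obtains p where "degree p \<le> B" "\<And>t. g (v(i := t)) = poly p t"
proof -
  have "\<forall>v. \<exists>p. degree p \<le> B \<and> (\<forall>t. g (v(i := t)) = poly p t)"
    using assms(1,2) unfolding deg_bounded_def by blast
  then have "\<exists>p. degree p \<le> B \<and> (\<forall>t. g (v(i := t)) = poly p t)" by (rule spec)
  then obtain p where p: "degree p \<le> B \<and> (\<forall>t. g (v(i := t)) = poly p t)" by (rule exE)
  show ?thesis by (rule that[OF conjunct1[OF p]]) (rule conjunct2[OF p, rule_format])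
qed

lemma deg_boundedI:
  assumes "\<And>v w. (\<And>i. i < n \<Longrightarrow> v i = w i) \<Longrightarrow> g v = g w"
    and "\<And>i v. i < n \<Longrightarrow> \<exists>p. degree p \<le> B \<and> (\<forall>t. g (v(i := t)) = poly p t)"
  shows "deg_bounded n B g"
  unfolding deg_bounded_def
proof (intro conjI allI impI)
  fix v w :: "nat \<Rightarrow> complex" assume "\<forall>i<n. v i = w i"
  then show "g v = g w" by (intro assms(1)) simp
qed (rule assms(2))

lemma deg_bounded_const: "deg_bounded n B (\<lambda>_. c)"
  by (rule deg_boundedI) (auto intro!: exI[of _ "[:c:]"])

lemma deg_bounded_mono:
  assumes "deg_bounded n B g" "B \<le> B'" shows "deg_bounded n B' g"
proof (rule deg_boundedI)
  fix i and v :: "nat \<Rightarrow> complex" assume i: "i < n"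
  obtain p where "degree p \<le> B" "\<And>t. g (v(i := t)) = poly p t" using deg_bounded_poly[OF assms(1) i] by metis
  then show "\<exists>p. degree p \<le> B' \<and> (\<forall>t. g (v(i := t)) = poly p t)" using assms(2) by (intro exI[of _ p]) auto
qed (rule deg_bounded_cong[OF assms(1)])

lemma deg_bounded_add:
  assumes "deg_bounded n B g" "deg_bounded n B h" shows "deg_bounded n B (\<lambda>v. g v + h v)"
proof (rule deg_boundedI)
  fix v w :: "nat \<Rightarrow> complex" assume "\<And>i. i < n \<Longrightarrow> v i = w i"
  then show "g v + h v = g w + h w" by (intro arg_cong2[where f = "(+)"] deg_bounded_cong[OF assms(1)] deg_bounded_cong[OF assms(2)])
next
  fix i and v :: "nat \<Rightarrow> complex" assume i: "i < n"
  obtain p where p: "degree p \<le> B" "\<And>t. g (v(i := t)) = poly p t" using deg_bounded_poly[OF assms(1) i] by metis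
  obtain q where q: "degree q \<le> B" "\<And>t. h (v(i := t)) = poly q t" using deg_bounded_poly[OF assms(2) i] by metis
  show "\<exists>p. degree p \<le> B \<and> (\<forall>t. g (v(i := t)) + h (v(i := t)) = poly p t)"
    using p q by (intro exI[of _ "p + q"]) (auto intro: degree_add_le)
qed

lemma deg_bounded_mult:
  assumes "deg_bounded n B g" "deg_bounded n B' h" shows "deg_bounded n (B + B') (\<lambda>v. g v * h v)"
proof (rule deg_boundedI)
  fix v w :: "nat \<Rightarrow> complex" assume "\<And>i. i < n \<Longrightarrow> v i = w i"
  then show "g v * h v = g w * h w" by (intro arg_cong2[where f = "(*)"] deg_bounded_cong[OF assms(1)] deg_bounded_cong[OF assms(2)])
next
  fix i and v :: "nat \<Rightarrow> complex" assume i: "i < n"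
  obtain p where p: "degree p \<le> B" "\<And>t. g (v(i := t)) = poly p t" using deg_bounded_poly[OF assms(1) i] by metis
  obtain q where q: "degree q \<le> B'" "\<And>t. h (v(i := t)) = poly q t" using deg_bounded_poly[OF assms(2) i] by metis
  show "\<exists>p. degree p \<le> B + B' \<and> (\<forall>t. g (v(i := t)) * h (v(i := t)) = poly p t)"
    using p q degree_mult_le[of p q] by (intro exI[of _ "p * q"]) auto
qed

lemma deg_bounded_power: "deg_bounded n B g \<Longrightarrow> deg_bounded n (k * B) (\<lambda>v. g v ^ k)"
  by (induction k) (auto intro: deg_bounded_const deg_bounded_mult)

lemma deg_bounded_sum:
  "(\<And>k. k \<in> K \<Longrightarrow> deg_bounded n B (g k)) \<Longrightarrow> deg_bounded n B (\<lambda>v. \<Sum>k\<in>K. g k v)"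
  by (induction K rule: infinite_finite_induct) (auto intro: deg_bounded_const deg_bounded_add)

lemma deg_bounded_grid:
  assumes g: "deg_bounded n B g" and 0: "\<And>e. e \<in> exps n B \<Longrightarrow> g (\<lambda>i. if i < n then of_nat (e ! i) else 0) = 0"
  shows "g v = 0"
proof -
  have "g v = 0" if "j \<le> n" "\<forall>i. j \<le> i \<and> i < n \<longrightarrow> v i \<in> of_nat ` {..B}" for j v
    using that
  proof (induction j arbitrary: v)
    case 0
    then have "\<forall>i\<in>{..<n}. \<exists>k. k \<le> B \<and> v i = of_nat k" by auto
    then obtain k where k: "\<forall>i\<in>{..<n}. k i \<le> B \<and> v i = of_nat (k i)" by (rule bchoice[THEN exE])
    let ?e = "map k [0..<n]"
    have "?e \<in> exps n B" using k by (auto simp: exps_def)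
    moreover have "g v = g (\<lambda>i. if i < n then of_nat (?e ! i) else 0)"
      by (rule deg_bounded_cong[OF g]) (use k in auto)
    ultimately show ?case using assms(2) by simp
  next
    case (Suc j)
    obtain p where p: "degree p \<le> B" "\<And>t. g (v(j := t)) = poly p t"
      using deg_bounded_poly[OF g] Suc.prems(1) by (metis Suc_le_lessD)
    have "poly p (of_nat k) = 0" if "k \<le> B" for k
      unfolding p(2)[symmetric] using Suc.prems that by (intro Suc.IH) auto
    then have "of_nat ` {..B} \<subseteq> {t. poly p t = 0}" by auto
    moreover have "card (of_nat ` {..B} :: complex set) = B + 1"
      by (subst card_image) (auto simp: inj_on_def)
    ultimately have "p = 0" using p(1) poly_roots_finite[of p] card_poly_roots_bound[of p]
      by (metis Suc_eq_plus1 card_mono le_trans not_less_eq_eq)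
    then show ?case using p(2)[of "v j"] by simp
  qed
  show ?thesis by (rule \<open>\<And>v j. j \<le> n \<Longrightarrow> \<forall>i. j \<le> i \<and> i < n \<longrightarrow> v i \<in> of_nat ` {..B} \<Longrightarrow> g v = 0\<close>[of n]) auto
qed

text \<open>
  There are \<open>(d + 1)\<^sup>m\<close> monomials in the \<open>m\<close> functions, but their pullbacks live in a space of dimension
  at most \<open>(m d B + 1)\<^sup>n\<close>; for \<open>m > n\<close> and large \<open>d\<close> this forces a relation.
\<close>

lemma krull_dim_le:
  fixes \<rho> :: "(nat \<Rightarrow> complex) \<Rightarrow> 'a"
  assumes X: "X = range \<rho>" and C: "\<And>c. c \<in> C \<Longrightarrow> \<exists>B. deg_bounded n B (c \<circ> \<rho>)"
  shows "krull_dim (zariski C X) \<le> enat n"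
  unfolding krull_dim_def
proof (rule Sup_least, clarify)
  fix m and Z :: "nat \<Rightarrow> 'a set"
  assume Z: "\<forall>i\<le>m. closedin (zariski C X) (Z i) \<and> irreducible_in (zariski C X) (Z i)"
    and strict: "\<forall>i<m. Z i \<subset> Z (Suc i)"
  have ZX: "Z i \<subseteq> X" if "i \<le> m" for i
    using Z that closedin_subset by force
  have "\<exists>f. f \<in> polyfun C \<and> (\<forall>z\<in>Z i. f z = 0) \<and> (\<exists>z\<in>Z (Suc i). f z \<noteq> 0)" if i: "i < m" for i
  proof -
    have "closedin (zariski C X) (Z i)" using Z i by simp
    then obtain F where F: "F \<subseteq> polyfun C" "Z i = {a \<in> X. \<forall>f\<in>F. f a = 0}" unfolding closedin_zariski by blast
    obtain z where z: "z \<in> Z (Suc i)" "z \<notin> Z i" using strict i by blast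
    then have "z \<in> X" using ZX[of "Suc i"] i by auto
    then obtain f where "f \<in> F" "f z \<noteq> 0" using z F(2) by blast
    then show ?thesis using F z by blast
  qed
  then have "\<forall>i\<in>{..<m}. \<exists>f. f \<in> polyfun C \<and> (\<forall>z\<in>Z i. f z = 0) \<and> (\<exists>z\<in>Z (Suc i). f z \<noteq> 0)" by simp
  then obtain f where f: "\<forall>i\<in>{..<m}. f i \<in> polyfun C \<and> (\<forall>z\<in>Z i. f i z = 0) \<and> (\<exists>z\<in>Z (Suc i). f i z \<noteq> 0)"
    by (rule bchoice[THEN exE])
  have db: "\<exists>B. deg_bounded n B (\<lambda>v. h (\<rho> v))" if "h \<in> polyfun C" for h
    using that
  proof induction
    case (const c)
    then show ?case using deg_bounded_const by blast
  next
    case (coord h)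
    then show ?case using C[of h] by (simp add: comp_def)
  next
    case (add g h)
    then obtain B B' where "deg_bounded n B (\<lambda>v. g (\<rho> v))" "deg_bounded n B' (\<lambda>v. h (\<rho> v))" by blast
    then have "deg_bounded n (max B B') (\<lambda>v. g (\<rho> v) + h (\<rho> v))"
      by (intro deg_bounded_add) (auto elim: deg_bounded_mono)
    then show ?case by blast
  next
    case (mult g h)
    then show ?case using deg_bounded_mult by blast
  qed
  define Bf where "Bf i = (SOME B. deg_bounded n B (\<lambda>v. f i (\<rho> v)))" for i
  have Bf: "deg_bounded n (Bf i) (\<lambda>v. f i (\<rho> v))" if "i < m" for i
    unfolding Bf_def by (rule someI_ex, rule db) (use f that in blast)
  define B where "B = (\<Sum>i<m. Bf i)"
  have B: "deg_bounded n B (\<lambda>v. f i (\<rho> v))" if "i < m" for i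
    by (rule deg_bounded_mono[OF Bf[OF that]]) (use that in \<open>auto simp: B_def intro: member_le_sum\<close>)
  have mono_deg: "deg_bounded n (j * (d * B)) (\<lambda>v. monom_fun f e (\<rho> v))" if "e \<in> exps j d" "j \<le> m" for e j d
    using that
  proof (induction j arbitrary: e)
    case 0
    then show ?case by (auto simp: exps_0 deg_bounded_const)
  next
    case (Suc j)
    then obtain k e' where e: "e = k # e'" "k \<le> d" "e' \<in> exps j d" by (auto simp: exps_Suc)
    have "deg_bounded n (k * B) (\<lambda>v. f (length e') (\<rho> v) ^ k)"
      using Suc.prems e by (intro deg_bounded_power B) (auto simp: exps_def)
    then have "deg_bounded n (d * B) (\<lambda>v. f (length e') (\<rho> v) ^ k)"
      by (rule deg_bounded_mono) (use e in simp)
    from deg_bounded_mult[OF this Suc.IH[OF e(3)]] Suc.prems show ?case by (simp add: e(1))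
  qed
  have count: "(d + 1) ^ m \<le> (m * (d * B) + 1) ^ n" for d
  proof (rule ccontr)
    assume "\<not> (d + 1) ^ m \<le> (m * (d * B) + 1) ^ n"
    then have "card (exps n (m * (d * B))) < card (exps m d)" by (simp add: card_exps)
    \<comment> \<open>The unknowns are the coefficients of the monomials, the equations are the grid
      points. Any such combination has degree at most m d B in each variable, so vanishing on the
      grid makes it vanish on all of X.\<close>
    then obtain c where c: "\<exists>e\<in>exps m d. c e \<noteq> 0"
      "\<forall>g\<in>exps n (m * (d * B)). (\<Sum>e\<in>exps m d. c e * monom_fun f e (\<rho> (\<lambda>i. if i < n then of_nat (g ! i) else 0))) = 0"
      using homogeneous_system[of "exps n (m * (d * B))" "exps m d" "\<lambda>e g. monom_fun f e (\<rho> (\<lambda>i. if i < n then of_nat (g ! i) else 0))"]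
      by auto
    have bd: "deg_bounded n (m * (d * B)) (\<lambda>v. \<Sum>e\<in>exps m d. c e * monom_fun f e (\<rho> v))"
      using deg_bounded_mult[OF deg_bounded_const[of n 0] mono_deg[of _ m d]]
      by (intro deg_bounded_sum) auto
    have "(\<Sum>e\<in>exps m d. c e * monom_fun f e (\<rho> v)) = 0" for v
      using deg_bounded_grid[OF bd] c(2) by auto
    then have "(\<Sum>e\<in>exps m d. c e * monom_fun f e z) = 0" if "z \<in> Z m" for z
      using ZX[of m] that X by auto
    then have "c e = 0" if "e \<in> exps m d" for e
      using Z ZX strict f that
      by (intro chain_algebraic_independence[of m C X Z f c d e]) auto
    then show False using c(1) by auto
  qed
  have "m \<le> n"
  proof (rule ccontr)
    assume "\<not> m \<le> n"
    then have mn: "Suc n \<le> m" by simp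
    \<comment> \<open>For this d the bound reads (d+1)^m \<le> (m d B + 1)^n \<le> (m B + 1)^n
      (d+1)^n = d (d+1)^n, which is smaller than (d+1)^(n+1).\<close>
    define d where "d = (m * B + 1) ^ n"
    have "(d + 1) ^ Suc n \<le> (d + 1) ^ m" using mn by (intro power_increasing) auto
    also have "\<dots> \<le> (m * (d * B) + 1) ^ n" by (rule count)
    also have "\<dots> \<le> ((m * B + 1) * (d + 1)) ^ n" by (intro power_mono) (auto simp: algebra_simps)
    also have "\<dots> = d * (d + 1) ^ n" by (simp only: power_mult_distrib d_def[symmetric])
    finally show False by simp
  qed
  then show "enat m \<le> enat n" by simp
qed

text \<open>If neither closed set contains the image, join a point missed by the first to a point
  missed by the second by a line. Along it the product of two nonzero univariate polynomials would
  vanish identically.\<close>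

lemma irreducible_image_of_lines:
  fixes \<rho> :: "(nat \<Rightarrow> complex) \<Rightarrow> 'a"
  assumes lines: "\<And>v w t. v \<in> V \<Longrightarrow> w \<in> V \<Longrightarrow> (\<lambda>k. v k + t * w k) \<in> V" and ne: "V \<noteq> {}" and XV: "\<rho> ` V \<subseteq> X"
    and C: "\<And>c v w. c \<in> C \<Longrightarrow> \<exists>p. \<forall>t. c (\<rho> (\<lambda>k. v k + t * w k)) = poly p t"
  shows "irreducible_in (zariski C X) (\<rho> ` V)"
  unfolding irreducible_in_def
proof (intro conjI allI impI)
  have pl: "\<exists>p. \<forall>t. h (\<rho> (\<lambda>k. v k + t * w k)) = poly p t" if "h \<in> polyfun C" for h v w
    using that
  proof induction
    case (const c)
    then show ?case by (intro exI[of _ "[:c:]"]) simp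
  next
    case (coord h)
    then show ?case by (rule C)
  next
    case (add g h)
    then obtain p q where "\<forall>t. g (\<rho> (\<lambda>k. v k + t * w k)) = poly p t" "\<forall>t. h (\<rho> (\<lambda>k. v k + t * w k)) = poly q t" by blast
    then show ?case by (intro exI[of _ "p + q"]) simp
  next
    case (mult g h)
    then obtain p q where "\<forall>t. g (\<rho> (\<lambda>k. v k + t * w k)) = poly p t" "\<forall>t. h (\<rho> (\<lambda>k. v k + t * w k)) = poly q t" by blast
    then show ?case by (intro exI[of _ "p * q"]) simp
  qed
  show "\<rho> ` V \<subseteq> topspace (zariski C X)" using XV by simp
  show "\<rho> ` V \<noteq> {}" using ne by simp
  fix A B assume AB: "closedin (zariski C X) A \<and> closedin (zariski C X) B \<and> \<rho> ` V \<subseteq> A \<union> B"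
  then obtain F G where F: "F \<subseteq> polyfun C" "A = {a \<in> X. \<forall>f\<in>F. f a = 0}" and G: "G \<subseteq> polyfun C" "B = {a \<in> X. \<forall>f\<in>G. f a = 0}"
    unfolding closedin_zariski by blast
  show "\<rho> ` V \<subseteq> A \<or> \<rho> ` V \<subseteq> B"
  proof (rule ccontr)
    assume "\<not> (\<rho> ` V \<subseteq> A \<or> \<rho> ` V \<subseteq> B)"
    then obtain v w where v: "v \<in> V" "\<rho> v \<notin> A" and w: "w \<in> V" "\<rho> w \<notin> B" by blast
    have "\<rho> v \<in> X" "\<rho> w \<in> X" using v w XV by auto
    then obtain f g where f: "f \<in> F" "f (\<rho> v) \<noteq> 0" and g: "g \<in> G" "g (\<rho> w) \<noteq> 0"
      using v w F G by blast
    \<comment> \<open>The line v + t u passes through v at t = 0 and through w at t = 1.\<close>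
    define u where "u k = w k + (-1) * v k" for k
    have u: "u \<in> V" using lines[OF w(1) v(1), of "-1"] by (simp add: u_def[abs_def])
    have L: "(\<lambda>k. v k + t * u k) \<in> V" for t using lines[OF v(1) u] .
    obtain p where p: "\<forall>t. f (\<rho> (\<lambda>k. v k + t * u k)) = poly p t" using pl f F by blast
    obtain q where q: "\<forall>t. g (\<rho> (\<lambda>k. v k + t * u k)) = poly q t" using pl g G by blast
    have "poly (p * q) t = 0" for t
    proof -
      have "\<rho> (\<lambda>k. v k + t * u k) \<in> A \<union> B" using AB L by blast
      then have "f (\<rho> (\<lambda>k. v k + t * u k)) = 0 \<or> g (\<rho> (\<lambda>k. v k + t * u k)) = 0" using F G f g by blast
      then show ?thesis using p q by auto
    qed
    then have "p * q = 0" using poly_all_0_iff_0 by blast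
    moreover have "poly p 0 \<noteq> 0" using p[rule_format, of 0] f by simp
    moreover have "poly q 1 \<noteq> 0" using q[rule_format, of 1] g by (simp add: u_def)
    ultimately show False by auto
  qed
qed

section \<open>Cartan decomposition\<close>

abbreviation tp :: "int \<Rightarrow> complex fls" where "tp \<equiv> fls_X_intpow"

text \<open>The sign that \<open>tp m\<close> picks up under t -> -t (see \<open>bar_tp\<close>), as
  a constant series.\<close>

definition sg :: "int \<Rightarrow> complex fls" where "sg m = fls_const ((-1) powi m)"

lemma tp_nth: "fls_nth (tp m * f) k = fls_nth f (k - m)" "fls_nth (f * tp m) k = fls_nth f (k - m)"
  by (simp_all only: fls_X_intpow_times_conv_shift fls_shift_nth) simp_all

lemma tp_tp: "tp m * tp k = tp (m + k)"
  by (rule fls_X_intpow_times_fls_X_intpow)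

lemma tp_0: "tp 0 = 1" by simp

lemma tp_cancel [simp]: "tp (- m) * (tp m * f) = f" "tp m * (tp (- m) * f) = f"
  by (simp_all only: mult.assoc[symmetric] tp_tp) simp_all

lemma tp_nonzero: "tp m \<noteq> 0"
proof
  assume 0: "tp m = 0"
  have "fls_nth (tp m * 1) m = 1" by (simp only: tp_nth) simp
  then show False unfolding 0 by simp
qed

lemma tp_O: "m \<ge> 0 \<Longrightarrow> tp m \<in> ring_O"
  unfolding ring_O_iff by simp

lemma sg_sg [simp]: "sg m * sg m = 1" "sg m * (sg m * f) = f"
proof -
  have "(-1 :: complex) powi m * (-1) powi m = 1" by (cases "even m") (simp_all add: power_int_minus_left)
  then show "sg m * sg m = 1" unfolding sg_def fls_const_mult_const by simp
  then show "sg m * (sg m * f) = f" by (simp add: mult.assoc[symmetric])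
qed

lemma sg_O [simp]: "sg m \<in> ring_O" by (simp only: sg_def RO.const_closed)

lemma bar_sg [simp]: "bar (sg m) = sg m" by (simp add: sg_def)

lemma bar_tp: "bar (tp m) = sg m * tp m" by (simp only: bar_X_intpow sg_def)

lemma bar_nth_0: "fls_nth (bar f) 0 = fls_nth f 0" by (simp add: bar_nth)

lemma odd_nth_0: "bar f = - f \<Longrightarrow> fls_nth f 0 = 0"
  using bar_nth_0[of f] by simp

lemma O_inverse:
  assumes "f \<in> ring_O" "fls_nth f 0 \<noteq> 0" shows "inverse f \<in> ring_O" "fls_nth (inverse f) 0 = inverse (fls_nth f 0)"
proof -
  from assms obtain F where F: "f = fps_to_fls F" by auto
  have F0: "fps_nth F 0 \<noteq> 0" using assms by (simp add: F)
  have "fps_to_fls F * fps_to_fls (inverse F) = 1"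
    using inverse_mult_eq_1'[OF F0] by (simp flip: fls_times_fps_to_fls)
  then have "inverse f = fps_to_fls (inverse F)" unfolding F by (rule inverse_unique)
  then show "inverse f \<in> ring_O" "fls_nth (inverse f) 0 = inverse (fls_nth f 0)"
    using F0 by (simp_all add: F fps_inverse_nth_0)
qed

lemma O_sqrt:
  assumes f: "f \<in> ring_O" "fls_nth f 0 = 1"
  obtains r where "r \<in> ring_O" "fls_nth r 0 = 1" "r * r = f"
proof -
  from f obtain F where F: "f = fps_to_fls F" by auto
  have F0: "fps_nth F 0 = 1" using f by (simp add: F)
  define R where "R = fps_radical (\<lambda>_ _. 1) 2 F"
  have "R ^ Suc 1 = F" unfolding R_def
    using power_radical[of F "\<lambda>_ _. 1" 1] F0 by (simp add: numeral_2_eq_2)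
  then have RR: "R * R = F" by (simp add: power2_eq_square)
  have R0: "fps_nth R 0 = 1" by (simp add: R_def)
  show ?thesis
    by (rule that[of "fps_to_fls R"]) (use R0 RR F in \<open>simp_all flip: fls_times_fps_to_fls\<close>)
qed

text \<open>A square root is unique up to sign, and the constant term 1 fixes the sign, so the root
  inherits the invariance of f.\<close>

lemma sqrt_bar:
  assumes "r * r = f" "fls_nth r 0 = 1" "bar f = f" shows "bar r = r"
proof -
  have "bar r * bar r = r * r" using assms by (simp flip: lp.cj_mult)
  then have "bar r = r \<or> bar r = - r" by (rule square_eq_iff[THEN iffD1])
  moreover have "fls_nth (bar r) 0 \<noteq> fls_nth (- r) 0" using assms by (simp add: bar_nth_0)
  ultimately show ?thesis by auto
qed

text \<open>The quadratic formula in the form e = a / (1 + r) with r^2 = 1 + a b, which also covers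
  b = 0. As a and b are odd, a b is even without constant term; hence r exists and is even, 1 + r is
  a unit, and e is odd.\<close>

lemma odd_quadratic:
  assumes a: "a \<in> ring_O" "bar a = - a" and b: "b \<in> ring_O" "bar b = - b"
  obtains e where "e \<in> ring_O" "bar e = - e" "b * (e * e) + 2 * e = a"
proof -
  have ab: "1 + a * b \<in> ring_O" using a b by (intro RO.add_closed RO.mult_closed RO.one_closed)
  have ab0: "fls_nth (1 + a * b) 0 = 1"
    using RO.coeff0_mult[OF a(1) b(1)] odd_nth_0[OF a(2)] by simp
  obtain r where r: "r \<in> ring_O" "fls_nth r 0 = 1" "r * r = 1 + a * b" by (rule O_sqrt[OF ab ab0])
  have br: "bar r = r"
    by (rule sqrt_bar[OF r(3,2)]) (simp add: lp.cj_add lp.cj_mult a b)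
  define u where "u = 1 + r"
  have u: "u \<in> ring_O" "fls_nth u 0 \<noteq> 0" "bar u = u"
    using r br by (auto simp: u_def lp.cj_add intro!: RO.add_closed RO.one_closed)
  have nz: "u \<noteq> 0" using u(2) by auto
  define e where "e = a * inverse u"
  have eu: "e * u = a" using nz by (simp add: e_def)
  have "(b * (e * e) + 2 * e) * (u * u) = a * (a * b + 2 * u)"
    unfolding eu[symmetric] by (simp add: algebra_simps)
  also have "a * b + 2 * u = u * u" using r(3) by (simp add: u_def algebra_simps)
  finally have "b * (e * e) + 2 * e = a" using nz by simp
  moreover have "e \<in> ring_O" using a u O_inverse by (auto simp: e_def)
  moreover have "bar e = - e" by (simp add: e_def lp.cj_mult lp.cj_inverse a u)
  ultimately show ?thesis by (rule that[rotated 2])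
qed

section \<open>Integral vectors and isotropic corrections\<close>

definition ovec :: "nat \<Rightarrow> complex fls vec \<Rightarrow> bool" where
  "ovec l v \<longleftrightarrow> v \<in> carrier_vec (2*l) \<and> (\<forall>i<2*l. v $ i \<in> ring_O)"

lemma ovec_carrier [simp]: "ovec l v \<Longrightarrow> v \<in> carrier_vec (2*l)" by (simp add: ovec_def)

lemma ovec_herm: "ovec l v \<Longrightarrow> ovec l w \<Longrightarrow> lp.herm l v w \<in> ring_O"
  unfolding lp.herm_def
  by (intro RO.sum_closed RO.mult_closed RO.sign_closed RO.bar_closed) (auto simp: ovec_def)

lemma ovec_index: "ovec l v \<Longrightarrow> i < 2*l \<Longrightarrow> v $ i \<in> ring_O"
  unfolding ovec_def by blast

lemma ovec_add:
  assumes "ovec l v" "ovec l w" shows "ovec l (v + w)"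
  unfolding ovec_def
proof (intro conjI allI impI)
  fix i assume i: "i < 2*l"
  have "(v + w) $ i = v $ i + w $ i"
    using i carrier_vecD[OF ovec_carrier[OF assms(2)]] by simp
  also have "\<dots> \<in> ring_O" by (intro RO.add_closed ovec_index[OF assms(1) i] ovec_index[OF assms(2) i])
  finally show "(v + w) $ i \<in> ring_O" .
qed (use assms in auto)

lemma ovec_smult:
  assumes "c \<in> ring_O" "ovec l v" shows "ovec l (c \<cdot>\<^sub>v v)"
  unfolding ovec_def
proof (intro conjI allI impI)
  fix i assume i: "i < 2*l"
  have "(c \<cdot>\<^sub>v v) $ i = c * v $ i"
    using i carrier_vecD[OF ovec_carrier[OF assms(2)]] by simp
  also have "\<dots> \<in> ring_O" by (intro RO.mult_closed assms(1) ovec_index[OF assms(2) i])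
  finally show "(c \<cdot>\<^sub>v v) $ i \<in> ring_O" .
qed (use assms in auto)

lemma herm_self_odd: "bar (lp.herm l v v) = - lp.herm l v v"
  using lp.herm_skew[of l v v] by (metis minus_minus)

text \<open>
  The values \<open>herm v v\<close> are odd in \<open>t\<close>, so the discriminant of the quadratic equation for \<open>c\<close> has
  constant term \<open>1\<close> after normalisation and its square root exists in \<open>\<complex>[[t]]\<close>.
\<close>

lemma isotropic_correction:
  assumes v: "ovec l v" and k: "ovec l k" and u: "fls_nth (lp.herm l k v) 0 \<noteq> 0"
  obtains c where "c \<in> ring_O" "lp.herm l (v + c \<cdot>\<^sub>v k) (v + c \<cdot>\<^sub>v k) = 0"
proof -
  let ?H = "lp.herm l"
  define \<eta> where "\<eta> = ?H k v"
  define \<alpha> where "\<alpha> = ?H v v"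
  define \<beta> where "\<beta> = ?H k k"
  have O: "\<eta> \<in> ring_O" "\<alpha> \<in> ring_O" "\<beta> \<in> ring_O" using v k by (auto simp: \<eta>_def \<alpha>_def \<beta>_def ovec_herm)
  have odd: "bar \<alpha> = - \<alpha>" "bar \<beta> = - \<beta>" by (simp_all add: \<alpha>_def \<beta>_def herm_self_odd)
  have nz: "\<eta> \<noteq> 0" using u by (auto simp: \<eta>_def)
  have inv: "inverse \<eta> \<in> ring_O" using O_inverse[of \<eta>] O u by (simp add: \<eta>_def)
  define i where "i = inverse \<eta>"
  have bi: "bar i \<in> ring_O" "i \<in> ring_O" using inv by (auto simp: i_def)
  have i1: "i * \<eta> = 1" "bar i * bar \<eta> = 1"
    using nz by (simp_all add: i_def lp.cj_inverse)
  have "- \<alpha> \<in> ring_O" "bar (- \<alpha>) = - (- \<alpha>)" using O odd by auto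
  moreover have "- (\<beta> * (i * bar i)) \<in> ring_O" using O bi by auto
  moreover have "bar (- (\<beta> * (i * bar i))) = - (- (\<beta> * (i * bar i)))"
    using odd by (simp add: lp.cj_mult mult.commute[of i])
  ultimately obtain e where e: "e \<in> ring_O" "bar e = - e" "- (\<beta> * (i * bar i)) * (e * e) + 2 * e = - \<alpha>"
    by (rule odd_quadratic)
  \<comment> \<open>This substitution, with i the inverse of \<eta>, turns isotropy into the
    normalised equation solved by e: its linear terms c (- \<open>bar \<eta>\<close>) and
    \<open>bar c\<close> \<eta> both become e.\<close>
  define c where "c = - (e * bar i)"
  have bc: "bar c = e * i" using e by (simp add: c_def lp.cj_mult)
  have kc: "k \<in> carrier_vec (2*l)" "v \<in> carrier_vec (2*l)" using v k by auto
  have Hvk: "?H v k = - bar \<eta>" unfolding \<eta>_def by (rule lp.herm_skew)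
  have "?H (v + c \<cdot>\<^sub>v k) (v + c \<cdot>\<^sub>v k) = \<alpha> + c * (- bar \<eta>) + bar c * (\<eta> + c * \<beta>)"
    using kc by (simp add: lp.herm_add_left lp.herm_add_right lp.herm_smult_left lp.herm_smult_right
        \<alpha>_def[symmetric] \<eta>_def[symmetric] \<beta>_def[symmetric] Hvk algebra_simps)
  also have "\<dots> = \<alpha> + e * (bar i * bar \<eta>) + e * (i * \<eta>) - \<beta> * (i * bar i) * (e * e)"
    unfolding bc by (simp add: c_def algebra_simps)
  also have "\<dots> = \<alpha> + (- (\<beta> * (i * bar i)) * (e * e) + 2 * e)" unfolding i1 by (simp add: algebra_simps)
  also have "\<dots> = 0" unfolding e(3) by simp
  finally show ?thesis using that[of c] e bi by (auto simp: c_def)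
qed

section \<open>Frames and their orthogonal complements\<close>

definition idx :: "nat \<Rightarrow> nat \<Rightarrow> nat set" where
  "idx l k = {i. i < 2*l \<and> (i < k \<or> 2*l - Suc i < k)}"

text \<open>
  A frame consists of the first and last \<open>k\<close> vectors of a basis of \<open>\<complex>[[t]]\<^sup>2\<^sup>l\<close> on which the form is \<open>J\<close>.
\<close>

definition frame :: "nat \<Rightarrow> nat \<Rightarrow> (nat \<Rightarrow> complex fls vec) \<Rightarrow> bool" where
  "frame l k h \<longleftrightarrow> (\<forall>i\<in>idx l k. ovec l (h i)) \<and>
     (\<forall>i\<in>idx l k. \<forall>j\<in>idx l k. lp.herm l (h i) (h j) = lp.J_entry l i j)"

definition perp :: "nat \<Rightarrow> nat \<Rightarrow> (nat \<Rightarrow> complex fls vec) \<Rightarrow> complex fls vec set" where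
  "perp l k h = {v. ovec l v \<and> (\<forall>i\<in>idx l k. lp.herm l (h i) v = 0)}"

lemma idx_flip: "i \<in> idx l k \<Longrightarrow> 2*l - Suc i \<in> idx l k" by (auto simp: idx_def)

lemma herm_sum_right:
  assumes "v \<in> carrier_vec (2*l)" "\<And>i. i \<in> I \<Longrightarrow> h i \<in> carrier_vec (2*l)"
  shows "lp.herm l u (vec (2*l) (\<lambda>a. v $ a - (\<Sum>i\<in>I. c i * h i $ a))) = lp.herm l u v - (\<Sum>i\<in>I. c i * lp.herm l u (h i))"
proof -
  have "lp.herm l u (vec (2*l) (\<lambda>a. v $ a - (\<Sum>i\<in>I. c i * h i $ a))) =
      (\<Sum>a<2*l. (-1)^a * bar (u $ a) * v $ (2*l - Suc a)) -
      (\<Sum>a<2*l. \<Sum>i\<in>I. c i * ((-1)^a * bar (u $ a) * h i $ (2*l - Suc a)))"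
    unfolding lp.herm_def sum_subtractf[symmetric]
    by (intro sum.cong refl) (simp add: right_diff_distrib sum_distrib_left mult_ac)
  then show ?thesis unfolding lp.herm_def sum_distrib_left by (subst (asm) sum.swap)
qed

text \<open>Up to signs a frame is its own dual basis, \<open>h i\<close> being dual to the vector
  of index 2l - 1 - i. The projection along it thus has pairings of integral vectors as
  coefficients, so the complement splits off over \<complex>[[t]].\<close>

lemma perp_projection:
  assumes fr: "frame l k h" and v: "ovec l v"
  shows "\<exists>v0\<in>perp l k h. (\<exists>c. v0 = vec (2*l) (\<lambda>a. v $ a - (\<Sum>i\<in>idx l k. c i * h i $ a))) \<and>
    (\<forall>w\<in>carrier_vec (2*l). (\<forall>i\<in>idx l k. lp.herm l (h i) w = 0) \<longrightarrow> lp.herm l v0 w = lp.herm l v w)"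
proof -
  let ?n = "2*l" let ?I = "idx l k"
  define c where "c i = (-1)^(?n - Suc i) * lp.herm l (h (?n - Suc i)) v" for i
  define v0 where "v0 = vec ?n (\<lambda>a. v $ a - (\<Sum>i\<in>?I. c i * h i $ a))"
  have hO: "ovec l (h i)" if "i \<in> ?I" for i using fr that by (simp add: frame_def)
  have hc: "h i \<in> carrier_vec ?n" if "i \<in> ?I" for i using hO[OF that] by simp
  have S: "lp.herm l u v0 = lp.herm l u v - (\<Sum>i\<in>?I. c i * lp.herm l u (h i))" for u
    unfolding v0_def by (rule herm_sum_right) (use v hc in auto)
  have cO: "c i \<in> ring_O" if "i \<in> ?I" for i
    unfolding c_def by (intro RO.mult_closed RO.sign_closed ovec_herm hO idx_flip that v)
  have v0O: "ovec l v0" unfolding ovec_def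
  proof (intro conjI allI impI)
    fix a assume a: "a < ?n"
    have "v $ a - (\<Sum>i\<in>?I. c i * h i $ a) = v $ a + - (\<Sum>i\<in>?I. c i * h i $ a)" by simp
    also have "\<dots> \<in> ring_O"
      using v a hO cO by (intro RO.add_closed RO.uminus_closed RO.sum_closed RO.mult_closed) (auto simp: ovec_def)
    finally show "v0 $ a \<in> ring_O" using a by (simp add: v0_def)
  qed (simp add: v0_def)
  have "lp.herm l (h j) v0 = 0" if j: "j \<in> ?I" for j
  proof -
    have "(\<Sum>i\<in>?I. c i * lp.herm l (h j) (h i)) = (\<Sum>i\<in>?I. if i = ?n - Suc j then c i * (-1)^j else 0)"
      using fr j by (intro sum.cong refl) (auto simp: frame_def lp.J_entry_def idx_def)
    also have "\<dots> = lp.herm l (h j) v"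
      using idx_flip[OF j] j by (simp add: c_def idx_def mult.commute[of _ "(-1)^j"])
    finally show ?thesis by (simp add: S)
  qed
  then have 1: "v0 \<in> perp l k h" using v0O by (simp add: perp_def)
  have 2: "lp.herm l v0 w = lp.herm l v w" if w: "w \<in> carrier_vec ?n" "\<And>i. i \<in> ?I \<Longrightarrow> lp.herm l (h i) w = 0" for w
  proof -
    have "lp.herm l w (h i) = 0" if "i \<in> ?I" for i
      using lp.herm_skew[of l w "h i"] w(2)[OF that] by simp
    then have "lp.herm l w v0 = lp.herm l w v" by (simp add: S)
    then show ?thesis using lp.herm_skew[of l v0 w] lp.herm_skew[of l v w] by simp
  qed
  show ?thesis using 1 2 by (intro bexI[OF _ 1] conjI exI[of _ c] ballI impI) (auto simp: v0_def)
qed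

lemma ovec_unit: "i < 2*l \<Longrightarrow> ovec l (unit_vec (2*l) i)"
  by (auto simp: ovec_def unit_vec_def)

text \<open>The form stays unimodular on the complement of a frame: an entry of u is, up to sign,
  its pairing with a unit vector, and for u orthogonal to the frame that vector may be replaced by
  its projection.\<close>

lemma perpI:
  assumes fr: "frame l k h" and u: "u \<in> carrier_vec (2*l)" "\<And>i. i \<in> idx l k \<Longrightarrow> lp.herm l (h i) u = 0"
    and O: "\<And>w. w \<in> perp l k h \<Longrightarrow> lp.herm l w u \<in> ring_O"
  shows "u \<in> perp l k h"
proof -
  have "u $ j \<in> ring_O" if j: "j < 2*l" for j
  proof -
    let ?j = "2*l - Suc j"
    have jj: "?j < 2*l" "2*l - Suc ?j = j" using j by auto
    from perp_projection[OF fr ovec_unit[OF jj(1)]] obtain v0 where v0: "v0 \<in> perp l k h"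
      and v0h: "\<forall>w\<in>carrier_vec (2*l). (\<forall>i\<in>idx l k. lp.herm l (h i) w = 0) \<longrightarrow>
        lp.herm l v0 w = lp.herm l (unit_vec (2*l) ?j) w" by (elim bexE conjE)
    have v0u: "lp.herm l v0 u = lp.herm l (unit_vec (2*l) ?j) u" using v0h u by blast
    have "(-1)^?j * lp.herm l (unit_vec (2*l) ?j) u = u $ j"
      unfolding lp.herm_unit_left[OF jj(1) u(1)] jj(2) by (rule lp.sign_square)
    moreover have "(-1)^?j * lp.herm l (unit_vec (2*l) ?j) u \<in> ring_O"
      unfolding v0u[symmetric] by (intro RO.mult_closed RO.sign_closed O v0)
    ultimately show ?thesis by simp
  qed
  then show ?thesis using u by (simp add: perp_def ovec_def)
qed

text \<open>Entries are recovered as in \<open>perpI\<close>; here this gives nondegeneracy on the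
  complement.\<close>

lemma perp_eq_0I:
  assumes fr: "frame l k h" and u: "u \<in> carrier_vec (2*l)" "\<And>i. i \<in> idx l k \<Longrightarrow> lp.herm l (h i) u = 0"
    and 0: "\<And>w. w \<in> perp l k h \<Longrightarrow> lp.herm l w u = 0"
  shows "u = 0\<^sub>v (2*l)"
proof (rule eq_vecI)
  fix j assume "j < dim_vec (0\<^sub>v (2*l) :: complex fls vec)"
  then have j: "j < 2*l" by simp
  let ?j = "2*l - Suc j"
  have jj: "?j < 2*l" "2*l - Suc ?j = j" using j by auto
  from perp_projection[OF fr ovec_unit[OF jj(1)]] obtain v0 where v0: "v0 \<in> perp l k h"
    and v0h: "\<forall>w\<in>carrier_vec (2*l). (\<forall>i\<in>idx l k. lp.herm l (h i) w = 0) \<longrightarrow>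
      lp.herm l v0 w = lp.herm l (unit_vec (2*l) ?j) w" by (elim bexE conjE)
  have v0u: "lp.herm l v0 u = lp.herm l (unit_vec (2*l) ?j) u" using v0h u by blast
  have "(-1)^?j * lp.herm l (unit_vec (2*l) ?j) u = u $ j"
    unfolding lp.herm_unit_left[OF jj(1) u(1)] jj(2) by (rule lp.sign_square)
  then show "u $ j = 0\<^sub>v (2*l) $ j" using 0[OF v0] v0u j by simp
qed (use u in simp)

text \<open>With a trivial complement every unit vector would be a combination of frame vectors. The
  square matrix of these vectors, with zero columns for the missing indices such as k, would then be
  invertible.\<close>

lemma perp_nontrivial:
  assumes fr: "frame l k h" and k: "k < l"
  shows "\<exists>v\<in>perp l k h. v \<noteq> 0\<^sub>v (2*l)"
proof (rule ccontr)
  assume no: "\<not> (\<exists>v\<in>perp l k h. v \<noteq> 0\<^sub>v (2*l))"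
  have triv: "v = 0\<^sub>v (2*l)" if v: "v \<in> perp l k h" for v
  proof (rule ccontr)
    assume "v \<noteq> 0\<^sub>v (2*l)"
    then have "\<exists>v\<in>perp l k h. v \<noteq> 0\<^sub>v (2*l)" using v by (rule bexI)
    then show False by (rule notE[OF no])
  qed
  let ?n = "2*l"
  have "\<exists>c. \<forall>a<?n. unit_vec ?n j $ a = (\<Sum>i\<in>idx l k. c i * h i $ a)" if j: "j < ?n" for j
  proof -
    from perp_projection[OF fr ovec_unit[OF j]] obtain v0 where v0: "v0 \<in> perp l k h"
      "\<exists>c. v0 = vec ?n (\<lambda>a. unit_vec ?n j $ a - (\<Sum>i\<in>idx l k. c i * h i $ a))"
      by (elim bexE conjE)
    from v0(2) obtain c where c: "v0 = vec ?n (\<lambda>a. unit_vec ?n j $ a - (\<Sum>i\<in>idx l k. c i * h i $ a))"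
      by (elim exE)
    have "unit_vec ?n j $ a = (\<Sum>i\<in>idx l k. c i * h i $ a)" if "a < ?n" for a
    proof -
      have "v0 $ a = 0" using triv[OF v0(1)] that by simp
      then show ?thesis using that by (simp add: c)
    qed
    then show ?thesis by (intro exI[of _ c] allI impI)
  qed
  then have "\<forall>j\<in>{..<?n}. \<exists>c. \<forall>a<?n. unit_vec ?n j $ a = (\<Sum>i\<in>idx l k. c i * h i $ a)" by simp
  from bchoice[OF this] obtain c where c':
    "\<forall>j\<in>{..<?n}. \<forall>a<?n. unit_vec ?n j $ a = (\<Sum>i\<in>idx l k. c j i * h i $ a)" by (elim exE)
  have c: "\<And>j a. j < ?n \<Longrightarrow> a < ?n \<Longrightarrow> unit_vec ?n j $ a = (\<Sum>i\<in>idx l k. c j i * h i $ a)"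
    using c' by simp
  define M where "M = mat ?n ?n (\<lambda>(a,i). if i \<in> idx l k then h i $ a else 0)"
  define N where "N = mat ?n ?n (\<lambda>(i,j). c j i)"
  have MN: "M \<in> carrier_mat ?n ?n" "N \<in> carrier_mat ?n ?n" by (auto simp: M_def N_def)
  have "M * N = 1\<^sub>m ?n"
  proof (rule eq_matI)
    fix a j assume "a < dim_row (1\<^sub>m ?n :: complex fls mat)" "j < dim_col (1\<^sub>m ?n :: complex fls mat)"
    then have aj: "a < ?n" "j < ?n" by auto
    have "(M * N) $$ (a,j) = (\<Sum>i<?n. M $$ (a,i) * N $$ (i,j))" by (rule times_mat_index[OF MN aj])
    also have "\<dots> = (\<Sum>i<?n. if i \<in> idx l k then c j i * h i $ a else 0)"
      using aj by (intro sum.cong refl) (auto simp: M_def N_def)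
    also have "\<dots> = (\<Sum>i\<in>idx l k. c j i * h i $ a)"
      by (rule sum.mono_neutral_cong_right) (auto simp: idx_def)
    also have "\<dots> = 1\<^sub>m ?n $$ (a,j)" using c[OF aj(2,1)] aj by (auto simp: unit_vec_def)
    finally show "(M * N) $$ (a,j) = 1\<^sub>m ?n $$ (a,j)" .
  qed (use MN in auto)
  then have NM: "N * M = 1\<^sub>m ?n" by (rule mat_mult_left_right_inverse[OF MN])
  have kk: "k < ?n" "k \<notin> idx l k" using k by (auto simp: idx_def)
  have "(N * M) $$ (k,k) = (\<Sum>i<?n. N $$ (k,i) * M $$ (i,k))" by (rule times_mat_index[OF MN(2,1) kk(1) kk(1)])
  also have "\<dots> = 0" using kk by (intro sum.neutral) (auto simp: M_def)
  finally show False using NM kk by simp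
qed

lemma frame_extend:
  assumes fr: "frame l k h" and k: "k < l" and p: "p \<in> perp l k h" "lp.herm l p p = 0"
    and q: "q \<in> perp l k h" "lp.herm l q q = 0" and pq: "lp.herm l p q = (-1)^k"
  shows "frame l (Suc k) (h(k := p, 2*l - Suc k := q))"
    and "perp l (Suc k) (h(k := p, 2*l - Suc k := q)) \<subseteq> perp l k h"
proof -
  let ?k = "2*l - Suc k" let ?h = "h(k := p, ?k := q)"
  have ne: "k \<noteq> ?k" "k \<notin> idx l k" "?k \<notin> idx l k" using k by (auto simp: idx_def)
  have Suc: "i \<in> idx l (Suc k) \<longleftrightarrow> i = k \<or> i = ?k \<or> i \<in> idx l k" for i using k by (auto simp: idx_def)
  have old: "?h i = h i" if "i \<in> idx l k" for i using ne that by auto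
  have new: "?h k = p" "?h ?k = q" using ne by auto
  have z1: "lp.herm l (h i) p = 0" "lp.herm l (h i) q = 0" if "i \<in> idx l k" for i
    using p q that by (auto simp: perp_def)
  have z2: "lp.herm l p (h i) = 0" "lp.herm l q (h i) = 0" if "i \<in> idx l k" for i
    using z1[OF that] lp.herm_skew[of l p "h i"] lp.herm_skew[of l q "h i"] by auto
  have qp: "lp.herm l q p = - ((-1)^k)" using lp.herm_skew[of l q p] pq by simp
  have J1: "lp.J_entry l i k = 0" "lp.J_entry l i ?k = 0" "lp.J_entry l k i = 0" "lp.J_entry l ?k i = 0" if "i \<in> idx l k" for i
    using that ne k by (auto simp: lp.J_entry_def idx_def)
  have J2: "lp.J_entry l k k = 0" "lp.J_entry l ?k ?k = 0" "lp.J_entry l k ?k = (-1)^k" "lp.J_entry l ?k k = - ((-1)^k)"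
    using k by (auto simp: lp.J_entry_def lp.sign_flip)
  show "frame l (Suc k) ?h" unfolding frame_def
  proof (intro conjI ballI)
    fix i assume "i \<in> idx l (Suc k)"
    then consider "i = k" | "i = ?k" | "i \<in> idx l k" using Suc by blast
    then show "ovec l (?h i)" using p q fr old new by cases (auto simp: perp_def frame_def)
  next
    fix i j assume "i \<in> idx l (Suc k)" "j \<in> idx l (Suc k)"
    then have "i = k \<or> i = ?k \<or> i \<in> idx l k" "j = k \<or> j = ?k \<or> j \<in> idx l k" using Suc by blast+
    then show "lp.herm l (?h i) (?h j) = lp.J_entry l i j"
      using fr by (elim disjE) (simp_all only: new old z1 z2 p q pq qp J1 J2 frame_def)
  qed
  show "perp l (Suc k) ?h \<subseteq> perp l k h"
  proof
    fix v assume v: "v \<in> perp l (Suc k) ?h"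
    have "lp.herm l (h i) v = 0" if "i \<in> idx l k" for i
    proof -
      have "lp.herm l (?h i) v = 0" using v that Suc[of i] unfolding perp_def by blast
      then show ?thesis by (simp only: old[OF that])
    qed
    then show "v \<in> perp l k h" using v by (simp add: perp_def)
  qed
qed

text \<open>A bound m for the order of the pole, possibly negative. It is measured by pairings, so
  that only the part of A acting between the two complements counts.\<close>

definition pole_le :: "nat \<Rightarrow> nat \<Rightarrow> complex fls mat \<Rightarrow> (nat \<Rightarrow> complex fls vec) \<Rightarrow> (nat \<Rightarrow> complex fls vec) \<Rightarrow> int \<Rightarrow> bool" where
  "pole_le l k A h g m \<longleftrightarrow> (\<forall>v\<in>perp l k h. \<forall>w\<in>perp l k g. tp m * lp.herm l w (A *\<^sub>v v) \<in> ring_O)"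

lemma pole_le_mono:
  assumes "pole_le l k A h g m" "m \<le> m'" shows "pole_le l k A h g m'"
  unfolding pole_le_def
proof (intro ballI)
  fix v w assume "v \<in> perp l k h" "w \<in> perp l k g"
  then have "tp m * lp.herm l w (A *\<^sub>v v) \<in> ring_O" using assms(1) by (simp add: pole_le_def)
  moreover have "tp (m' - m) \<in> ring_O" using assms(2) by (intro tp_O) simp
  ultimately have "tp (m' - m) * (tp m * lp.herm l w (A *\<^sub>v v)) \<in> ring_O" by (rule RO.mult_closed[rotated])
  then show "tp m' * lp.herm l w (A *\<^sub>v v) \<in> ring_O" by (simp only: mult.assoc[symmetric] tp_tp) simp
qed

lemma mat_common_pole:
  "\<exists>D. \<forall>i<n. \<forall>j<n. tp D * A $$ (i,j) \<in> ring_O"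
proof -
  define D where "D = (\<Sum>(i,j)\<in>{..<n}\<times>{..<n}. \<bar>fls_subdegree (A $$ (i,j))\<bar>)"
  have "tp D * A $$ (i,j) \<in> ring_O" if ij: "i < n" "j < n" for i j
    unfolding ring_O_iff tp_nth
  proof (intro allI impI fls_eq0_below_subdegree)
    fix m :: int assume "m < 0"
    have "(\<lambda>(i,j). \<bar>fls_subdegree (A $$ (i,j))\<bar>) (i,j) \<le> D"
      unfolding D_def using ij by (intro member_le_sum) auto
    then show "m - D < fls_subdegree (A $$ (i,j))" using \<open>m < 0\<close> by simp
  qed
  then show ?thesis by blast
qed

lemma ovec_mult_pole:
  assumes A: "A \<in> carrier_mat (2*l) (2*l)" and D: "\<And>i j. i < 2*l \<Longrightarrow> j < 2*l \<Longrightarrow> tp D * A $$ (i,j) \<in> ring_O" and v: "ovec l v"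
  shows "ovec l (tp D \<cdot>\<^sub>v (A *\<^sub>v v))"
  unfolding ovec_def
proof (intro conjI allI impI)
  fix i assume i: "i < 2*l"
  have "(tp D \<cdot>\<^sub>v (A *\<^sub>v v)) $ i = tp D * (A *\<^sub>v v) $ i" using i A by (intro index_smult_vec(1)) auto
  also have "\<dots> = (\<Sum>p<2*l. (tp D * A $$ (i,p)) * v $ p)"
    unfolding mult_mat_vec_index[OF A ovec_carrier[OF v] i] sum_distrib_left by (simp only: mult.assoc)
  also have "\<dots> \<in> ring_O" by (intro RO.sum_closed RO.mult_closed D i ovec_index[OF v]) auto
  finally show "(tp D \<cdot>\<^sub>v (A *\<^sub>v v)) $ i \<in> ring_O" .
qed (use mult_mat_vec_carrier[OF A ovec_carrier[OF v]] in simp)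

context
  fixes l k :: nat and A :: "complex fls mat" and h g :: "nat \<Rightarrow> complex fls vec"
  assumes U: "lp.unitary l A" and kl: "k < l" and fh: "frame l k h" and fg: "frame l k g"
    and rel: "\<forall>i\<in>idx l k. \<exists>c. c \<noteq> 0 \<and> A *\<^sub>v h i = c \<cdot>\<^sub>v g i"
begin

private abbreviation (input) "V \<equiv> carrier_vec (2*l) :: complex fls vec set"
private abbreviation (input) "H \<equiv> lp.herm l"
private abbreviation (input) "B \<equiv> lp.adj l A"
private abbreviation (input) "PP \<equiv> pole_le l k A h g"

private lemma Ac: "A \<in> carrier_mat (2*l) (2*l)" using U by simp

private lemma pair_carrier [simp]: "v \<in> V \<Longrightarrow> A *\<^sub>v v \<in> V" "v \<in> V \<Longrightarrow> B *\<^sub>v v \<in> V"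
  using Ac by (auto intro!: mult_mat_vec_carrier[of _ "2*l" "2*l"])

private lemma AB: "v \<in> V \<Longrightarrow> A *\<^sub>v (B *\<^sub>v v) = v" "v \<in> V \<Longrightarrow> B *\<^sub>v (A *\<^sub>v v) = v"
proof -
  assume v: "v \<in> V"
  have "A *\<^sub>v (B *\<^sub>v v) = (A * B) *\<^sub>v v" using Ac v by (intro assoc_mult_mat_vec[symmetric]) auto
  then show "A *\<^sub>v (B *\<^sub>v v) = v" using U v by (simp add: lp.unitary_def)
  have "B *\<^sub>v (A *\<^sub>v v) = (B * A) *\<^sub>v v" using Ac v by (intro assoc_mult_mat_vec[symmetric]) auto
  then show "B *\<^sub>v (A *\<^sub>v v) = v" using lp.unitary_adj_left[OF U] v by simp
qed

private lemma HA: "v \<in> V \<Longrightarrow> w \<in> V \<Longrightarrow> H (A *\<^sub>v v) (A *\<^sub>v w) = H v w"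
  by (rule lp.unitary_herm[OF U])

private lemma HB: "v \<in> V \<Longrightarrow> w \<in> V \<Longrightarrow> H v (B *\<^sub>v w) = H (A *\<^sub>v v) w"
  by (rule lp.herm_adj[OF Ac, symmetric])

private lemma smult_A: "v \<in> V \<Longrightarrow> A *\<^sub>v (c \<cdot>\<^sub>v v) = c \<cdot>\<^sub>v (A *\<^sub>v v)"
  using Ac by (intro mult_mat_vec) auto

private lemma perpV: "v \<in> perp l k h \<Longrightarrow> v \<in> V" "w \<in> perp l k g \<Longrightarrow> w \<in> V"
  by (auto simp: perp_def)

private lemma frV: "i \<in> idx l k \<Longrightarrow> h i \<in> V" "i \<in> idx l k \<Longrightarrow> g i \<in> V"
  using fh fg by (auto simp: frame_def)

private lemma perp_A:
  assumes i: "i \<in> idx l k" and v: "v \<in> V"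
  shows "H (h i) v = 0 \<Longrightarrow> H (g i) (A *\<^sub>v v) = 0" "H (g i) v = 0 \<Longrightarrow> H (h i) (B *\<^sub>v v) = 0"
proof -
  obtain c where c: "c \<noteq> 0" "A *\<^sub>v h i = c \<cdot>\<^sub>v g i" using rel i by blast
  have "bar c * H (g i) (A *\<^sub>v v) = H (h i) v"
    using HA[OF frV(1)[OF i] v] frV[OF i] by (simp add: c lp.herm_smult_left)
  then show "H (h i) v = 0 \<Longrightarrow> H (g i) (A *\<^sub>v v) = 0" using c by simp
  have "H (h i) (B *\<^sub>v v) = bar c * H (g i) v"
    using HB[OF frV(1)[OF i] v] frV[OF i] by (simp add: c lp.herm_smult_left)
  then show "H (g i) v = 0 \<Longrightarrow> H (h i) (B *\<^sub>v v) = 0" by simp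
qed

text \<open>By \<open>perpI\<close>, integrality of all pairings is integrality of the vector
  itself. Orthogonality to the frame survives because A maps \<open>h i\<close> to a multiple of
  \<open>g i\<close>.\<close>

private lemma scaled_perp:
  assumes P: "PP m" and v: "v \<in> perp l k h" shows "tp m \<cdot>\<^sub>v (A *\<^sub>v v) \<in> perp l k g"
proof (rule perpI[OF fg])
  have vV: "v \<in> V" using v by (rule perpV)
  show "tp m \<cdot>\<^sub>v (A *\<^sub>v v) \<in> V" using vV by simp
  show "H (g i) (tp m \<cdot>\<^sub>v (A *\<^sub>v v)) = 0" if "i \<in> idx l k" for i
    using v that vV perp_A(1)[OF that vV] by (simp add: lp.herm_smult_right perp_def)
  show "H w (tp m \<cdot>\<^sub>v (A *\<^sub>v v)) \<in> ring_O" if "w \<in> perp l k g" for w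
    unfolding lp.herm_smult_right[OF pair_carrier(1)[OF vV]] using P v that unfolding pole_le_def by blast
qed

private lemma scaled_adj_perp:
  assumes P: "PP m" and w: "w \<in> perp l k g" shows "tp m \<cdot>\<^sub>v (B *\<^sub>v w) \<in> perp l k h"
proof (rule perpI[OF fh])
  have wV: "w \<in> V" using w by (rule perpV)
  show "tp m \<cdot>\<^sub>v (B *\<^sub>v w) \<in> V" using wV by simp
  show "H (h i) (tp m \<cdot>\<^sub>v (B *\<^sub>v w)) = 0" if "i \<in> idx l k" for i
    using w that wV perp_A(2)[OF that wV] by (simp add: lp.herm_smult_right perp_def)
  show "H v (tp m \<cdot>\<^sub>v (B *\<^sub>v w)) \<in> ring_O" if v: "v \<in> perp l k h" for v
  proof -
    have vV: "v \<in> V" using v by (rule perpV)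
    have "H v (tp m \<cdot>\<^sub>v (B *\<^sub>v w)) = tp m * H (A *\<^sub>v v) w"
      using wV vV by (simp only: lp.herm_smult_right[OF pair_carrier(2)] HB)
    also have "\<dots> = - (sg m * bar (tp m * H w (A *\<^sub>v v)))"
      unfolding lp.herm_skew[of l "A *\<^sub>v v" w] lp.cj_mult bar_tp by (simp add: mult.assoc)
    also have "\<dots> \<in> ring_O"
    proof -
      have "tp m * H w (A *\<^sub>v v) \<in> ring_O" using P v w unfolding pole_le_def by blast
      then show ?thesis by (intro RO.uminus_closed RO.mult_closed[OF sg_O] RO.bar_closed)
    qed
    finally show ?thesis .
  qed
qed

text \<open>Some bound exists, as A has finitely many entries. If every bound could be lowered, all
  m would be bounds, while a nonzero pairing, which exists because the complement is nontrivial and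
  A invertible, has a definite lowest exponent.\<close>

private lemma minimal_pole: "\<exists>m. PP m \<and> \<not> PP (m - 1)"
proof (rule ccontr)
  assume no: "\<not> (\<exists>m. PP m \<and> \<not> PP (m - 1))"
  obtain D where D': "\<forall>i<2*l. \<forall>j<2*l. tp D * A $$ (i,j) \<in> ring_O" using mat_common_pole[of "2*l" A] by (elim exE)
  have D: "tp D * A $$ (i,j) \<in> ring_O" if "i < 2*l" "j < 2*l" for i j using D' that by blast
  have PD: "PP D" unfolding pole_le_def
  proof (intro ballI)
    fix v w assume v: "v \<in> perp l k h" and w: "w \<in> perp l k g"
    have "H w (tp D \<cdot>\<^sub>v (A *\<^sub>v v)) \<in> ring_O"
      by (rule ovec_herm[OF _ ovec_mult_pole[OF Ac D]]) (use v w in \<open>auto simp: perp_def\<close>)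
    then show "tp D * H w (A *\<^sub>v v) \<in> ring_O" using pair_carrier(1)[OF perpV(1)[OF v]] by (simp only: lp.herm_smult_right)
  qed
  have all: "PP m" for m
  proof (cases "m \<le> D")
    case True
    then show ?thesis
    proof (induction rule: int_le_induct)
      case base
      then show ?case by (rule PD)
    next
      case (step i)
      then show ?case using no by blast
    qed
  next
    case False
    then show ?thesis using pole_le_mono[OF PD] by simp
  qed
  obtain v where v: "v \<in> perp l k h" "v \<noteq> 0\<^sub>v (2*l)" using perp_nontrivial[OF fh kl] by (rule bexE)
  have vV: "v \<in> V" using v(1) by (rule perpV)
  have "A *\<^sub>v v \<noteq> 0\<^sub>v (2*l)"
  proof
    assume 0: "A *\<^sub>v v = 0\<^sub>v (2*l)"
    have "v = B *\<^sub>v 0\<^sub>v (2*l)" using AB(2)[OF vV] unfolding 0 ..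
    also have "\<dots> = 0\<^sub>v (2*l)" by (rule eq_vecI) (auto simp: scalar_prod_def)
    finally show False using v by simp
  qed
  then obtain w where w: "w \<in> perp l k g" "H w (A *\<^sub>v v) \<noteq> 0"
    using perp_eq_0I[OF fg pair_carrier(1)[OF vV] perp_A(1)] v vV unfolding perp_def by blast
  define f where "f = H w (A *\<^sub>v v)"
  have "tp (- fls_subdegree f - 1) * f \<in> ring_O" using all v w unfolding pole_le_def f_def by blast
  then have "fls_nth (tp (- fls_subdegree f - 1) * f) (-1) = 0" unfolding ring_O_iff by simp
  then have "fls_nth f (fls_subdegree f) = 0" unfolding tp_nth by simp
  then show False using w by (simp add: f_def)
qed

private lemma herm_lin:
  "u \<in> V \<Longrightarrow> v \<in> V \<Longrightarrow> w \<in> V \<Longrightarrow> H u (v + c \<cdot>\<^sub>v w) = H u v + c * H u w"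
  "u \<in> V \<Longrightarrow> v \<in> V \<Longrightarrow> w \<in> V \<Longrightarrow> H (v + c \<cdot>\<^sub>v w) u = H v u + bar c * H w u"
  by (simp_all add: lp.herm_add_right lp.herm_add_left lp.herm_smult_right lp.herm_smult_left)

private lemma perp_lin:
  assumes "p \<in> perp l k f" "q \<in> perp l k f" "c \<in> ring_O" shows "p + c \<cdot>\<^sub>v q \<in> perp l k f"
  using assms by (auto simp: perp_def ovec_add ovec_smult lp.herm_add_right lp.herm_smult_right simp del: image_iff)

text \<open>
  Take \<open>m\<close> minimal with \<open>pole_le m\<close>. Some \<open>herm w (A v)\<close> then has a pole of order exactly \<open>m\<close>, and both
  \<open>v\<close> and \<open>w\<close> can be corrected to isotropic vectors; these span the next hyperbolic pair.
\<close>

lemma cartan_step: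
  "\<exists>m p q p' q'. 0 \<le> m \<and> PP m \<and> \<not> PP (m - 1) \<and>
     p \<in> perp l k h \<and> q \<in> perp l k h \<and> p' \<in> perp l k g \<and> q' \<in> perp l k g \<and>
     H p p = 0 \<and> H q q = 0 \<and> H p q = (-1)^k \<and> H p' p' = 0 \<and> H q' q' = 0 \<and> H p' q' = (-1)^k \<and>
     A *\<^sub>v p = tp m \<cdot>\<^sub>v p' \<and> A *\<^sub>v q = (sg m * tp (- m)) \<cdot>\<^sub>v q'"
proof -
  obtain m where P: "PP m" and nP: "\<not> PP (m - 1)" using minimal_pole by blast
  from nP obtain v0 w0 where v0: "v0 \<in> perp l k h" and w0: "w0 \<in> perp l k g"
    and nO: "tp (m - 1) * H w0 (A *\<^sub>v v0) \<notin> ring_O" unfolding pole_le_def by blast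
  have vV: "v0 \<in> V" "w0 \<in> V" using perpV v0 w0 by auto
  define \<epsilon> where "\<epsilon> = tp m * H w0 (A *\<^sub>v v0)"
  have \<epsilon>O: "\<epsilon> \<in> ring_O" using P v0 w0 unfolding pole_le_def \<epsilon>_def by blast
  \<comment> \<open>With zero constant term, multiplication by the power m - 1 would already be
    integral, contrary to the choice of v0 and w0.\<close>
  have \<epsilon>0: "fls_nth \<epsilon> 0 \<noteq> 0"
  proof
    assume 0: "fls_nth \<epsilon> 0 = 0"
    have "fls_nth (tp (m - 1) * H w0 (A *\<^sub>v v0)) j = 0" if "j < 0" for j
    proof -
      have "fls_nth (tp (m - 1) * H w0 (A *\<^sub>v v0)) j = fls_nth \<epsilon> (j + 1)"
        unfolding \<epsilon>_def tp_nth by (rule arg_cong[of _ _ "fls_nth _"]) simp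
      also have "\<dots> = 0" using 0 \<epsilon>O that unfolding ring_O_iff by (cases "j = -1") auto
      finally show ?thesis .
    qed
    then show False using nO unfolding ring_O_iff by blast
  qed
  define u0 where "u0 = tp m \<cdot>\<^sub>v (A *\<^sub>v v0)"
  \<comment> \<open>The partner of v0: A carries it to t^m w0, so its pairing with v0 is the unit
    \<epsilon> up to sign.\<close>
  define k0 where "k0 = tp m \<cdot>\<^sub>v (B *\<^sub>v w0)"
  have u0: "u0 \<in> perp l k g" unfolding u0_def by (rule scaled_perp[OF P v0])
  have k0: "k0 \<in> perp l k h" unfolding k0_def by (rule scaled_adj_perp[OF P w0])
  have uV: "u0 \<in> V" "k0 \<in> V" using perpV u0 k0 by auto
  have Ak0: "A *\<^sub>v k0 = tp m \<cdot>\<^sub>v w0" unfolding k0_def using vV by (simp add: smult_A AB)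
  have Hkv: "H k0 v0 = sg m * \<epsilon>"
  proof -
    have "H k0 v0 = H (tp m \<cdot>\<^sub>v w0) (A *\<^sub>v v0)" unfolding HA[OF uV(2) vV(1), symmetric] Ak0 ..
    then show ?thesis unfolding lp.herm_smult_left[OF vV(2)] bar_tp \<epsilon>_def by (simp only: mult.assoc)
  qed
  have sg0: "fls_nth (sg m * f) 0 = fls_nth (sg m) 0 * fls_nth f 0" "fls_nth (sg m) 0 \<noteq> 0" for f
    by (simp_all add: sg_def)
  \<comment> \<open>For negative m the integral vectors t^m A k0 and t^m A v0 would pair to t^(2m)
    \<epsilon>, which has a pole.\<close>
  have m0: "0 \<le> m"
  proof (rule ccontr)
    assume m: "\<not> 0 \<le> m"
    have u': "tp m \<cdot>\<^sub>v (A *\<^sub>v k0) \<in> perp l k g" by (rule scaled_perp[OF P k0])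
    have "H (tp m \<cdot>\<^sub>v (A *\<^sub>v k0)) u0 = sg m * tp m * (tp m * H k0 v0)"
      unfolding u0_def using vV uV by (simp only: lp.herm_smult_left[OF pair_carrier(1)] lp.herm_smult_right[OF pair_carrier(1)] smult_carrier_vec pair_carrier(1) lp.herm_smult_right HA bar_tp)
        (simp only: mult_ac)
    also have "\<dots> = tp (m + m) * \<epsilon>" unfolding Hkv tp_tp[symmetric]
      by (simp add: mult.assoc mult.left_commute[of "sg m"])
    finally have "tp (m + m) * \<epsilon> \<in> ring_O"
      using ovec_herm[of l "tp m \<cdot>\<^sub>v (A *\<^sub>v k0)" u0] u' u0 unfolding perp_def by (simp del: image_iff)
    then have "fls_nth (tp (m + m) * \<epsilon>) (m + m) = 0" using m unfolding ring_O_iff by simp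
    then show False using \<epsilon>0 unfolding tp_nth by simp
  qed
  have O: "ovec l v0" "ovec l k0" "ovec l w0" "ovec l u0" using v0 k0 w0 u0 by (auto simp: perp_def)
  obtain c where c: "c \<in> ring_O" "H (v0 + c \<cdot>\<^sub>v k0) (v0 + c \<cdot>\<^sub>v k0) = 0"
    by (rule isotropic_correction[OF O(1,2)]) (use \<epsilon>0 sg0 in \<open>simp_all add: Hkv\<close>)
  define v1 where "v1 = v0 + c \<cdot>\<^sub>v k0"
  have v1: "v1 \<in> perp l k h" "H v1 v1 = 0" unfolding v1_def by (rule perp_lin[OF v0 k0 c(1)], rule c(2))
  have v1V: "v1 \<in> V" using v1 perpV by auto
  define u1 where "u1 = tp m \<cdot>\<^sub>v (A *\<^sub>v v1)"
  have u1: "u1 \<in> perp l k g" unfolding u1_def by (rule scaled_perp[OF P v1(1)])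
  have u1V: "u1 \<in> V" using u1 perpV by auto
  have H1: "H u1 u1 = 0"
    unfolding u1_def using v1V v1(2) by (simp add: lp.herm_smult_left lp.herm_smult_right HA)
  have Av1: "A *\<^sub>v v1 = tp (- m) \<cdot>\<^sub>v u1"
    unfolding u1_def smult_smult_assoc tp_tp using pair_carrier(1)[OF v1V] by (simp only: left_minus tp_0 one_smult_vec)
  define \<theta> where "\<theta> = H w0 u1"
  have \<theta>O: "\<theta> \<in> ring_O" using O u1 by (auto simp: \<theta>_def perp_def ovec_herm simp del: image_iff)
  \<comment> \<open>Correcting v0 adds to \<epsilon> a multiple of \<open>H w0 w0\<close>; the
    factor is integral since m \<ge> 0, and an odd series has no constant term. So the pairing
    remains a unit.\<close>
  have "\<theta> = \<epsilon> + (c * tp m * tp m) * H w0 w0"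
  proof -
    have "A *\<^sub>v v1 = A *\<^sub>v v0 + c \<cdot>\<^sub>v (A *\<^sub>v k0)"
      unfolding v1_def using Ac vV uV by (simp add: mult_add_distrib_mat_vec[of _ "2*l" "2*l"] smult_A)
    then have "\<theta> = tp m * (H w0 (A *\<^sub>v v0) + c * (tp m * H w0 w0))"
      unfolding \<theta>_def u1_def using vV uV by (simp add: lp.herm_smult_right herm_lin Ak0)
    then show ?thesis by (simp only: \<epsilon>_def distrib_left mult.assoc mult.left_commute[of c])
  qed
  moreover have "fls_nth ((c * tp m * tp m) * H w0 w0) 0 = fls_nth (c * tp m * tp m) 0 * fls_nth (H w0 w0) 0"
    using m0 c O by (intro RO.coeff0_mult RO.mult_closed tp_O ovec_herm) auto
  moreover have "fls_nth (H w0 w0) 0 = 0" by (rule odd_nth_0[OF herm_self_odd])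
  ultimately have \<theta>0: "fls_nth \<theta> 0 \<noteq> 0" using \<epsilon>0 by simp
  have Hu1w0: "H u1 w0 = - bar \<theta>" unfolding \<theta>_def by (rule lp.herm_skew)
  obtain d where d: "d \<in> ring_O" "H (w0 + d \<cdot>\<^sub>v u1) (w0 + d \<cdot>\<^sub>v u1) = 0"
    by (rule isotropic_correction[OF O(3), of u1]) (use \<theta>0 u1 in \<open>simp_all add: Hu1w0 bar_nth_0 perp_def\<close>)
  define w1 where "w1 = w0 + d \<cdot>\<^sub>v u1"
  have w1: "w1 \<in> perp l k g" "H w1 w1 = 0" unfolding w1_def by (rule perp_lin[OF w0 u1 d(1)], rule d(2))
  have w1V: "w1 \<in> V" using w1 perpV by auto
  define k1 where "k1 = tp m \<cdot>\<^sub>v (B *\<^sub>v w1)"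
  have k1: "k1 \<in> perp l k h" unfolding k1_def by (rule scaled_adj_perp[OF P w1(1)])
  have k1V: "k1 \<in> V" using k1 perpV by auto
  have Ak1: "A *\<^sub>v k1 = tp m \<cdot>\<^sub>v w1" unfolding k1_def using w1V by (simp add: smult_A AB)
  have Hk1: "H k1 k1 = 0"
    unfolding HA[OF k1V k1V, symmetric] Ak1 using w1V w1(2) by (simp add: lp.herm_smult_left lp.herm_smult_right)
  have Hw1u1: "H w1 u1 = \<theta>"
    unfolding w1_def \<theta>_def using vV u1V H1 by (simp add: herm_lin)
  have Hk1v1: "H k1 v1 = sg m * \<theta>"
  proof -
    have "H k1 v1 = H (tp m \<cdot>\<^sub>v w1) (tp (- m) \<cdot>\<^sub>v u1)" unfolding HA[OF k1V v1V, symmetric] Ak1 Av1 ..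
    also have "\<dots> = sg m * (tp m * (tp (- m) * \<theta>))"
      using w1V u1V by (simp add: lp.herm_smult_left lp.herm_smult_right Hw1u1 bar_tp mult.assoc mult.left_commute[of "tp (- m)"])
    finally show ?thesis unfolding tp_cancel .
  qed
  \<comment> \<open>The scalar that normalises the pairing of k1 with v1 to (-1)^k, conjugated
    because the form is conjugate-linear in its first argument. The pairs are s k1, v1 in the source
    and s w1, \<open>sg m\<close> u1 in the target.\<close>
  define s where "s = bar ((-1)^k * (sg m * inverse \<theta>))"
  have iO: "inverse \<theta> \<in> ring_O" by (rule O_inverse[OF \<theta>O \<theta>0])
  have sO: "s \<in> ring_O" unfolding s_def by (intro RO.bar_closed RO.mult_closed RO.sign_closed sg_O iO)
  have \<theta>nz: "\<theta> \<noteq> 0" using \<theta>0 by auto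
  have bs: "bar s = (-1)^k * (sg m * inverse \<theta>)" by (simp add: s_def)
  have bst: "bar s * (sg m * \<theta>) = (-1)^k"
  proof -
    have "bar s * (sg m * \<theta>) = (-1)^k * (sg m * sg m) * (inverse \<theta> * \<theta>)" unfolding bs by (simp only: mult_ac)
    then show ?thesis unfolding sg_sg(1) left_inverse[OF \<theta>nz] by simp
  qed
  show ?thesis
  proof (intro exI conjI)
    show "0 \<le> m" "PP m" "\<not> PP (m - 1)" by fact+
    show "s \<cdot>\<^sub>v k1 \<in> perp l k h" "s \<cdot>\<^sub>v w1 \<in> perp l k g"
      using k1 w1 sO k1V w1V by (auto simp: perp_def ovec_smult lp.herm_smult_right simp del: image_iff)
    show "v1 \<in> perp l k h" by (rule v1)
    show "sg m \<cdot>\<^sub>v u1 \<in> perp l k g"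
      using u1 u1V by (auto simp: perp_def ovec_smult lp.herm_smult_right simp del: image_iff)
    show "H (s \<cdot>\<^sub>v k1) (s \<cdot>\<^sub>v k1) = 0" using k1V Hk1 by (simp add: lp.herm_smult_left lp.herm_smult_right)
    show "H v1 v1 = 0" by (rule v1)
    show "H (s \<cdot>\<^sub>v k1) v1 = (-1)^k"
      unfolding lp.herm_smult_left[OF k1V] Hk1v1 by (rule bst)
    show "H (s \<cdot>\<^sub>v w1) (s \<cdot>\<^sub>v w1) = 0" using w1V w1(2) by (simp add: lp.herm_smult_left lp.herm_smult_right)
    show "H (sg m \<cdot>\<^sub>v u1) (sg m \<cdot>\<^sub>v u1) = 0" using u1V H1 by (simp add: lp.herm_smult_left lp.herm_smult_right)
    show "H (s \<cdot>\<^sub>v w1) (sg m \<cdot>\<^sub>v u1) = (-1)^k"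
      unfolding lp.herm_smult_left[OF w1V] lp.herm_smult_right[OF u1V] Hw1u1 mult.left_commute[of "sg m" "bar s"] by (rule bst)
    show "A *\<^sub>v (s \<cdot>\<^sub>v k1) = tp m \<cdot>\<^sub>v (s \<cdot>\<^sub>v w1)"
      unfolding smult_A[OF k1V] Ak1 smult_smult_assoc by (simp only: mult.commute)
    show "A *\<^sub>v v1 = (sg m * tp (- m)) \<cdot>\<^sub>v (sg m \<cdot>\<^sub>v u1)"
    proof -
      have e: "sg m * tp (- m) * sg m = tp (- m)" using sg_sg(2)[of m "tp (- m)"] by (simp only: mult_ac)
      show ?thesis unfolding Av1 smult_smult_assoc e ..
    qed
  qed
qed

end

text \<open>The last clause bounds the pole that is still left by the latest exponent; it is what
  makes the exponents decrease in the next step.\<close>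

definition cartan_state :: "nat \<Rightarrow> complex fls mat \<Rightarrow> nat \<Rightarrow> (nat \<Rightarrow> complex fls vec) \<Rightarrow> (nat \<Rightarrow> complex fls vec) \<Rightarrow> (nat \<Rightarrow> int) \<Rightarrow> bool" where
  "cartan_state l A k h g a \<longleftrightarrow> frame l k h \<and> frame l k g \<and>
     (\<forall>i<k. 0 \<le> a i \<and> A *\<^sub>v h i = tp (a i) \<cdot>\<^sub>v g i \<and>
        A *\<^sub>v h (2*l - Suc i) = (sg (a i) * tp (- a i)) \<cdot>\<^sub>v g (2*l - Suc i)) \<and>
     (\<forall>i j. i \<le> j \<longrightarrow> j < k \<longrightarrow> a j \<le> a i) \<and> (k > 0 \<longrightarrow> pole_le l k A h g (a (k - 1)))"

lemma sg_nonzero: "sg m \<noteq> 0"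
proof
  assume 0: "sg m = 0"
  show False using sg_sg(1)[of m] unfolding 0 by simp
qed

lemma cartan_frames:
  assumes U: "lp.unitary l A" shows "k \<le> l \<Longrightarrow> \<exists>h g a. cartan_state l A k h g a"
proof (induction k)
  case 0
  have "idx l 0 = {}" by (auto simp: idx_def)
  then show ?case by (simp add: cartan_state_def frame_def)
next
  case (Suc k)
  then obtain h g a where S: "cartan_state l A k h g a" by auto
  have kl: "k < l" using Suc by simp
  have fh: "frame l k h" "frame l k g" using S by (auto simp: cartan_state_def)
  have old: "0 \<le> a i" "A *\<^sub>v h i = tp (a i) \<cdot>\<^sub>v g i" "A *\<^sub>v h (2*l - Suc i) = (sg (a i) * tp (- a i)) \<cdot>\<^sub>v g (2*l - Suc i)"
    if "i < k" for i using S that unfolding cartan_state_def by blast+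
  have dec: "a j \<le> a i" if "i \<le> j" "j < k" for i j using S that unfolding cartan_state_def by blast
  have rel: "\<exists>c. c \<noteq> 0 \<and> A *\<^sub>v h i = c \<cdot>\<^sub>v g i" if i: "i \<in> idx l k" for i
  proof (cases "i < k")
    case True
    then show ?thesis using old(2) tp_nonzero by blast
  next
    case False
    then have j: "2*l - Suc i < k" "2*l - Suc (2*l - Suc i) = i" using i by (auto simp: idx_def)
    have "sg (a (2*l - Suc i)) * tp (- a (2*l - Suc i)) \<noteq> 0" using sg_nonzero tp_nonzero by (metis mult_eq_0_iff)
    then show ?thesis using old(3)[OF j(1)] unfolding j(2) by blast
  qed
  then have "\<forall>i\<in>idx l k. \<exists>c. c \<noteq> 0 \<and> A *\<^sub>v h i = c \<cdot>\<^sub>v g i" by blast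
  from cartan_step[OF U kl fh this] obtain m p q p' q' where
    m: "0 \<le> m" "pole_le l k A h g m" "\<not> pole_le l k A h g (m - 1)"
    and pq: "p \<in> perp l k h" "q \<in> perp l k h" "p' \<in> perp l k g" "q' \<in> perp l k g"
    and H: "lp.herm l p p = 0" "lp.herm l q q = 0" "lp.herm l p q = (-1)^k"
     "lp.herm l p' p' = 0" "lp.herm l q' q' = 0" "lp.herm l p' q' = (-1)^k"
    and A: "A *\<^sub>v p = tp m \<cdot>\<^sub>v p'" "A *\<^sub>v q = (sg m * tp (- m)) \<cdot>\<^sub>v q'"
    by (elim exE conjE)
  let ?h = "h(k := p, 2*l - Suc k := q)" and ?g = "g(k := p', 2*l - Suc k := q')" and ?a = "a(k := m)"
  note eh = frame_extend[OF fh(1) kl pq(1) H(1) pq(2) H(2,3)]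
  note eg = frame_extend[OF fh(2) kl pq(3) H(4) pq(4) H(5,6)]
  \<comment> \<open>The previous exponent is still a bound on the current complements, and m is the
    minimal one.\<close>
  have mk: "m \<le> a i" if i: "i < k" for i
  proof -
    have "m \<le> a (k - 1)"
    proof (rule ccontr)
      assume "\<not> m \<le> a (k - 1)"
      then have "a (k - 1) \<le> m - 1" by simp
      moreover have "pole_le l k A h g (a (k - 1))" using S i unfolding cartan_state_def by auto
      ultimately show False using pole_le_mono m(3) by blast
    qed
    also have "a (k - 1) \<le> a i" using i by (intro dec) auto
    finally show ?thesis .
  qed
  have "cartan_state l A (Suc k) ?h ?g ?a" unfolding cartan_state_def
  proof (intro conjI allI impI)
    show "frame l (Suc k) ?h" "frame l (Suc k) ?g" by (rule eh eg)+
    have ne: "k \<noteq> 2*l - Suc k" using kl by simp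
    fix i assume i: "i < Suc k"
    have ne2: "i \<noteq> k \<Longrightarrow> i \<noteq> 2*l - Suc k \<and> 2*l - Suc i \<noteq> k \<and> 2*l - Suc i \<noteq> 2*l - Suc k" using i kl by auto
    show "0 \<le> ?a i" using old(1) m(1) i by (cases "i = k") auto
    show "A *\<^sub>v ?h i = tp (?a i) \<cdot>\<^sub>v ?g i" using old(2)[of i] A(1) i ne ne2 by (cases "i = k") auto
    show "A *\<^sub>v ?h (2*l - Suc i) = (sg (?a i) * tp (- ?a i)) \<cdot>\<^sub>v ?g (2*l - Suc i)"
      using old(3)[of i] A(2) i ne ne2 by (cases "i = k") auto
  next
    fix i j assume "i \<le> j" "j < Suc k"
    then show "?a j \<le> ?a i" using dec[of i j] mk[of i] by (cases "j = k"; cases "i = k") auto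
  next
    show "pole_le l (Suc k) A ?h ?g (?a (Suc k - 1))"
      unfolding pole_le_def
    proof (intro ballI)
      fix v w assume "v \<in> perp l (Suc k) ?h" "w \<in> perp l (Suc k) ?g"
      then have "v \<in> perp l k h \<and> w \<in> perp l k g" using eh(2) eg(2) by blast
      then show "tp (?a (Suc k - 1)) * lp.herm l w (A *\<^sub>v v) \<in> ring_O" using m(2) unfolding pole_le_def by simp
    qed
  qed
  then show ?case by blast
qed

section \<open>Symplectic transvections\<close>

text \<open>The matrix of the map which adds to w the multiple c \<open>herm v w\<close> of
  v.\<close>

definition transvection :: "nat \<Rightarrow> complex vec \<Rightarrow> complex \<Rightarrow> complex mat" where
  "transvection l v c = mat (2*l) (2*l) (\<lambda>(i,j). (if i = j then 1 else 0) + c * v $ i * ((-1)^(2*l - Suc j) * v $ (2*l - Suc j)))"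

lemma transvection_carrier [simp]: "transvection l v c \<in> carrier_mat (2*l) (2*l)"
  by (simp add: transvection_def)

lemma transvection_dim [simp]: "dim_row (transvection l v c) = 2*l" "dim_col (transvection l v c) = 2*l"
  by (simp_all add: transvection_def)

lemma transvection_apply:
  assumes v: "v \<in> carrier_vec (2*l)" and w: "w \<in> carrier_vec (2*l)"
  shows "transvection l v c *\<^sub>v w = w + (c * cx.herm l v w) \<cdot>\<^sub>v v"
proof (rule eq_vecI)
  fix i assume "i < dim_vec (w + (c * cx.herm l v w) \<cdot>\<^sub>v v)"
  then have i: "i < 2*l" using v by simp
  have h: "cx.herm l v w = (\<Sum>j<2*l. (-1)^(2*l - Suc j) * v $ (2*l - Suc j) * w $ j)"
    unfolding cx.herm_def by (subst sum.nat_diff_reindex[symmetric]) simp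
  have "(transvection l v c *\<^sub>v w) $ i = (\<Sum>j<2*l. transvection l v c $$ (i,j) * w $ j)"
    by (rule mult_mat_vec_index[OF _ w i]) simp
  also have "\<dots> = (\<Sum>j<2*l. (if i = j then w $ j else 0) + c * v $ i * ((-1)^(2*l - Suc j) * v $ (2*l - Suc j) * w $ j))"
    using i by (intro sum.cong refl) (auto simp: transvection_def algebra_simps)
  also have "\<dots> = w $ i + c * v $ i * cx.herm l v w"
    using i by (simp add: sum.distrib h sum_distrib_left)
  finally show "(transvection l v c *\<^sub>v w) $ i = (w + (c * cx.herm l v w) \<cdot>\<^sub>v v) $ i"
    using i v w by simp
qed (use v in auto)

lemma cx_herm_skew: "cx.herm l w v = - cx.herm l v w" using cx.herm_skew[of l w v] by simp

lemma cx_herm_self: "cx.herm l v v = 0" using cx_herm_skew[of l v v] by simp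

lemma cx_herm_lin:
  assumes "u \<in> carrier_vec (2*l)" "v \<in> carrier_vec (2*l)" "w \<in> carrier_vec (2*l)"
  shows "cx.herm l u (v + c \<cdot>\<^sub>v w) = cx.herm l u v + c * cx.herm l u w"
    "cx.herm l (v + c \<cdot>\<^sub>v w) u = cx.herm l v u + c * cx.herm l w u"
    "cx.herm l u (v - w) = cx.herm l u v - cx.herm l u w"
    "cx.herm l (v - w) u = cx.herm l v u - cx.herm l w u"
proof -
  show 1: "cx.herm l u (v + c \<cdot>\<^sub>v w) = cx.herm l u v + c * cx.herm l u w" for c
    using assms by (simp add: cx.herm_add_right cx.herm_smult_right)
  show 2: "cx.herm l (v + c \<cdot>\<^sub>v w) u = cx.herm l v u + c * cx.herm l w u" for c
    using assms by (simp add: cx.herm_add_left cx.herm_smult_left)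
  have "v - w = v + (-1) \<cdot>\<^sub>v w" using assms by (intro eq_vecI) auto
  then show "cx.herm l u (v - w) = cx.herm l u v - cx.herm l u w" "cx.herm l (v - w) u = cx.herm l v u - cx.herm l w u"
    using 1[of "-1"] 2[of "-1"] by auto
qed

lemma isometry_unitary:
  assumes M: "M \<in> carrier_mat (2*l) (2*l)"
    and iso: "\<And>v w. v \<in> carrier_vec (2*l) \<Longrightarrow> w \<in> carrier_vec (2*l) \<Longrightarrow> cx.herm l (M *\<^sub>v v) (M *\<^sub>v w) = cx.herm l v w"
  shows "cx.unitary l M"
proof -
  have "cx.unitary l (mat (2*l) (2*l) (\<lambda>(i,j). (M *\<^sub>v unit_vec (2*l) j) $ i))"
    by (rule cx.unitary_columns) (use M iso in \<open>auto simp: cx.herm_unit_unit intro!: mult_mat_vec_carrier[of _ "2*l" "2*l"]\<close>)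
  moreover have "mat (2*l) (2*l) (\<lambda>(i,j). (M *\<^sub>v unit_vec (2*l) j) $ i) = M"
    by (rule eq_matI) (use M in auto)
  ultimately show ?thesis by simp
qed

lemma transvection_unitary:
  assumes v: "v \<in> carrier_vec (2*l)" shows "cx.unitary l (transvection l v c)"
proof (rule isometry_unitary)
  fix w w' :: "complex vec" assume w: "w \<in> carrier_vec (2*l)" "w' \<in> carrier_vec (2*l)"
  show "cx.herm l (transvection l v c *\<^sub>v w) (transvection l v c *\<^sub>v w') = cx.herm l w w'"
    unfolding transvection_apply[OF v w(1)] transvection_apply[OF v w(2)]
    using v w by (simp add: cx_herm_lin cx_herm_self cx_herm_skew[of l w v])
qed simp

text \<open>A transvection is the square of the one with half the parameter, and the determinant of
  a unitary matrix squares to 1.\<close>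

lemma transvection_det:
  assumes v: "v \<in> carrier_vec (2*l)" shows "det (transvection l v c) = 1"
proof -
  let ?T = "transvection l v (c/2)"
  have "?T * ?T = transvection l v c"
  proof (rule eq_matI)
    fix i j assume "i < dim_row (transvection l v c)" "j < dim_col (transvection l v c)"
    then have ij: "i < 2*l" "j < 2*l" by (auto simp: transvection_def)
    let ?e = "unit_vec (2*l) j :: complex vec"
    have "(?T * ?T) *\<^sub>v ?e = ?T *\<^sub>v (?T *\<^sub>v ?e)" by (rule assoc_mult_mat_vec[of _ "2*l" "2*l" _ "2*l"]) auto
    also have "\<dots> = ?T *\<^sub>v (?e + (c/2 * cx.herm l v ?e) \<cdot>\<^sub>v v)" using v by (simp add: transvection_apply)
    also have "\<dots> = transvection l v c *\<^sub>v ?e"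
      using v by (subst (1 2) transvection_apply) (auto simp: cx_herm_lin cx_herm_self algebra_simps intro!: eq_vecI)
    finally have "((?T * ?T) *\<^sub>v ?e) $ i = (transvection l v c *\<^sub>v ?e) $ i" by simp
    moreover have "(M *\<^sub>v ?e) $ i = M $$ (i,j)" if "M \<in> carrier_mat (2*l) (2*l)" for M
      using that ij by simp
    ultimately show "(?T * ?T) $$ (i,j) = transvection l v c $$ (i,j)"
      by (simp del: index_mult_mat(1) index_mult_mat_vec add: mult_carrier_mat[of _ "2*l" "2*l"])
  qed (auto simp: transvection_def)
  then have "det (transvection l v c) = det ?T * det ?T"
    using det_mult[of ?T "2*l" ?T] by simp
  also have "\<dots> = 1" using cx.det_unitary[OF transvection_unitary[OF v]] by simp
  finally show ?thesis .
qed

definition fixed_perp :: "nat \<Rightarrow> nat \<Rightarrow> complex vec set" where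
  "fixed_perp l k = {v \<in> carrier_vec (2*l). \<forall>i\<in>idx l k. cx.herm l (unit_vec (2*l) i) v = 0}"

definition fixer :: "nat \<Rightarrow> nat \<Rightarrow> complex mat set" where
  "fixer l k = {T. cx.unitary l T \<and> det T = 1 \<and> (\<forall>i\<in>idx l k. T *\<^sub>v unit_vec (2*l) i = unit_vec (2*l) i)}"

lemma fixer_mult:
  assumes "S \<in> fixer l k" "T \<in> fixer l k" shows "S * T \<in> fixer l k"
proof -
  have c: "S \<in> carrier_mat (2*l) (2*l)" "T \<in> carrier_mat (2*l) (2*l)" using assms by (auto simp: fixer_def)
  have as: "(S * T) *\<^sub>v unit_vec (2*l) i = S *\<^sub>v (T *\<^sub>v unit_vec (2*l) i)" for i
    using c unit_vec_carrier by (rule assoc_mult_mat_vec)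
  show ?thesis using assms c by (auto simp: fixer_def as cx.unitary_mult det_mult[of _ "2*l"])
qed

text \<open>The transvection in the direction w - u, scaled to carry u to w, moves x by a multiple
  of the pairing of w - u with x. It thus fixes every x that pairs equally with u and w, in
  particular the given unit vectors.\<close>

lemma transvection_move:
  assumes u: "u \<in> fixed_perp l k" and w: "w \<in> fixed_perp l k" and n: "cx.herm l w u \<noteq> 0"
  shows "\<exists>T\<in>fixer l k. T *\<^sub>v u = w \<and> (\<forall>x\<in>carrier_vec (2*l). cx.herm l w x = cx.herm l u x \<longrightarrow> T *\<^sub>v x = x)"
proof -
  have c: "u \<in> carrier_vec (2*l)" "w \<in> carrier_vec (2*l)" using u w by (auto simp: fixed_perp_def)
  define v where "v = w - u"
  define T where "T = transvection l v (1 / cx.herm l w u)"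
  have vc: "v \<in> carrier_vec (2*l)" using c by (simp add: v_def)
  have hv: "cx.herm l v x = cx.herm l w x - cx.herm l u x" if "x \<in> carrier_vec (2*l)" for x
    unfolding v_def using c that by (simp add: cx_herm_lin)
  have fix0: "T *\<^sub>v x = x" if "x \<in> carrier_vec (2*l)" "cx.herm l w x = cx.herm l u x" for x
    unfolding T_def transvection_apply[OF vc that(1)] hv[OF that(1)] that(2) using vc that(1) by (auto intro!: eq_vecI)
  have hz: "cx.herm l w (unit_vec (2*l) i) = 0" "cx.herm l u (unit_vec (2*l) i) = 0" if "i \<in> idx l k" for i
    using u w that by (auto simp: fixed_perp_def cx_herm_skew[of l _ "unit_vec (2*l) i"])
  have "T \<in> fixer l k" unfolding fixer_def
  proof (intro CollectI conjI ballI)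
    show "cx.unitary l T" "det T = 1"
      unfolding T_def by (rule transvection_unitary[OF vc], rule transvection_det[OF vc])
    fix i assume "i \<in> idx l k"
    then show "T *\<^sub>v unit_vec (2*l) i = unit_vec (2*l) i" by (intro fix0) (simp_all add: hz)
  qed
  moreover have "T *\<^sub>v u = w"
    unfolding T_def transvection_apply[OF vc c(1)] hv[OF c(1)] using n c by (auto simp: cx_herm_self v_def intro!: eq_vecI)
  ultimately show ?thesis by (intro bexI[of _ T] conjI ballI impI fix0)
qed

text \<open>One transvection suffices when the two vectors pair nontrivially. Otherwise the way
  leads through a vector pairing nontrivially with both, for which one of u', e' and u' + e' can be
  taken.\<close>

lemma transvection_transitive:
  assumes u: "u \<in> fixed_perp l k" "u' \<in> fixed_perp l k" "cx.herm l u u' \<noteq> 0"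
    and e: "e \<in> fixed_perp l k" "e' \<in> fixed_perp l k" "cx.herm l e e' \<noteq> 0"
  shows "\<exists>T\<in>fixer l k. T *\<^sub>v u = e"
proof (cases "cx.herm l e u \<noteq> 0")
  case True
  then show ?thesis using transvection_move[OF u(1) e(1)] by blast
next
  case False
  have c: "u \<in> carrier_vec (2*l)" "u' \<in> carrier_vec (2*l)" "e \<in> carrier_vec (2*l)" "e' \<in> carrier_vec (2*l)"
    using u e by (auto simp: fixed_perp_def)
  have sum: "u' + 1 \<cdot>\<^sub>v e' \<in> fixed_perp l k"
    using u e c by (auto simp: fixed_perp_def cx.herm_add_right)
  obtain w where w: "w \<in> fixed_perp l k" "cx.herm l w u \<noteq> 0" "cx.herm l e w \<noteq> 0"
  proof -
    consider "cx.herm l e u' \<noteq> 0" | "cx.herm l u e' \<noteq> 0" | "cx.herm l e u' = 0" "cx.herm l u e' = 0" by blast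
    then show ?thesis
    proof cases
      case 1
      then show ?thesis using that[of u'] u by (simp add: cx_herm_skew[of l u' u])
    next
      case 2
      then show ?thesis using that[of e'] e by (simp add: cx_herm_skew[of l e' u])
    next
      case 3
      have "cx.herm l (u' + 1 \<cdot>\<^sub>v e') u = - cx.herm l u u'"
        using c 3 by (simp only: cx_herm_lin cx_herm_skew[of l u' u] cx_herm_skew[of l e' u]) simp
      moreover have "cx.herm l e (u' + 1 \<cdot>\<^sub>v e') = cx.herm l e e'" using c 3 by (simp only: cx_herm_lin) simp
      ultimately show ?thesis using that[OF sum] u e by simp
    qed
  qed
  obtain S where S: "S \<in> fixer l k" "S *\<^sub>v u = w" using transvection_move[OF u(1) w(1,2)] by blast
  obtain T where T: "T \<in> fixer l k" "T *\<^sub>v w = e" using transvection_move[OF w(1) e(1) w(3)] by blast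
  have "(T * S) *\<^sub>v u = T *\<^sub>v (S *\<^sub>v u)"
    using S T c by (intro assoc_mult_mat_vec[of _ "2*l" "2*l" _ "2*l"]) (auto simp: fixer_def)
  then show ?thesis using fixer_mult[OF T(1) S(1)] S T by (intro bexI[of _ "T * S"]) auto
qed

text \<open>Induction on the number of hyperbolic pairs that M may still move: multiplying by
  products of transvections, which have determinant 1, makes M fix one more pair until the identity
  is reached.\<close>

lemma det_symplectic_aux:
  "k \<le> l \<Longrightarrow> cx.unitary l M \<Longrightarrow> (\<And>i. i \<in> idx l k \<Longrightarrow> M *\<^sub>v unit_vec (2*l) i = unit_vec (2*l) i) \<Longrightarrow> det M = 1"
proof (induction "l - k" arbitrary: k M)
  case 0
  have M: "M \<in> carrier_mat (2*l) (2*l)" by (rule cx.unitary_carrier[OF 0(3)])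
  have "M = 1\<^sub>m (2*l)"
  proof (rule eq_matI)
    fix i j assume "i < dim_row (1\<^sub>m (2*l) :: complex mat)" "j < dim_col (1\<^sub>m (2*l) :: complex mat)"
    then have ij: "i < 2*l" "j < 2*l" by auto
    then have "M *\<^sub>v unit_vec (2*l) j = unit_vec (2*l) j" using 0 by (intro 0(4)) (auto simp: idx_def)
    then have "(M *\<^sub>v unit_vec (2*l) j) $ i = unit_vec (2*l) j $ i" by simp
    moreover have "(M *\<^sub>v unit_vec (2*l) j) $ i = M $$ (i,j)" using ij M by simp
    moreover have "unit_vec (2*l) j $ i = 1\<^sub>m (2*l) $$ (i,j)" using ij by simp
    ultimately show "M $$ (i,j) = 1\<^sub>m (2*l) $$ (i,j)" by simp
  qed (use M in auto)
  then show ?case by simp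
next
  case (Suc d)
  have kl: "k < l" using Suc by simp
  let ?n = "2*l" let ?k = "?n - Suc k" let ?H = "cx.herm l"
  define e where "e = (unit_vec ?n k :: complex vec)"
  define e' where "e' = (unit_vec ?n ?k :: complex vec)"
  have M: "M \<in> carrier_mat ?n ?n" by (rule cx.unitary_carrier[OF Suc.prems(2)])
  have kn: "k < ?n" "?k < ?n" using kl by auto
  have ec: "e \<in> carrier_vec ?n" "e' \<in> carrier_vec ?n" by (auto simp: e_def e'_def)
  have ee: "?H e e' = (-1)^k" "?H e' e = - ((-1)^k)"
    unfolding cx_herm_skew[of l e' e] using kl kn by (auto simp: e_def e'_def cx.herm_unit_unit cx.J_entry_def)
  have eW: "e \<in> fixed_perp l k" "e' \<in> fixed_perp l k"
    using kl kn by (auto simp: fixed_perp_def e_def e'_def cx.herm_unit_unit cx.J_entry_def idx_def)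
  have pres: "N *\<^sub>v v \<in> fixed_perp l k" if N: "cx.unitary l N" "\<And>i. i \<in> idx l k \<Longrightarrow> N *\<^sub>v unit_vec ?n i = unit_vec ?n i"
    and v: "v \<in> fixed_perp l k" for N v
  proof -
    have "?H (unit_vec ?n i) (N *\<^sub>v v) = 0" if i: "i \<in> idx l k" for i
    proof -
      have "?H (N *\<^sub>v unit_vec ?n i) (N *\<^sub>v v) = ?H (unit_vec ?n i) v"
        using N v by (intro cx.unitary_herm) (auto simp: fixed_perp_def)
      then show ?thesis using N(2)[OF i] v i by (simp add: fixed_perp_def)
    qed
    then show ?thesis using N v by (auto simp: fixed_perp_def intro!: mult_mat_vec_carrier[of _ ?n ?n])
  qed
  have uW: "M *\<^sub>v e \<in> fixed_perp l k" "M *\<^sub>v e' \<in> fixed_perp l k" using pres Suc.prems eW by auto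
  have "?H (M *\<^sub>v e) (M *\<^sub>v e') = ?H e e'" using Suc.prems ec by (intro cx.unitary_herm) auto
  then obtain S where S: "S \<in> fixer l k" "S *\<^sub>v (M *\<^sub>v e) = e"
    using transvection_transitive[OF uW _ eW] ee by auto
  have Sc: "S \<in> carrier_mat ?n ?n" "cx.unitary l S" "det S = 1" using S by (auto simp: fixer_def)
  define y where "y = S *\<^sub>v (M *\<^sub>v e')"
  have yW: "y \<in> fixed_perp l k" unfolding y_def by (rule pres) (use S uW in \<open>auto simp: fixer_def\<close>)
  have yc: "y \<in> carrier_vec ?n" using yW by (simp add: fixed_perp_def)
  have "?H e y = ?H (S *\<^sub>v (M *\<^sub>v e)) (S *\<^sub>v (M *\<^sub>v e'))" by (simp add: S(2) y_def)
  also have "\<dots> = ?H (M *\<^sub>v e) (M *\<^sub>v e')" using uW Sc by (intro cx.unitary_herm) (auto simp: fixed_perp_def)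
  also have "\<dots> = ?H e e'" by fact
  finally have ey: "?H e y = (-1)^k" "?H y e = - ((-1)^k)" using ee cx_herm_skew[of l y e] by auto
  \<comment> \<open>Now y has to go to e' while e stays. Both y and e' pair with e in the same way,
    so a transvection from y to e' fixes e. If y and e' are orthogonal, the detour through e' + e
    works, which pairs with e in the same way too.\<close>
  obtain T where T: "T \<in> fixer l k" "T *\<^sub>v e = e" "T *\<^sub>v y = e'"
  proof (cases "?H e' y = 0")
    case False
    from transvection_move[OF yW eW(2) this] obtain T where "T \<in> fixer l k" "T *\<^sub>v y = e'"
      "\<forall>x\<in>carrier_vec ?n. ?H e' x = ?H y x \<longrightarrow> T *\<^sub>v x = x" by blast
    then show ?thesis using that ec ee ey by auto
  next
    case True
    define z where "z = e' + 1 \<cdot>\<^sub>v e"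
    have zW: "z \<in> fixed_perp l k" using eW ec by (auto simp: z_def fixed_perp_def cx.herm_add_right)
    have zc: "z \<in> carrier_vec ?n" using ec by (simp add: z_def)
    have zy: "?H z y = (-1)^k" unfolding z_def using ec yc True ey by (simp only: cx_herm_lin; simp)
    have ze: "?H z e = ?H y e" unfolding z_def using ec ee ey by (simp only: cx_herm_lin cx_herm_self; simp)
    have ez: "?H e' z = - ((-1)^k)" unfolding z_def using ec ee by (simp only: cx_herm_lin cx_herm_self; simp)
    have "?H z y \<noteq> 0" using zy by simp
    from transvection_move[OF yW zW this] obtain T1 where T1: "T1 \<in> fixer l k" "T1 *\<^sub>v y = z"
      "\<forall>x\<in>carrier_vec ?n. ?H z x = ?H y x \<longrightarrow> T1 *\<^sub>v x = x" by blast
    have "?H e' z \<noteq> 0" using ez by simp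
    from transvection_move[OF zW eW(2) this] obtain T2 where T2: "T2 \<in> fixer l k" "T2 *\<^sub>v z = e'"
      "\<forall>x\<in>carrier_vec ?n. ?H e' x = ?H z x \<longrightarrow> T2 *\<^sub>v x = x" by blast
    have as: "(T2 * T1) *\<^sub>v x = T2 *\<^sub>v (T1 *\<^sub>v x)" if "x \<in> carrier_vec ?n" for x
      using T1 T2 that by (intro assoc_mult_mat_vec[of _ ?n ?n _ ?n]) (auto simp: fixer_def)
    have "(T2 * T1) *\<^sub>v e = e" using as[OF ec(1)] T1(3) T2(3) ec ze ee ey by auto
    moreover have "(T2 * T1) *\<^sub>v y = e'" using as[OF yc] T1 T2 by simp
    ultimately show ?thesis using that fixer_mult[OF T2(1) T1(1)] by blast
  qed
  have Tc: "T \<in> carrier_mat ?n ?n" "cx.unitary l T" "det T = 1" using T by (auto simp: fixer_def)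
  have SM: "S * M \<in> carrier_mat ?n ?n" by (rule mult_carrier_mat[OF Sc(1) M])
  define N where "N = T * (S * M)"
  have Nx: "N *\<^sub>v x = T *\<^sub>v (S *\<^sub>v (M *\<^sub>v x))" if "x \<in> carrier_vec ?n" for x
  proof -
    have "N *\<^sub>v x = T *\<^sub>v ((S * M) *\<^sub>v x)" unfolding N_def
      by (rule assoc_mult_mat_vec[OF Tc(1) SM that])
    also have "(S * M) *\<^sub>v x = S *\<^sub>v (M *\<^sub>v x)" by (rule assoc_mult_mat_vec[OF Sc(1) M that])
    finally show ?thesis .
  qed
  have "det N = 1"
  proof (rule Suc.hyps(1)[of "Suc k"])
    show "d = l - Suc k" "Suc k \<le> l" using Suc.hyps kl by auto
    show "cx.unitary l N" unfolding N_def using Tc Sc Suc.prems by (intro cx.unitary_mult) auto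
    fix i assume "i \<in> idx l (Suc k)"
    then have "i = k \<or> i = ?k \<or> i \<in> idx l k" by (simp add: idx_def) arith
    then consider "i = k" | "i = ?k" | "i \<in> idx l k" by blast
    then show "N *\<^sub>v unit_vec ?n i = unit_vec ?n i"
    proof cases
      case 1 then show ?thesis using Nx[OF ec(1)] S T by (simp add: e_def)
    next
      case 2 then show ?thesis using Nx[OF ec(2)] T by (simp add: e'_def y_def)
    next
      case 3 then show ?thesis using Nx[of "unit_vec ?n i"] S T Suc.prems by (simp add: fixer_def)
    qed
  qed
  moreover have "det N = det T * (det S * det M)"
    unfolding N_def det_mult[OF Tc(1) SM] det_mult[OF Sc(1) M] ..
  ultimately show ?case using Tc Sc by simp
qed

lemma det_symplectic: "cx.unitary l M \<Longrightarrow> det M = 1"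
  by (rule det_symplectic_aux[of 0]) (auto simp: idx_def)

section \<open>Small weights\<close>

lemma finite_pos_roots: "finite (pos_roots l)"
proof -
  have "pos_roots l \<subseteq> (\<lambda>(i,j) k. unit_wt i k - unit_wt j k) ` ({..<l} \<times> {..<l}) \<union>
      (\<lambda>(i,j) k. unit_wt i k + unit_wt j k) ` ({..<l} \<times> {..<l}) \<union> (\<lambda>i k. 2 * unit_wt i k) ` {..<l}"
    unfolding pos_roots_def by (intro Un_mono subsetI) (force simp: image_iff)+
  then show ?thesis by (rule finite_subset) simp
qed

lemma wt_geq_simple_roots:
  fixes t :: "nat \<Rightarrow> nat"
  assumes "\<And>i. i < l \<Longrightarrow> \<alpha> i \<in> pos_roots l" "\<And>k. k < l \<Longrightarrow> a k - m k = (\<Sum>i<l. int (t i) * \<alpha> i k)"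
  shows "wt_geq l a m"
  unfolding wt_geq_def
\<comment> \<open>The coefficients in \<open>wt_geq\<close> are indexed by roots, hence the sum over
  all indices that give the same root.\<close>
proof (intro exI[of _ "\<lambda>\<beta>. \<Sum>i | i \<in> {..<l} \<and> \<alpha> i = \<beta>. t i"] allI impI)
  fix k assume k: "k < l"
  have "(\<Sum>\<beta>\<in>pos_roots l. int (\<Sum>i | i \<in> {..<l} \<and> \<alpha> i = \<beta>. t i) * \<beta> k) =
      (\<Sum>\<beta>\<in>pos_roots l. \<Sum>i | i \<in> {..<l} \<and> \<alpha> i = \<beta>. int (t i) * \<alpha> i k)"
    by (intro sum.cong refl) (simp add: sum_distrib_right)
  also have "\<dots> = (\<Sum>i<l. int (t i) * \<alpha> i k)"
    by (rule sum.group) (use finite_pos_roots assms(1) in auto)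
  finally show "a k - m k = (\<Sum>\<beta>\<in>pos_roots l. int (\<Sum>i | i \<in> {..<l} \<and> \<alpha> i = \<beta>. t i) * \<beta> k)"
    using assms(2)[OF k] by simp
qed

text \<open>In terms of the simple roots e_i - e_(i+1) and 2 e_l, the coefficients of a vector are
  its partial sums, the last one halved; the parity assumption makes the half an integer.\<close>

lemma wt_geq_partial_sums:
  assumes l: "l \<ge> 1" and s: "\<And>k. k < l \<Longrightarrow> 0 \<le> (\<Sum>i\<le>k. a i - m i)" and ev: "even (\<Sum>i<l. a i - m i)"
  shows "wt_geq l a m"
proof -
  define s' where "s' k = (\<Sum>i\<le>k. a i - m i)" for k
  define \<alpha> where "\<alpha> i = (if Suc i < l then (\<lambda>k. unit_wt i k - unit_wt (Suc i) k) else (\<lambda>k. 2 * unit_wt i k))" for i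
  define t where "t i = nat (if Suc i < l then s' i else s' i div 2)" for i
  have last: "s' (l - 1) = (\<Sum>i<l. a i - m i)"
    unfolding s'_def using l by (intro sum.cong) auto
  show ?thesis
  proof (rule wt_geq_simple_roots[of l \<alpha> _ _ t])
    show "\<alpha> i \<in> pos_roots l" if "i < l" for i using that unfolding \<alpha>_def pos_roots_def by auto
    fix k assume k: "k < l"
    have "int (t i) * \<alpha> i k = (if i = k then s' i else 0) - (if Suc i = k then s' i else 0)" if i: "i < l" for i
    proof (cases "Suc i < l")
      case True
      then show ?thesis using s[OF i] by (auto simp: t_def \<alpha>_def s'_def[symmetric])
    next
      case False
      then have il: "i = l - 1" "Suc i \<noteq> k" using i k by auto
      then have "even (s' i)" using last ev by simp
      then show ?thesis using s[OF i] False il by (auto simp: t_def \<alpha>_def s'_def[symmetric])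
    qed
    then have "(\<Sum>i<l. int (t i) * \<alpha> i k) = (\<Sum>i<l. if i = k then s' i else 0) - (\<Sum>i<l. if Suc i = k then s' i else 0)"
      by (simp add: sum_subtractf)
    also have "(\<Sum>i<l. if i = k then s' i else 0) = s' k" using k by simp
    also have "(\<Sum>i<l. if Suc i = k then s' i else 0) = (case k of 0 \<Rightarrow> 0 | Suc j \<Rightarrow> s' j)"
      using k by (auto split: nat.split)
    also have "s' k - (case k of 0 \<Rightarrow> 0 | Suc j \<Rightarrow> s' j) = a k - m k"
      by (auto split: nat.split simp: s'_def)
    finally show "a k - m k = (\<Sum>i<l. int (t i) * \<alpha> i k)" ..
  qed
qed

text \<open>Every positive root has a nonnegative sum of its first two coordinates, so a sum of at
  most 3 excludes lying above (2,2,0,...,0). Conversely, a dominant weight beyond the bounds has a_0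
  + a_1 \<ge> 4, since parity excludes (3,0,...,0), and then all partial sums of the difference are
  nonnegative.\<close>

lemma small_wt_iff:
  assumes l: "l \<ge> 2"
  shows "small_wt l a \<longleftrightarrow> dominant l a \<and> a 0 \<le> 2 \<and> a 1 \<le> 1"
proof
  assume sm: "small_wt l a"
  then have dom: "dominant l a" by (simp add: small_wt_def)
  have dec: "a j \<le> a i" if "i \<le> j" "j < l" for i j using dom that by (simp add: dominant_def)
  have nn: "0 \<le> a i" if "i < l" for i using dom that by (simp add: dominant_def)
  have ev: "even (\<Sum>i<l. a i)" using dom by (simp add: dominant_def)
  let ?m = "\<lambda>k. 2 * gamma0 k"
  have split: "(\<Sum>i<l. f i) = f 0 + f 1 + (\<Sum>i=2..<l. f i)" for f :: "nat \<Rightarrow> int"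
  proof -
    have "(\<Sum>i<l. f i) = (\<Sum>i\<in>{0,1} \<union> {2..<l}. f i)" using l by (intro sum.cong) auto
    also have "\<dots> = f 0 + f 1 + (\<Sum>i=2..<l. f i)" by (subst sum.union_disjoint) auto
    finally show ?thesis .
  qed
  show "dominant l a \<and> a 0 \<le> 2 \<and> a 1 \<le> 1"
  proof (rule ccontr)
    assume "\<not> (dominant l a \<and> a 0 \<le> 2 \<and> a 1 \<le> 1)"
    then have big: "a 0 \<ge> 3 \<or> a 1 \<ge> 2" using dom by auto
    have a10: "a 1 \<le> a 0" "0 \<le> a 1" using dec[of 0 1] nn[of 1] l by auto
    have four: "a 0 + a 1 \<ge> 4"
    proof (rule ccontr)
      assume "\<not> 4 \<le> a 0 + a 1"
      then have a: "a 0 = 3" "a 1 = 0" using big a10 by auto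
      have "a i = 0" if "i \<in> {2..<l}" for i using dec[of 1 i] nn[of i] that a by auto
      then show False using ev a by (simp add: split)
    qed
    have "wt_geq l a ?m"
    proof (rule wt_geq_partial_sums)
      show "1 \<le> l" using l by simp
      show "even (\<Sum>i<l. a i - ?m i)" using ev by (simp add: sum_subtractf sum_distrib_left[symmetric])
      fix k assume k: "k < l"
      show "0 \<le> (\<Sum>i\<le>k. a i - ?m i)"
      proof (cases k)
        case 0
        then show ?thesis using big a10 by (auto simp: gamma0_def)
      next
        case (Suc j)
        have "(\<Sum>i\<le>k. a i - ?m i) = (\<Sum>i\<in>{0,1} \<union> {2..k}. a i - ?m i)" using Suc by (intro sum.cong) auto
        also have "\<dots> = (a 0 + a 1 - 4) + (\<Sum>i=2..k. a i - ?m i)"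
          by (subst sum.union_disjoint) (auto simp: gamma0_def)
        also have "(\<Sum>i=2..k. a i - ?m i) = (\<Sum>i=2..k. a i)" by (intro sum.cong) (auto simp: gamma0_def)
        also have "0 \<le> (a 0 + a 1 - 4) + (\<Sum>i=2..k. a i)"
          using four k nn by (intro add_nonneg_nonneg sum_nonneg) auto
        finally show ?thesis .
      qed
    qed
    then show False using sm by (simp add: small_wt_def)
  qed
next
  assume h: "dominant l a \<and> a 0 \<le> 2 \<and> a 1 \<le> 1"
  have "\<not> wt_geq l a (\<lambda>k. 2 * gamma0 k)"
  proof
    assume "wt_geq l a (\<lambda>k. 2 * gamma0 k)"
    then obtain c :: "(nat \<Rightarrow> int) \<Rightarrow> nat" where c: "\<And>k. k < l \<Longrightarrow> a k - 2 * gamma0 k = (\<Sum>\<beta>\<in>pos_roots l. int (c \<beta>) * \<beta> k)"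
      unfolding wt_geq_def by blast
    have "0 \<le> \<beta> 0 + \<beta> 1" if "\<beta> \<in> pos_roots l" for \<beta> using that unfolding pos_roots_def by auto
    then have "0 \<le> (\<Sum>\<beta>\<in>pos_roots l. int (c \<beta>) * (\<beta> 0 + \<beta> 1))" by (intro sum_nonneg mult_nonneg_nonneg) auto
    also have "\<dots> = (a 0 - 2) + (a 1 - 2)"
      using c[of 0] c[of 1] l by (simp add: gamma0_def distrib_left sum.distrib)
    finally show False using h by simp
  qed
  then show "small_wt l a" using h by (simp add: small_wt_def)
qed

section \<open>The small part of the Grassmannian\<close>

lemma small_pairD:
  assumes "small_pair l x y"
  shows "x \<in> carrier_mat (2*l) (2*l)" "y \<in> carrier_mat (2*l) (2*l)" "cx.adj l x = x" "outer (2*l) y"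
    "y + cx.adj l y = x * x"
proof -
  note g = assms[unfolded small_pair_def]
  note g2 = conjunct2[OF g] note g3 = conjunct2[OF g2] note g4 = conjunct2[OF g3]
  show "x \<in> carrier_mat (2*l) (2*l)" by (rule conjunct1[OF g])
  show "y \<in> carrier_mat (2*l) (2*l)" by (rule conjunct1[OF g2])
  show "cx.adj l x = x" by (rule conjunct1[OF g3])
  show "y + cx.adj l y = x * x" by (rule conjunct1[OF g4])
  show "outer (2*l) y" by (rule conjunct2[OF conjunct2[OF conjunct2[OF g4]]])
qed

lemma sg_add: "sg (m + k) = sg m * sg k"
  by (simp add: sg_def power_int_add fls_const_mult_const)

lemma sg_uminus: "sg (- m) = sg m"
  by (cases "even m") (simp_all add: sg_def power_int_minus_left)

lemma sg_diff: "sg (m - k) = sg m * sg k"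
  using sg_add[of m "- k"] by (simp add: sg_uminus)

lemma mat_diag_carrier: "mat_diag n f \<in> carrier_mat n n" by simp

lemma mat_diag_index: "i < n \<Longrightarrow> j < n \<Longrightarrow> mat_diag n f $$ (i,j) = (if i = j then f i else 0)"
  by (simp add: mat_diag_def)

lemma adj_mat_diag: "lp.adj l (mat_diag (2*l) f) = mat_diag (2*l) (\<lambda>i. bar (f (2*l - Suc i)))"
  unfolding mat_diag_def by (rule eq_matI) (auto simp: lp.adj_index)

lemma unitary_mat_diag:
  assumes "\<And>i. i < 2*l \<Longrightarrow> f i * bar (f (2*l - Suc i)) = 1" shows "lp.unitary l (mat_diag (2*l) f)"
  unfolding lp.unitary_def adj_mat_diag mat_diag_diag
  using assms by (auto simp: mat_diag_def intro!: eq_matI)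

lemma det_mat_diag: "det (mat_diag n f) = (\<Prod>i<n. f i)" for f :: "nat \<Rightarrow> complex fls"
proof -
  have "det (mat_diag n f) = prod_list (diag_mat (mat_diag n f))"
    by (rule det_upper_triangular[of _ n]) (auto simp: mat_diag_def upper_triangular_def)
  also have "\<dots> = (\<Prod>i<n. f i)"
    by (simp add: prod_list_diag_prod mat_diag_def atLeast0LessThan)
  finally show ?thesis .
qed

lemma prod_pairs: "(\<Prod>i<2*l. f i) = (\<Prod>i<l. f i * f (2*l - Suc i))" for f :: "nat \<Rightarrow> complex fls"
proof -
  have "(\<Prod>i<2*l. f i) = (\<Prod>i\<in>{..<l} \<union> {l..<2*l}. f i)" by (intro prod.cong) auto
  also have "\<dots> = (\<Prod>i<l. f i) * (\<Prod>i\<in>{l..<2*l}. f i)" by (rule prod.union_disjoint) auto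
  also have "(\<Prod>i\<in>{l..<2*l}. f i) = (\<Prod>i<l. f (2*l - Suc i))"
    by (rule prod.reindex_bij_witness[of _ "\<lambda>i. 2*l - Suc i" "\<lambda>i. 2*l - Suc i"]) auto
  finally show ?thesis by (simp add: prod.distrib)
qed

text \<open>On the torus the involution is inversion followed by reversal of the indices and t ->
  -t. The reversal produces the exponents b_i - b_(2l-1-i), the substitution the signs.\<close>

lemma n_elt_eq: "n_elt l b = mat_diag (2*l) (\<lambda>i. sg (b (2*l - Suc i)) * tp (b i - b (2*l - Suc i)))"
proof -
  let ?n = "2*l"
  let ?T = "mat_diag ?n (\<lambda>i. tp (b i)) :: complex fls mat" and ?T' = "mat_diag ?n (\<lambda>i. tp (- b i)) :: complex fls mat"
  interpret comm_ring_hom bar by (rule lp.cj_hom)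
  have "?T * ?T' = 1\<^sub>m ?n" unfolding mat_diag_diag by (simp only: tp_tp) simp
  then have "map_mat bar ?T * map_mat bar ?T' = 1\<^sub>m ?n"
    by (simp add: mat_hom_mult[of _ ?n ?n _ ?n, symmetric] mat_hom_one)
  then have "the (mat_inverse (map_mat bar ?T)) = map_mat bar ?T'"
    by (intro mat_inverse_eqI[of _ ?n]) auto
  moreover have "(\<lambda>f. fls_compose_fps f (- fps_X)) = bar" by (rule ext) (simp add: bar_def)
  ultimately have "sigma_loop l ?T = lp.adj l ?T'"
    by (simp add: sigma_loop_def sigma_G_def lp.adj_eq_Jmat[OF mat_diag_carrier])
  then have "n_elt l b = ?T * mat_diag ?n (\<lambda>i. bar (tp (- b (?n - Suc i))))"
    unfolding n_elt_def t_pow_def adj_mat_diag by simp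
  also have "\<dots> = mat_diag ?n (\<lambda>i. tp (b i) * bar (tp (- b (?n - Suc i))))" by (rule mat_diag_diag)
  also have "(\<lambda>i. tp (b i) * bar (tp (- b (?n - Suc i)))) = (\<lambda>i. sg (b (?n - Suc i)) * tp (b i - b (?n - Suc i)))"
  proof
    fix i
    have "tp (b i) * bar (tp (- b (?n - Suc i))) = sg (- b (?n - Suc i)) * (tp (b i) * tp (- b (?n - Suc i)))"
      unfolding bar_tp by (simp only: mult_ac)
    also have "\<dots> = sg (b (?n - Suc i)) * tp (b i - b (?n - Suc i))" unfolding tp_tp sg_uminus by simp
    finally show "tp (b i) * bar (tp (- b (?n - Suc i))) = sg (b (?n - Suc i)) * tp (b i - b (?n - Suc i))" .
  qed
  finally show ?thesis .
qed

text \<open>If t^2 f is integral, t^-2 is the lowest power that can occur, and integral factors act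
  on its coefficient through their constant terms alone.\<close>

lemma double_pole_coeff:
  assumes "x \<in> ring_O" "z \<in> ring_O" "tp 2 * f \<in> ring_O"
  shows "fls_nth (x * f * z) (-2) = fls_nth x 0 * fls_nth f (-2) * fls_nth z 0"
    and "k \<ge> 3 \<Longrightarrow> fls_nth (x * f * z) (- int k) = 0"
proof -
  define G where "G = x * (tp 2 * f) * z"
  have G: "G \<in> ring_O" unfolding G_def by (intro RO.mult_closed assms)
  have e: "x * f * z = tp (-2) * G"
  proof -
    have "tp (-2) * G = (tp (-2) * tp 2) * (x * f * z)" unfolding G_def by (simp only: mult_ac)
    then show ?thesis unfolding tp_tp by simp
  qed
  have "fls_nth (x * f * z) (-2) = fls_nth G 0" unfolding e tp_nth by simp
  also have "\<dots> = fls_nth x 0 * fls_nth (tp 2 * f) 0 * fls_nth z 0"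
    unfolding G_def by (subst RO.coeff0_mult[OF RO.mult_closed[OF assms(1,3)] assms(2)], subst RO.coeff0_mult[OF assms(1,3)]) simp
  also have "fls_nth (tp 2 * f) 0 = fls_nth f (-2)" unfolding tp_nth by simp
  finally show "fls_nth (x * f * z) (-2) = fls_nth x 0 * fls_nth f (-2) * fls_nth z 0" .
  show "fls_nth (x * f * z) (- int k) = 0" if "k \<ge> 3"
    unfolding e tp_nth using G that unfolding ring_O_iff by simp
qed

lemma fls_nth_sum: "fls_nth (sum f S) m = (\<Sum>i\<in>S. fls_nth (f i) m)"
  by (induction S rule: infinite_finite_induct) auto

lemma M_small_imp_small_pair:
  assumes l: "l \<ge> 2" and p: "p \<in> M_small l"
  shows "\<exists>x y. small_pair l x y \<and> p = gr_pt l (quad_loop l x y)"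
proof -
  let ?n = "2*l"
  from p obtain a where a: "small_wt l a" "p \<in> gr_orbit l a" "p \<in> gr_minus l"
    by (auto simp: M_small_def M_cell_def)
  obtain A where A: "A \<in> congruence_minus l" "p = gr_pt l A" using a(3) by (auto simp: gr_minus_eq)
  obtain g b where g: "g \<in> twisted l ring_O" and b: "coinv_class l b = a" and pg: "p = gr_pt l (g * n_elt l b)"
    using a(2) by (auto simp: gr_orbit_def)
  have "A \<in> gr_pt l (g * n_elt l b)" using mem_gr_pt[OF congruence_minus_carrier[OF A(1)]] A(2) pg by simp
  then obtain h where h: "h \<in> twisted l ring_O" and Ah: "A = g * n_elt l b * h" by (auto simp: gr_pt_eq)
  have gm: "g \<in> mats ?n ring_O" "h \<in> mats ?n ring_O" using g h by (auto simp: twisted_iff SL_iff)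
  have gc: "g \<in> carrier_mat ?n ?n" "h \<in> carrier_mat ?n ?n" using gm by (auto simp: mats_def)
  define \<nu> where "\<nu> i = sg (b (?n - Suc i)) * tp (b i - b (?n - Suc i))" for i
  have N: "n_elt l b = mat_diag ?n \<nu>" unfolding n_elt_eq \<nu>_def ..
  have Aij: "A $$ (i,j) = (\<Sum>p<?n. g $$ (i,p) * \<nu> p * h $$ (p,j))" if "i < ?n" "j < ?n" for i j
  proof -
    have "A = mat ?n ?n (\<lambda>(i,j). g $$ (i,j) * \<nu> j) * h" unfolding Ah N mat_diag_mult_right[OF gc(1)] ..
    then show ?thesis using that gc by (simp add: times_mat_index[of _ ?n ?n _ ?n] del: index_mult_mat(1))
  qed
  have sm: "dominant l a" "a 0 \<le> 2" "a 1 \<le> 1" using a(1) small_wt_iff[OF l] by auto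
  have ak: "a i \<le> 1" "0 \<le> a i" if "1 \<le> i" "i < l" for i
    using sm that order_trans[of "a i" "a 1" 1] by (auto simp: dominant_def)
  have bi: "b i - b (?n - Suc i) = (if i < l then a i else - a (?n - Suc i))" if "i < ?n" for i
    using that l by (auto simp: b[symmetric] coinv_class_def)
  have a0: "0 \<le> a 0" using sm l by (auto simp: dominant_def)
  \<comment> \<open>Every exponent other than the last is at least -1: among the negated weights
    only - a_0, at index 2l - 1, can reach -2. A single diagonal entry with a double pole gives a
    coefficient of rank at most one.\<close>
  have e1: "-1 \<le> b i - b (?n - Suc i)" if "i < ?n - 1" for i
    using that ak[of i] ak[of "?n - Suc i"] a0 bi[of i] by (cases "i = 0") auto
  have e2: "-2 \<le> b i - b (?n - Suc i)" if "i < ?n" for i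
    using that e1[of i] sm(2) bi[of i] l by (cases "i < ?n - 1") (auto simp: not_less le_antisym)
  have nuO: "tp 2 * \<nu> i \<in> ring_O" if "i < ?n" for i
  proof -
    have "tp 2 * \<nu> i = sg (b (?n - Suc i)) * tp (2 + (b i - b (?n - Suc i)))"
      unfolding \<nu>_def tp_tp[symmetric] by (simp only: mult_ac)
    also have "\<dots> \<in> ring_O" using e2[OF that] by (intro RO.mult_closed sg_O tp_O) simp
    finally show ?thesis .
  qed
  have nu2: "fls_nth (\<nu> i) (-2) = 0" if "i < ?n - 1" for i
  proof -
    have "fls_nth (\<nu> i) (-2) = fls_nth (sg (b (?n - Suc i))) (-2 - (b i - b (?n - Suc i)))" unfolding \<nu>_def tp_nth ..
    also have "\<dots> = 0" using e1[OF that] by (simp add: sg_def)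
    finally show ?thesis .
  qed
  have ge: "g $$ (i,p) \<in> ring_O" "h $$ (i,p) \<in> ring_O" if "i < ?n" "p < ?n" for i p
    using gm that by (auto simp: mats_def simp del: image_iff)
  have Ac: "A \<in> carrier_mat ?n ?n" by (rule congruence_minus_carrier[OF A(1)])
  have c3: "cf k A = 0\<^sub>m ?n ?n" if "k \<ge> 3" for k
  proof (rule eq_matI)
    fix i j assume "i < dim_row (0\<^sub>m ?n ?n :: complex mat)" "j < dim_col (0\<^sub>m ?n ?n :: complex mat)"
    then have ij: "i < ?n" "j < ?n" by auto
    have "fls_nth (A $$ (i,j)) (- int k) = (\<Sum>p<?n. fls_nth (g $$ (i,p) * \<nu> p * h $$ (p,j)) (- int k))"
      unfolding Aij[OF ij] fls_nth_sum ..
    also have "\<dots> = 0"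
      by (intro sum.neutral ballI double_pole_coeff(2) ge ij nuO that) auto
    finally show "cf k A $$ (i,j) = 0\<^sub>m ?n ?n $$ (i,j)" using ij Ac by simp
  qed (use Ac in auto)
  have "outer ?n (cf 2 A)" unfolding outer_def
  proof (intro exI allI impI)
    fix i j assume ij: "i < ?n" "j < ?n"
    have "cf 2 A $$ (i,j) = fls_nth (A $$ (i,j)) (-2)" using ij Ac by simp
    also have "\<dots> = (\<Sum>p<?n. fls_nth (g $$ (i,p) * \<nu> p * h $$ (p,j)) (-2))"
      unfolding Aij[OF ij] fls_nth_sum ..
    also have "\<dots> = (\<Sum>p<?n. fls_nth (g $$ (i,p)) 0 * fls_nth (\<nu> p) (-2) * fls_nth (h $$ (p,j)) 0)"
      by (intro sum.cong refl double_pole_coeff(1) ge ij nuO) auto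
    also have "\<dots> = (\<Sum>p\<in>{?n - 1}. fls_nth (g $$ (i,p)) 0 * fls_nth (\<nu> p) (-2) * fls_nth (h $$ (p,j)) 0)"
      using l by (intro sum.mono_neutral_right) (auto simp: nu2)
    finally show "cf 2 A $$ (i,j) = (fls_nth (g $$ (i,?n - 1)) 0 * fls_nth (\<nu> (?n - 1)) (-2)) * fls_nth (h $$ (?n - 1,j)) 0"
      by simp
  qed
  from congruence_minus_small_pair[OF A(1) c3 this] A(2) show ?thesis by metis
qed

lemma small_pair_imp_M_small:
  assumes l: "l \<ge> 2" and gd: "small_pair l x y"
  shows "gr_pt l (quad_loop l x y) \<in> M_small l"
proof -
  let ?n = "2*l"
  define A where "A = quad_loop l x y"
  have Acm: "A \<in> congruence_minus l" unfolding A_def by (rule quad_loop_small_pair[OF gd])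
  have AU: "lp.unitary l A" and detA: "det A = 1" and Ac: "A \<in> carrier_mat ?n ?n"
    using congruence_minus_subset[OF Acm] by (auto simp: twisted_iff SL_iff)
  obtain h g a' where S: "cartan_state l A l h g a'" using cartan_frames[OF AU order_refl] by blast
  have idx: "idx l l = {..<?n}" by (auto simp: idx_def)
  have fr: "frame l l h" "frame l l g" using S by (auto simp: cartan_state_def)
  have rel: "A *\<^sub>v h i = tp (a' i) \<cdot>\<^sub>v g i" "A *\<^sub>v h (?n - Suc i) = (sg (a' i) * tp (- a' i)) \<cdot>\<^sub>v g (?n - Suc i)" "0 \<le> a' i"
    if "i < l" for i using S that unfolding cartan_state_def by blast+
  have dec: "a' j \<le> a' i" if "i \<le> j" "j < l" for i j using S that unfolding cartan_state_def by blast
  \<comment> \<open>The two frames as matrices. In these bases A becomes the diagonal matrix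
    \<open>N\<close> of the exponents, A P = Q N.\<close>
  define P where "P = mat ?n ?n (\<lambda>(i,j). h j $ i)"
  define Q where "Q = mat ?n ?n (\<lambda>(i,j). g j $ i)"
  define \<nu> where "\<nu> i = (if i < l then tp (a' i) else sg (a' (?n - Suc i)) * tp (- a' (?n - Suc i)))" for i
  define N where "N = mat_diag ?n \<nu>"
  have ov: "ovec l (h i)" "ovec l (g i)" if "i < ?n" for i using fr that by (auto simp: frame_def idx)
  have PU: "lp.unitary l P" "lp.unitary l Q"
    unfolding P_def Q_def by (rule lp.unitary_columns; use fr ov in \<open>auto simp: frame_def idx\<close>)+
  have Pc: "P \<in> carrier_mat ?n ?n" "Q \<in> carrier_mat ?n ?n" by (auto simp: P_def Q_def)
  have PO: "P \<in> mats ?n ring_O" "Q \<in> mats ?n ring_O"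
    unfolding mats_def P_def Q_def using ov by (auto simp: ovec_def simp del: image_iff)
  have Nc: "N \<in> carrier_mat ?n ?n" by (simp add: N_def)
  have col: "A *\<^sub>v h j = \<nu> j \<cdot>\<^sub>v g j" if j: "j < ?n" for j
  proof (cases "j < l")
    case True
    then show ?thesis using rel(1)[OF True] by (simp add: \<nu>_def)
  next
    case False
    then have "?n - Suc j < l" "?n - Suc (?n - Suc j) = j" using j by auto
    then show ?thesis using rel(2)[of "?n - Suc j"] False by (simp add: \<nu>_def)
  qed
  have AP: "A * P = Q * N"
  proof (rule eq_matI)
    fix i j assume "i < dim_row (Q * N)" "j < dim_col (Q * N)"
    then have ij: "i < ?n" "j < ?n" using Pc Nc by auto
    have "(A * P) $$ (i,j) = (A *\<^sub>v h j) $ i"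
      unfolding times_mat_index[OF Ac Pc(1) ij] mult_mat_vec_index[OF Ac ovec_carrier[OF ov(1)[OF ij(2)]] ij(1)]
      using ij by (intro sum.cong) (auto simp: P_def)
    also have "\<dots> = \<nu> j * g j $ i" unfolding col[OF ij(2)] using ij carrier_vecD[OF ovec_carrier[OF ov(2)[OF ij(2)]]] by simp
    also have "\<dots> = (Q * N) $$ (i,j)"
      unfolding N_def mat_diag_mult_right[OF Pc(2)] using ij by (simp add: Q_def)
    finally show "(A * P) $$ (i,j) = (Q * N) $$ (i,j)" .
  qed (use Ac Pc Nc in auto)
  define T where "T = (\<Sum>i<l. a' i)"
  have pair: "\<nu> i * \<nu> (?n - Suc i) = sg (a' i)" if "i < l" for i
  proof -
    have "\<nu> i * \<nu> (?n - Suc i) = tp (a' i) * (sg (a' i) * tp (- a' i))" using that by (simp only: \<nu>_def) auto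
    also have "\<dots> = sg (a' i) * (tp (a' i) * tp (- a' i))" by (simp only: mult_ac)
    finally show ?thesis unfolding tp_tp by simp
  qed
  have "det N = (\<Prod>i<l. sg (a' i))" unfolding N_def det_mat_diag prod_pairs by (intro prod.cong refl pair) simp
  also have "\<dots> = sg T"
  proof -
    have "(\<Prod>i<k. sg (a' i)) = sg (\<Sum>i<k. a' i)" for k
      by (induction k) (simp_all add: sg_add sg_def[of 0])
    then show ?thesis by (simp add: T_def)
  qed
  finally have detN: "det N = sg T" .
  \<comment> \<open>At t = 0 a unitary matrix over \<complex>[[t]] becomes symplectic, hence has
    determinant 1 there.\<close>
  have det0: "fls_nth (det M) 0 = 1" if "M \<in> mats ?n ring_O" "lp.unitary l M" for M
    using det_symplectic[OF RO.unitary_c0[OF that]] RO.c0_det[OF that(1)] by simp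
  have detPQ: "det P = det Q * sg T"
    using arg_cong[OF AP, of det] det_mult[OF Ac Pc(1)] det_mult[OF Pc(2) Nc] detA detN by simp
  \<comment> \<open>Comparing constant terms in det P = det Q (-1)^T leaves (-1)^T = 1. This is the
    parity required of a dominant weight.\<close>
  have evT: "even T"
  proof -
    have "fls_nth (det P) 0 = fls_nth (det Q) 0 * fls_nth (sg T) 0"
      unfolding detPQ by (intro RO.coeff0_mult sg_O RO.det_closed[OF PO(2)])
    then have "(-1 :: complex) powi T = 1" using det0 PO PU by (simp add: sg_def)
    then show ?thesis by (cases "even T") (simp_all add: power_int_minus_left)
  qed
  have sgT: "sg T = 1" using evT by (simp add: sg_def power_int_minus_left)
  define f where "f = det P"
  have f: "det Q = f" "f \<in> ring_O" "fls_nth f 0 = 1" "f * bar f = 1"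
    using detPQ sgT det0 PO PU RO.det_closed[OF PO(1)] lp.det_unitary[OF PU(1)] by (auto simp: f_def simp del: image_iff)
  have fnz: "f \<noteq> 0" using f(3) by auto
  have fi: "inverse f \<in> ring_O" "fls_nth (inverse f) 0 = 1" using O_inverse[OF f(2)] f(3) by auto
  \<comment> \<open>P and Q share the determinant f. Scaling the first and the last vector of both
    frames by r, with r^2 = 1/f, brings it to 1; since r \<open>bar r\<close> = 1 the form is
    preserved, and the diagonal scaling commutes with \<open>N\<close>.\<close>
  obtain r where r: "r \<in> ring_O" "fls_nth r 0 = 1" "r * r = inverse f" by (rule O_sqrt[OF fi])
  have rr: "r * bar r = 1"
  proof -
    have bO: "bar r \<in> ring_O" using r(1) by (rule RO.bar_closed)
    have "(r * bar r) * (r * bar r) = (r * r) * bar (r * r)" by (simp only: lp.cj_mult mult_ac)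
    also have "\<dots> = inverse (f * bar f)" unfolding r(3) by (simp add: lp.cj_inverse)
    finally have sq: "(r * bar r) * (r * bar r) = 1 * 1" using f(4) by simp
    then have "r * bar r = 1 \<or> r * bar r = - 1" by (rule square_eq_iff[THEN iffD1])
    moreover have "fls_nth (r * bar r) 0 = 1" using RO.coeff0_mult[OF r(1) bO] r(2) by (simp add: bar_nth_0)
    ultimately show ?thesis by auto
  qed
  define \<delta> where "\<delta> i = (if i = 0 \<or> i = ?n - 1 then r else 1)" for i
  define D where "D = mat_diag ?n \<delta>"
  have Dc: "D \<in> carrier_mat ?n ?n" by (simp add: D_def)
  have \<delta>f: "\<delta> (?n - Suc i) = \<delta> i" if "i < ?n" for i using that by (auto simp: \<delta>_def)
  have DU: "lp.unitary l D" unfolding D_def by (rule unitary_mat_diag) (auto simp: \<delta>f, auto simp: \<delta>_def rr)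
  have DO: "D \<in> mats ?n ring_O" unfolding mats_def D_def
    using r(1) by (auto simp: mat_diag_index \<delta>_def simp del: image_iff)
  have detD: "det D = inverse f"
  proof -
    have "(\<Prod>i<l. \<delta> i * \<delta> (?n - Suc i)) = (\<Prod>i<l. if i = 0 then r * r else 1)"
      using l by (intro prod.cong) (auto simp: \<delta>f, auto simp: \<delta>_def)
    also have "\<dots> = r * r" using l by simp
    finally show ?thesis unfolding D_def det_mat_diag prod_pairs r(3) .
  qed
  have tw: "M * D \<in> twisted l ring_O" if "M \<in> mats ?n ring_O" "lp.unitary l M" "det M = f" for M
  proof -
    have "det (M * D) = det M * det D" using that Dc by (intro det_mult[of _ ?n]) auto
    then show ?thesis using that DO DU fnz
      by (auto simp: twisted_iff SL_iff RO.mats_mult lp.unitary_mult detD)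
  qed
  have PD: "P * D \<in> twisted l ring_O" and QD: "Q * D \<in> twisted l ring_O"
    using tw PO PU f by (auto simp: f_def[symmetric])
  define a where "a i = (if i < l then a' i else 0)" for i
  \<comment> \<open>A cocharacter in the given class: the weights in the first half, with T/2
    removed at both ends. This makes the total zero and leaves the differences b_i - b_(2l-1-i)
    unchanged.\<close>
  define b where "b i = (if i < l then a' i else 0) - (if i = 0 \<or> i = ?n - 1 then T div 2 else 0)" for i
  have ba: "b i - b (?n - Suc i) = a' i" if "i < l" for i
    using that l by (auto simp: b_def)
  have bc: "b \<in> cochars l"
  proof -
    have "(\<Sum>i<?n. b i) = (\<Sum>i<?n. if i < l then a' i else 0) - (\<Sum>i<?n. if i = 0 \<or> i = ?n - 1 then T div 2 else 0)"
      by (simp add: b_def sum_subtractf)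
    also have "(\<Sum>i<?n. if i < l then a' i else 0) = T"
      unfolding T_def by (rule sum.mono_neutral_cong_right) auto
    also have "(\<Sum>i<?n. if i = 0 \<or> i = ?n - 1 then T div 2 else 0) = (\<Sum>i\<in>{0, ?n - 1}. T div 2)"
      using l by (intro sum.mono_neutral_cong_right) auto
    also have "\<dots> = T" using l evT by simp
    finally show ?thesis by (simp add: cochars_def)
  qed
  have coinv: "coinv_class l b = a" by (rule ext) (simp add: coinv_class_def a_def ba)
  \<comment> \<open>\<open>N\<close> and \<open>n_elt l b\<close> have the same exponents and differ
    only in signs. These are symmetric under reversal of the indices, so their diagonal matrix
    \<open>E\<close> lies in the stabiliser of the base point.\<close>
  define \<epsilon> where "\<epsilon> i = (if i < l then sg (b (?n - Suc i)) else sg (b i))" for i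
  define E where "E = mat_diag ?n \<epsilon>"
  have \<epsilon>f: "\<epsilon> (?n - Suc i) = \<epsilon> i" if "i < ?n" for i
  proof -
    have "?n - Suc i < l \<longleftrightarrow> \<not> i < l" "?n - Suc (?n - Suc i) = i" using that by auto
    then show ?thesis by (simp add: \<epsilon>_def)
  qed
  have \<epsilon>1: "\<epsilon> i * \<epsilon> i = 1" "bar (\<epsilon> i) = \<epsilon> i" for i by (simp_all add: \<epsilon>_def)
  have EU: "lp.unitary l E" unfolding E_def by (rule unitary_mat_diag) (auto simp: \<epsilon>f \<epsilon>1)
  have EO: "E \<in> mats ?n ring_O" unfolding mats_def E_def
    by (auto simp: mat_diag_index \<epsilon>_def simp del: image_iff)
  have detE: "det E = 1" unfolding E_def det_mat_diag prod_pairs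
    by (rule prod.neutral) (auto simp: \<epsilon>f \<epsilon>1)
  have ET: "E \<in> twisted l ring_O" using EU EO detE by (simp add: twisted_iff SL_iff)
  have Ec: "E \<in> carrier_mat ?n ?n" by (simp add: E_def)
  have NE: "N = n_elt l b * E"
  proof -
    have "\<nu> i = sg (b (?n - Suc i)) * tp (b i - b (?n - Suc i)) * \<epsilon> i" if i: "i < ?n" for i
    proof (cases "i < l")
      case True
      have "sg (b (?n - Suc i)) * tp (b i - b (?n - Suc i)) * \<epsilon> i = (sg (b (?n - Suc i)) * sg (b (?n - Suc i))) * tp (a' i)"
        using True unfolding ba[OF True] by (simp only: \<epsilon>_def if_True mult_ac)
      then show ?thesis using True by (simp add: \<nu>_def)
    next
      case False
      let ?i = "?n - Suc i"
      have i': "?i < l" "?n - Suc ?i = i" using False i by auto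
      have d: "b ?i - b i = a' ?i" using ba[OF i'(1)] unfolding i'(2) .
      have "sg (b ?i) * tp (b i - b ?i) * \<epsilon> i = (sg (b ?i) * sg (b i)) * tp (- (b ?i - b i))"
        using False by (simp only: \<epsilon>_def if_False mult_ac minus_diff_eq)
      also have "\<dots> = sg (a' ?i) * tp (- a' ?i)" unfolding sg_diff[symmetric] d ..
      finally show ?thesis using False by (simp only: \<nu>_def if_False)
    qed
    then show ?thesis unfolding N_def n_elt_eq E_def mat_diag_diag
      by (auto simp: mat_diag_def intro!: eq_matI)
  qed
  define K where "K = E * lp.adj l (P * D)"
  have KT: "K \<in> twisted l ring_O" unfolding K_def by (intro RO.twisted_mult ET RO.twisted_adj PD)
  have nc: "n_elt l b \<in> carrier_mat ?n ?n" unfolding n_elt_eq by simp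
  have PDc: "P * D \<in> carrier_mat ?n ?n" "Q * D \<in> carrier_mat ?n ?n" using Pc Dc by auto
  note assoc = assoc_mult_mat[of _ ?n ?n _ ?n _ ?n]
  have AK: "A = (Q * D * n_elt l b) * K"
  proof -
    have DN: "N * D = D * N" unfolding N_def D_def mat_diag_diag by (simp only: mult.commute)
    have "A * (P * D) = A * P * D" using Ac Pc Dc by (simp add: assoc)
    also have "\<dots> = Q * (N * D)" unfolding AP using Pc Dc Nc by (simp add: assoc)
    also have "\<dots> = Q * D * N" unfolding DN using Pc Dc Nc by (intro assoc[symmetric]) auto
    also have "\<dots> = Q * D * (n_elt l b * E)" by (simp only: NE[symmetric])
    finally have 1: "A * (P * D) = Q * D * (n_elt l b * E)" .
    have PDu: "lp.unitary l (P * D)" using PD by (simp add: twisted_iff)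
    have "A = A * (P * D * lp.adj l (P * D))" using PDu Ac by (simp add: lp.unitary_def)
    also have "\<dots> = A * (P * D) * lp.adj l (P * D)" using Ac PDc by (intro assoc[symmetric]) auto
    also have "\<dots> = (Q * D * n_elt l b * E) * lp.adj l (P * D)" unfolding 1
      using PDc nc Ec by (subst assoc[of "Q * D" "n_elt l b" E]) auto
    also have "\<dots> = (Q * D * n_elt l b) * K" unfolding K_def
      using PDc nc Ec by (intro assoc) (auto intro!: mult_carrier_mat[of _ ?n ?n])
    finally show ?thesis .
  qed
  have orbit: "gr_pt l A \<in> gr_orbit l a"
  proof -
    have "gr_pt l A = gr_pt l (Q * D * n_elt l b)" unfolding AK
      by (rule gr_pt_absorb[OF _ KT]) (use PDc nc in \<open>auto intro!: mult_carrier_mat[of _ ?n ?n]\<close>)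
    then show ?thesis unfolding gr_orbit_def using QD bc coinv by blast
  qed
  \<comment> \<open>\<open>N\<close> arises from A by integral matrices on both sides, so by
    \<open>double_pole_coeff\<close> it inherits the bound 2 on the pole and the product form of the
    coefficient of t^-2.\<close>
  have Nij: "N $$ (i,j) = (\<Sum>p<?n. \<Sum>q<?n. lp.adj l Q $$ (i,p) * A $$ (p,q) * P $$ (q,j))" if ij: "i < ?n" "j < ?n" for i j
  proof -
    have "N = lp.adj l Q * Q * N" using lp.unitary_adj_left[OF PU(2)] Nc by simp
    also have "\<dots> = lp.adj l Q * (A * P)" unfolding AP using Pc Nc by (intro assoc) auto
    finally have "N $$ (i,j) = (lp.adj l Q * (A * P)) $$ (i,j)" by simp
    also have "\<dots> = (\<Sum>p<?n. lp.adj l Q $$ (i,p) * (A * P) $$ (p,j))"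
      by (rule times_mat_index[OF _ mult_carrier_mat[OF Ac Pc(1)] ij]) simp
    also have "\<dots> = (\<Sum>p<?n. \<Sum>q<?n. lp.adj l Q $$ (i,p) * A $$ (p,q) * P $$ (q,j))"
      by (intro sum.cong refl) (simp add: times_mat_index[OF Ac Pc(1) _ ij(2)] sum_distrib_left mult.assoc del: index_mult_mat(1))
    finally show ?thesis .
  qed
  have A2: "tp 2 * A $$ (p,q) \<in> ring_O" if "p < ?n" "q < ?n" for p q
    unfolding ring_O_iff tp_nth A_def using that by (auto simp: quad_loop_nth)
  have aQ: "lp.adj l Q $$ (i,p) \<in> ring_O" "P $$ (i,p) \<in> ring_O" if "i < ?n" "p < ?n" for i p
    using RO.mats_adj[OF PO(2)] PO(1) that by (auto simp: mats_def simp del: image_iff)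
  have N3: "fls_nth (N $$ (i,j)) (- int k) = 0" if "i < ?n" "j < ?n" "k \<ge> 3" for i j k
    unfolding Nij[OF that(1,2)] fls_nth_sum
    by (intro sum.neutral ballI double_pole_coeff(2) aQ A2 that) auto
  have a0: "a' 0 \<le> 2"
  proof (rule ccontr)
    assume "\<not> a' 0 \<le> 2"
    then have k: "nat (a' 0) \<ge> 3" "int (nat (a' 0)) = a' 0" by auto
    have "N $$ (?n - 1, ?n - 1) = sg (a' 0) * tp (- a' 0)"
      using l unfolding N_def by (subst mat_diag_index) (auto simp: \<nu>_def)
    then have "fls_nth (sg (a' 0) * tp (- a' 0)) (- a' 0) = 0"
      using N3[of "?n - 1" "?n - 1" "nat (a' 0)"] k l by simp
    then show False unfolding tp_nth by (simp add: sg_def)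
  qed
  \<comment> \<open>Otherwise the two leading weights are both 2, and the coefficient of t^-2 of
    \<open>N\<close> has two nonzero diagonal entries with a zero next to them, which is impossible
    for a product U_i W_j.\<close>
  have a1: "a' 1 \<le> 1"
  proof (rule ccontr)
    assume "\<not> a' 1 \<le> 1"
    then have a2: "a' 1 = 2" "a' 0 = 2" using a0 dec[of 0 1] l by auto
    from small_pairD(4)[OF gd] obtain u w where uw: "\<And>p q. p < ?n \<Longrightarrow> q < ?n \<Longrightarrow> y $$ (p,q) = u p * w q"
      unfolding outer_def by blast
    define U where "U i = (\<Sum>p<?n. fls_nth (lp.adj l Q $$ (i,p)) 0 * u p)" for i
    define W where "W j = (\<Sum>q<?n. w q * fls_nth (P $$ (q,j)) 0)" for j
    have N2: "fls_nth (N $$ (i,j)) (-2) = U i * W j" if ij: "i < ?n" "j < ?n" for i j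
    proof -
      have "fls_nth (N $$ (i,j)) (-2) = (\<Sum>p<?n. \<Sum>q<?n. fls_nth (lp.adj l Q $$ (i,p) * A $$ (p,q) * P $$ (q,j)) (-2))"
        unfolding Nij[OF ij] fls_nth_sum ..
      also have "\<dots> = (\<Sum>p<?n. \<Sum>q<?n. (fls_nth (lp.adj l Q $$ (i,p)) 0 * u p) * (w q * fls_nth (P $$ (q,j)) 0))"
      proof (intro sum.cong refl)
        fix p q assume "p \<in> {..<?n}" "q \<in> {..<?n}"
        then have pq: "p < ?n" "q < ?n" by auto
        have "fls_nth (lp.adj l Q $$ (i,p) * A $$ (p,q) * P $$ (q,j)) (-2) =
            fls_nth (lp.adj l Q $$ (i,p)) 0 * fls_nth (A $$ (p,q)) (-2) * fls_nth (P $$ (q,j)) 0"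
          by (intro double_pole_coeff(1) aQ A2 pq ij)
        also have "fls_nth (A $$ (p,q)) (-2) = u p * w q" unfolding A_def using pq by (simp add: quad_loop_nth uw)
        finally show "fls_nth (lp.adj l Q $$ (i,p) * A $$ (p,q) * P $$ (q,j)) (-2) =
            (fls_nth (lp.adj l Q $$ (i,p)) 0 * u p) * (w q * fls_nth (P $$ (q,j)) 0)" by (simp only: mult_ac)
      qed
      also have "\<dots> = U i * W j" unfolding U_def W_def sum_product ..
      finally show ?thesis .
    qed
    have diag: "fls_nth (N $$ (?n - Suc i, ?n - Suc i)) (-2) \<noteq> 0" if "i = 0 \<or> i = 1" for i
    proof -
      have "N $$ (?n - Suc i, ?n - Suc i) = sg 2 * tp (-2)"
        using l that a2 unfolding N_def by (subst mat_diag_index) (auto simp: \<nu>_def)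
      then have "fls_nth (N $$ (?n - Suc i, ?n - Suc i)) (-2) = fls_nth (sg 2) 0" by (simp only: tp_nth) simp
      then show ?thesis by (simp add: sg_def)
    qed
    have "N $$ (?n - Suc 0, ?n - Suc 1) = 0"
      using l unfolding N_def by (subst mat_diag_index) auto
    then have "U (?n - Suc 0) * W (?n - Suc 1) = 0" using N2[of "?n - Suc 0" "?n - Suc 1"] l by simp
    moreover have "U (?n - Suc 0) \<noteq> 0" "W (?n - Suc 1) \<noteq> 0"
      using diag[of 0] diag[of 1] N2[of "?n - Suc 0" "?n - Suc 0"] N2[of "?n - Suc 1" "?n - Suc 1"] l by auto
    ultimately show False by simp
  qed
  have "dominant l a"
    unfolding dominant_def using evT dec rel(3) by (auto simp: a_def T_def)
  then have "small_wt l a" using a0 a1 l small_wt_iff[OF l] by (simp add: a_def)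
  moreover have "gr_pt l A \<in> gr_minus l" using Acm by (auto simp: gr_minus_eq)
  ultimately show ?thesis using orbit by (auto simp: M_small_def M_cell_def A_def)
qed

lemma M_small_eq: "l \<ge> 2 \<Longrightarrow> M_small l = {gr_pt l (quad_loop l x y) | x y. small_pair l x y}"
  using M_small_imp_small_pair small_pair_imp_M_small by blast

section \<open>The fibres of \<open>\<pi>\<close>\<close>

lemma gr_rep_quad_loop: "small_pair l x y \<Longrightarrow> gr_rep l (gr_pt l (quad_loop l x y)) = quad_loop l x y"
  by (rule gr_rep_gr_pt[OF quad_loop_small_pair])

lemma pi_map_quad_loop:
  assumes "small_pair l x y" shows "pi_map l (gr_pt l (quad_loop l x y)) = x"
  using cf_quad_loop[OF small_pairD(1,2)[OF assms], of 1] by (simp add: pi_map_def gr_rep_quad_loop[OF assms])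

lemma pi_fiber_eq:
  assumes "l \<ge> 2" shows "pi_fiber l x = {gr_pt l (quad_loop l x y) | y. small_pair l x y}"
  unfolding pi_fiber_def M_small_eq[OF assms] using pi_map_quad_loop by auto

text \<open>On a fibre only the coefficient of t^-2 varies, every other coordinate being constant,
  and the passage between y and z = y - x^2/2 is a translation. So both directions are polynomial in
  the coordinates.\<close>

lemma fiber_isomorphic:
  assumes l: "l \<ge> 2" and x: "x \<in> pi_map l ` M_small l"
  shows "variety_isomorphic (gr_coords l) (pi_fiber l x) (mat_coords (2*l)) (fiber_model l x)"
proof -
  let ?n = "2*l"
  from x obtain y0 where y0: "small_pair l x y0" unfolding M_small_eq[OF l] using pi_map_quad_loop by auto
  have xc: "x \<in> carrier_mat ?n ?n" and xa: "cx.adj l x = x" using small_pairD[OF y0] by auto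
  have x4: "(x * x) * (x * x) = 0\<^sub>m ?n ?n" by (rule small_pair_fourth_power[OF y0])
  define s where "s = x * x"
  have sc: "s \<in> carrier_mat ?n ?n" unfolding s_def by (rule mult_carrier_mat[OF xc xc])
  define \<phi> where "\<phi> p = cf 2 (gr_rep l p) + (- (1/2)) \<cdot>\<^sub>m s" for p
  define \<psi> where "\<psi> z = gr_pt l (quad_loop l x (z + (1/2) \<cdot>\<^sub>m s))" for z
  have phi: "\<phi> (gr_pt l (quad_loop l x y)) = y + (- (1/2)) \<cdot>\<^sub>m s" if "small_pair l x y" for y
    unfolding \<phi>_def gr_rep_quad_loop[OF that] by (subst cf_quad_loop[OF small_pairD(1,2)[OF that]]) simp
  have gz: "small_pair l x (z + (1/2) \<cdot>\<^sub>m s)" if "z \<in> fiber_model l x" for z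
    unfolding s_def by (rule fiber_model_imp_small_pair[OF xc xa x4 that])
  have zc: "z \<in> carrier_mat ?n ?n" if "z \<in> fiber_model l x" for z
    using that by (auto simp: fiber_model_def sp_def sl_def)
  have c1: "y + (- (1/2)) \<cdot>\<^sub>m s + (1/2) \<cdot>\<^sub>m s = y" "y + (1/2) \<cdot>\<^sub>m s + (- (1/2)) \<cdot>\<^sub>m s = y"
    if "y \<in> carrier_mat ?n ?n" for y
    using that sc by (auto intro!: eq_matI)
  show ?thesis
  proof (rule variety_isomorphicI[of _ \<phi> _ \<psi>])
    fix p assume "p \<in> pi_fiber l x"
    then obtain y where y: "small_pair l x y" "p = gr_pt l (quad_loop l x y)" unfolding pi_fiber_eq[OF l] by blast
    show "\<phi> p \<in> fiber_model l x" unfolding y(2) phi[OF y(1)] s_def by (rule small_pair_imp_fiber_model[OF y(1)])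
    show "\<psi> (\<phi> p) = p" unfolding y(2) phi[OF y(1)] \<psi>_def c1(1)[OF small_pairD(2)[OF y(1)]] ..
  next
    fix z assume z: "z \<in> fiber_model l x"
    show "\<psi> z \<in> pi_fiber l x" unfolding pi_fiber_eq[OF l] \<psi>_def using gz[OF z] by blast
    show "\<phi> (\<psi> z) = z" unfolding \<psi>_def phi[OF gz[OF z]] by (rule c1(2)[OF zc[OF z]])
  next
    fix d assume "d \<in> mat_coords ?n"
    then obtain i j where ij: "i < ?n" "j < ?n" and d: "d = (\<lambda>A. A $$ (i,j))" by (auto simp: mat_coords_def)
    let ?c = "\<lambda>p. fls_nth (gr_rep l p $$ (i,j)) (- int 2)"
    have "?c \<in> gr_coords l" unfolding gr_coords_def using ij by blast
    then have "(\<lambda>p. ?c p + (- (1/2)) * s $$ (i,j)) \<in> polyfun (gr_coords l)"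
      by (intro polyfun.add polyfun.coord polyfun.const)
    moreover have "?c p + (- (1/2)) * s $$ (i,j) = d (\<phi> p)" if p: "p \<in> pi_fiber l x" for p
    proof -
      obtain y where y: "small_pair l x y" "p = gr_pt l (quad_loop l x y)" using p unfolding pi_fiber_eq[OF l] by blast
      show ?thesis unfolding y(2) d phi[OF y(1)] gr_rep_quad_loop[OF y(1)]
        using ij sc small_pairD(2)[OF y(1)] by (simp add: quad_loop_nth)
    qed
    ultimately show "\<exists>q\<in>polyfun (gr_coords l). \<forall>p\<in>pi_fiber l x. q p = d (\<phi> p)"
      by (intro bexI[rotated] ballI)
  next
    fix c assume "c \<in> gr_coords l"
    then obtain i j k where ij: "i < ?n" "j < ?n" and c: "c = (\<lambda>p. fls_nth (gr_rep l p $$ (i,j)) (- int k))"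
      by (auto simp: gr_coords_def)
    have "(\<lambda>A. A $$ (i,j)) \<in> mat_coords ?n" using ij by (auto simp: mat_coords_def)
    then have q: "(\<lambda>z. z $$ (i,j) + (1/2) * s $$ (i,j)) \<in> polyfun (mat_coords ?n)"
      by (intro polyfun.add polyfun.coord polyfun.const)
    have val: "c (\<psi> z) = (if k = 2 then z $$ (i,j) + (1/2) * s $$ (i,j) else
        if k = 0 then (if i = j then 1 else 0) else if k = 1 then x $$ (i,j) else 0)" if z: "z \<in> fiber_model l x" for z
    proof -
      have "- int k = - 2 \<longleftrightarrow> k = 2" "- int k = - 1 \<longleftrightarrow> k = 1" by auto
      then show ?thesis unfolding c \<psi>_def gr_rep_quad_loop[OF gz[OF z]] quad_loop_nth[OF ij]
        using ij sc zc[OF z] by simp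
    qed
    show "\<exists>q\<in>polyfun (mat_coords ?n). \<forall>z\<in>fiber_model l x. q z = c (\<psi> z)"
    proof (cases "k = 2")
      case True
      then show ?thesis by (intro bexI[OF _ q] ballI) (simp add: val)
    next
      case False
      then show ?thesis by (intro bexI[OF _ polyfun.const[of "if k = 0 then if i = j then 1 else 0 else if k = 1 then x $$ (i,j) else 0"]] ballI)
        (simp add: val)
    qed
  qed
qed

section \<open>The minimal nilpotent orbit\<close>

text \<open>The matrix \<open>v v\<^sup>T J\<close>, which sends w to \<open>herm v w\<close> times
  v (see \<open>sym_square_apply\<close>); only the first 2l values of v enter.\<close>

definition sym_square :: "nat \<Rightarrow> (nat \<Rightarrow> complex) \<Rightarrow> complex mat" where
  "sym_square l v = mat (2*l) (2*l) (\<lambda>(i,j). v i * ((-1)^(2*l - Suc j) * v (2*l - Suc j)))"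

lemma sym_square_carrier [simp]: "sym_square l v \<in> carrier_mat (2*l) (2*l)"
  by (simp add: sym_square_def)

lemma sym_square_index:
  "i < 2*l \<Longrightarrow> j < 2*l \<Longrightarrow> sym_square l v $$ (i,j) = v i * ((-1)^(2*l - Suc j) * v (2*l - Suc j))"
  by (simp add: sym_square_def)

lemma outer_sym_square: "outer (2*l) (sym_square l v)"
  unfolding outer_def by (intro exI[of _ v] exI[of _ "\<lambda>j. (-1)^(2*l - Suc j) * v (2*l - Suc j)"]) (simp add: sym_square_index)

lemma adj_sym_square: "cx.adj l (sym_square l v) = - sym_square l v"
proof (rule eq_matI)
  fix i j assume "i < dim_row (- sym_square l v)" "j < dim_col (- sym_square l v)"
  then have ij: "i < 2*l" "j < 2*l" by (auto simp: sym_square_def)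
  then have k: "2*l - Suc i < 2*l" "2*l - Suc j < 2*l" "2*l - Suc (2*l - Suc i) = i" by auto
  have "cx.adj l (sym_square l v) $$ (i,j) = (-1)^i * (-1)^j * (v (2*l - Suc j) * ((-1)^i * v i))"
    using ij k by (simp add: cx.adj_index sym_square_index)
  also have "\<dots> = ((-1)^i * (-1)^i) * (v i * ((-1)^j * v (2*l - Suc j)))" by (simp only: mult_ac)
  also have "\<dots> = (- sym_square l v) $$ (i,j)"
    using ij cx.sign_flip[of j l] by (simp add: sym_square_index carrier_matD[OF sym_square_carrier])
  finally show "cx.adj l (sym_square l v) $$ (i,j) = (- sym_square l v) $$ (i,j)" .
qed (auto simp: sym_square_def)

text \<open>The sum in the middle of the product is the pairing of v with itself, which is zero
  because reversing the order of summation changes its sign.\<close>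

lemma sym_square_square: "sym_square l v * sym_square l v = 0\<^sub>m (2*l) (2*l)"
proof (rule eq_matI)
  let ?n = "2*l"
  fix i j assume "i < dim_row (0\<^sub>m ?n ?n :: complex mat)" "j < dim_col (0\<^sub>m ?n ?n :: complex mat)"
  then have ij: "i < ?n" "j < ?n" by auto
  let ?S = "\<Sum>p<?n. (-1)^(?n - Suc p) * v (?n - Suc p) * v p"
  have "?S = (\<Sum>p<?n. (-1)^(?n - Suc (?n - Suc p)) * v (?n - Suc (?n - Suc p)) * v (?n - Suc p))"
    by (subst sum.nat_diff_reindex[symmetric]) simp
  also have "\<dots> = (\<Sum>p<?n. - ((-1)^(?n - Suc p) * v (?n - Suc p) * v p))"
  proof (intro sum.cong refl)
    fix p assume "p \<in> {..<?n}"
    then have p: "p < ?n" "?n - Suc (?n - Suc p) = p" by auto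
    show "(-1)^(?n - Suc (?n - Suc p)) * v (?n - Suc (?n - Suc p)) * v (?n - Suc p) = - ((-1)^(?n - Suc p) * v (?n - Suc p) * v p)"
      unfolding p(2) cx.sign_flip[OF p(1)] by simp
  qed
  finally have S: "?S = 0" by (simp add: sum_negf)
  have "(sym_square l v * sym_square l v) $$ (i,j) = (\<Sum>p<?n. sym_square l v $$ (i,p) * sym_square l v $$ (p,j))"
    by (rule times_mat_index[OF _ _ ij]) simp_all
  also have "\<dots> = v i * ?S * ((-1)^(?n - Suc j) * v (?n - Suc j))"
    unfolding sum_distrib_left sum_distrib_right using ij by (intro sum.cong refl) (simp add: sym_square_index mult.assoc)
  finally show "(sym_square l v * sym_square l v) $$ (i,j) = 0\<^sub>m ?n ?n $$ (i,j)" unfolding S using ij by simp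
qed (auto simp: sym_square_def)

lemma small_pair_sym_square: "small_pair l (0\<^sub>m (2*l) (2*l)) (sym_square l v)"
proof -
  let ?n = "2*l" let ?Z = "0\<^sub>m ?n ?n :: complex mat"
  have a0: "cx.adj l ?Z = ?Z" by (rule eq_matI) (auto simp: cx.adj_index)
  have 1: "sym_square l v + cx.adj l (sym_square l v) = ?Z"
    unfolding adj_sym_square by (rule eq_matI) (auto simp: sym_square_def)
  have 2: "sym_square l v * cx.adj l (sym_square l v) = ?Z"
  proof -
    have "sym_square l v * cx.adj l (sym_square l v) = - (sym_square l v * sym_square l v)"
      unfolding adj_sym_square by (rule uminus_mult_right_mat) (simp add: sym_square_def)
    also have "\<dots> = - ?Z" by (simp only: sym_square_square)
    also have "\<dots> = ?Z" by (rule eq_matI) auto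
    finally show ?thesis .
  qed
  have 3: "?Z * cx.adj l (sym_square l v) = sym_square l v * ?Z"
    unfolding left_mult_zero_mat[OF cx.adj_carrier]
      right_mult_zero_mat[OF sym_square_carrier] ..
  have 4: "?Z = ?Z * ?Z" by simp
  show ?thesis unfolding small_pair_def
    by (intro conjI zero_carrier_mat sym_square_carrier a0 2 3 outer_sym_square trans[OF 1 4])
qed

text \<open>Write z = u w^T = u q^T J. Skewness under the adjoint says that u q^T is symmetric, so q
  is a multiple of u; a complex square root of the factor is absorbed into the vector.\<close>

lemma skew_outer_eq_sym_square:
  assumes z: "z \<in> carrier_mat (2*l) (2*l)" "cx.adj l z = - z" and o: "outer (2*l) z"
  shows "\<exists>v. z = sym_square l v"
proof -
  let ?n = "2*l"
  from o obtain u w where uw: "\<And>i j. i < ?n \<Longrightarrow> j < ?n \<Longrightarrow> z $$ (i,j) = u i * w j" by (auto simp: outer_def)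
  define q where "q k = (-1)^k * w (?n - Suc k)" for k
  have wq: "w j = (-1)^(?n - Suc j) * q (?n - Suc j)" if "j < ?n" for j
  proof -
    have "?n - Suc (?n - Suc j) = j" using that by auto
    then show ?thesis by (simp add: q_def)
  qed
  have sym: "u a * q i = u i * q a" if ai: "a < ?n" "i < ?n" for a i
  proof -
    have aa: "?n - Suc a < ?n" "?n - Suc (?n - Suc a) = a" "?n - Suc i < ?n" using ai by auto
    have "cx.adj l z $$ (i, ?n - Suc a) = (- z) $$ (i, ?n - Suc a)" by (simp only: z(2))
    then have "(-1)^i * (-1)^(?n - Suc a) * (u a * w (?n - Suc i)) = - (u i * w (?n - Suc a))"
      using ai aa carrier_matD[OF z(1)] by (simp add: cx.adj_index uw)
    moreover have "w (?n - Suc i) = (-1)^i * q i" "w (?n - Suc a) = (-1)^a * q a"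
      using wq[OF aa(3)] wq[OF aa(1)] aa(2) ai by auto
    ultimately have "(-1)^i * (- ((-1)^a)) * (u a * ((-1)^i * q i)) = - (u i * ((-1)^a * q a))"
      unfolding cx.sign_flip[OF ai(1)] by (simp only:)
    then have "((-1)^i * (-1)^i) * (((-1)^a * (-1)^a) * (u a * q i)) = ((-1)^a * (-1)^a) * (u i * q a)"
      by (metis (no_types, opaque_lifting) minus_mult_minus minus_mult_left minus_mult_right mult.assoc mult.commute neg_equal_iff_equal)
    then show ?thesis by simp
  qed
  show ?thesis
  proof (cases "\<forall>i<?n. u i = 0")
    case True
    then have "z = sym_square l (\<lambda>_. 0)"
      using z(1) by (intro eq_matI) (auto simp: sym_square_def uw)
    then show ?thesis by blast
  next
    case False
    then obtain k where k: "k < ?n" "u k \<noteq> 0" by auto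
    define c where "c = csqrt (q k / u k)"
    have cc: "c * c = q k / u k" by (simp add: c_def flip: power2_eq_square)
    have qi: "q i = (c * c) * u i" if "i < ?n" for i
      using sym[OF k(1) that] k by (simp add: cc field_simps)
    have "z = sym_square l (\<lambda>i. c * u i)"
    proof (rule eq_matI)
      fix i j assume "i < dim_row (sym_square l (\<lambda>i. c * u i))" "j < dim_col (sym_square l (\<lambda>i. c * u i))"
      then have ij: "i < ?n" "j < ?n" "?n - Suc j < ?n" by (auto simp: sym_square_def)
      show "z $$ (i,j) = sym_square l (\<lambda>i. c * u i) $$ (i,j)"
        unfolding uw[OF ij(1,2)] wq[OF ij(2)] qi[OF ij(3)] sym_square_index[OF ij(1,2)] by (simp only: mult_ac)
    qed (use z in \<open>auto simp: sym_square_def\<close>)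
    then show ?thesis by blast
  qed
qed

lemma fiber_model_0: "fiber_model l (0\<^sub>m (2*l) (2*l)) = range (sym_square l)"
proof
  let ?n = "2*l" let ?Z = "0\<^sub>m ?n ?n :: complex mat"
  have ZZ: "?Z * ?Z = ?Z" by simp
  have h: "M + c \<cdot>\<^sub>m ?Z = M" if "M \<in> carrier_mat ?n ?n" for M c
    using that by (intro eq_matI) auto
  show "fiber_model l ?Z \<subseteq> range (sym_square l)"
  proof
    fix z assume z: "z \<in> fiber_model l ?Z"
    then have zc: "z \<in> carrier_mat ?n ?n" "cx.adj l z = - z" by (auto simp: fiber_model_def sp_iff_adj sl_def)
    have "vec_space.rank ?n (z + (1/2) \<cdot>\<^sub>m (?Z * ?Z)) \<le> 1" using z unfolding fiber_model_def by blast
    then have "outer ?n z" unfolding ZZ h[OF zc(1)] rank_le_1_iff[OF zc(1)] .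
    then show "z \<in> range (sym_square l)" using skew_outer_eq_sym_square[OF zc] by blast
  qed
  show "range (sym_square l) \<subseteq> fiber_model l ?Z"
  proof
    fix z assume "z \<in> range (sym_square l)"
    then obtain v where v: "z = sym_square l v" by blast
    show "z \<in> fiber_model l ?Z"
      using small_pair_imp_fiber_model[OF small_pair_sym_square[of l v]] unfolding ZZ h[OF sym_square_carrier] v .
  qed
qed

lemma sym_square_sp: "sym_square l v \<in> sp l"
  using fiber_model_0[of l] by (auto simp: fiber_model_def)

lemma sym_square_apply:
  assumes w: "w \<in> carrier_vec (2*l)"
  shows "sym_square l v *\<^sub>v w = cx.herm l (vec (2*l) v) w \<cdot>\<^sub>v vec (2*l) v"
proof (rule eq_vecI)
  let ?n = "2*l"
  fix i assume "i < dim_vec (cx.herm l (vec ?n v) w \<cdot>\<^sub>v vec ?n v)"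
  then have i: "i < ?n" by simp
  have "cx.herm l (vec ?n v) w = (\<Sum>j<?n. (-1)^(?n - Suc j) * v (?n - Suc j) * w $ j)"
    unfolding cx.herm_def by (subst sum.nat_diff_reindex[symmetric]) (auto intro!: sum.cong)
  then show "(sym_square l v *\<^sub>v w) $ i = (cx.herm l (vec ?n v) w \<cdot>\<^sub>v vec ?n v) $ i"
    unfolding mult_mat_vec_index[OF sym_square_carrier w i]
    using i by (simp add: sym_square_index sum_distrib_right) (intro sum.cong refl; simp add: sym_square_index)
qed (simp add: sym_square_def)

lemma mat_eqI_apply:
  assumes "A \<in> carrier_mat n m" "B \<in> carrier_mat n m"
    and "\<And>w. w \<in> carrier_vec m \<Longrightarrow> A *\<^sub>v w = B *\<^sub>v w"
  shows "A = (B :: complex mat)"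
proof (rule eq_matI)
  fix i j assume "i < dim_row B" "j < dim_col B"
  then have ij: "i < n" "j < m" using assms by auto
  have "(A *\<^sub>v unit_vec m j) $ i = (B *\<^sub>v unit_vec m j) $ i" by (simp add: assms(3))
  then show "A $$ (i,j) = B $$ (i,j)" using ij assms(1,2) by simp
qed (use assms in auto)

text \<open>As g preserves the form, applying the inverse of g to w before pairing with v is the
  same as pairing w with g v. Conjugation thus acts on the vector.\<close>

lemma conj_sym_square:
  assumes g: "cx.unitary l g"
  shows "g * sym_square l v * the (mat_inverse g) = sym_square l (\<lambda>i. (g *\<^sub>v vec (2*l) v) $ i)"
proof (rule mat_eqI_apply[of _ "2*l" "2*l"])
  let ?n = "2*l"
  have gc: "g \<in> carrier_mat ?n ?n" "cx.adj l g \<in> carrier_mat ?n ?n" using g by auto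
  have inv: "the (mat_inverse g) = cx.adj l g" by (rule cx.mat_inverse_unitary[OF g])
  have gy: "g * sym_square l v \<in> carrier_mat ?n ?n" using gc by (intro mult_carrier_mat[of _ ?n ?n]) auto
  show "g * sym_square l v * the (mat_inverse g) \<in> carrier_mat ?n ?n" unfolding inv by (rule mult_carrier_mat[OF gy gc(2)])
  show "sym_square l (\<lambda>i. (g *\<^sub>v vec ?n v) $ i) \<in> carrier_mat ?n ?n" by simp
  fix w :: "complex vec" assume w: "w \<in> carrier_vec ?n"
  have gw: "cx.adj l g *\<^sub>v w \<in> carrier_vec ?n" by (rule mult_mat_vec_carrier[OF gc(2) w])
  have gv: "g *\<^sub>v vec ?n v \<in> carrier_vec ?n" by (rule mult_mat_vec_carrier[OF gc(1)]) simp
  have e: "vec ?n (\<lambda>i. (g *\<^sub>v vec ?n v) $ i) = g *\<^sub>v vec ?n v"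
    by (rule eq_vecI) (simp_all only: carrier_vecD[OF gv] index_vec dim_vec)
  have "(g * sym_square l v * the (mat_inverse g)) *\<^sub>v w = g *\<^sub>v (sym_square l v *\<^sub>v (cx.adj l g *\<^sub>v w))"
    unfolding inv assoc_mult_mat_vec[OF gy gc(2) w] assoc_mult_mat_vec[OF gc(1) sym_square_carrier gw] ..
  also have "\<dots> = cx.herm l (vec ?n v) (cx.adj l g *\<^sub>v w) \<cdot>\<^sub>v (g *\<^sub>v vec ?n v)"
    unfolding sym_square_apply[OF gw] by (rule mult_mat_vec[OF gc(1)]) simp
  also have "cx.herm l (vec ?n v) (cx.adj l g *\<^sub>v w) = cx.herm l (g *\<^sub>v vec ?n v) w"
    by (rule cx.herm_adj[OF gc(1) _ w, symmetric]) simp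
  finally show "(g * sym_square l v * the (mat_inverse g)) *\<^sub>v w = sym_square l (\<lambda>i. (g *\<^sub>v vec ?n v) $ i) *\<^sub>v w"
    unfolding sym_square_apply[OF w] e .
qed

lemma sym_square_cong: "(\<And>i. i < 2*l \<Longrightarrow> v i = w i) \<Longrightarrow> sym_square l v = sym_square l w"
  by (rule eq_matI) (auto simp: sym_square_def)

lemma herm_nondegenerate:
  assumes v: "v \<in> carrier_vec (2*l)" "v \<noteq> 0\<^sub>v (2*l)"
  shows "\<exists>w\<in>carrier_vec (2*l). cx.herm l v w \<noteq> 0"
proof -
  obtain i where i: "i < 2*l" "v $ i \<noteq> 0"
  proof (rule ccontr)
    assume "\<not> thesis"
    then have "v $ i = 0" if "i < 2*l" for i using \<open>\<And>i. i < 2*l \<Longrightarrow> v $ i \<noteq> 0 \<Longrightarrow> thesis\<close> that by metis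
    then have "v = 0\<^sub>v (2*l)" using v(1) by (intro eq_vecI) auto
    then show False using v(2) by simp
  qed
  have j: "2*l - Suc i < 2*l" "2*l - Suc (2*l - Suc i) = i" using i by auto
  have "cx.herm l (unit_vec (2*l) (2*l - Suc i)) v \<noteq> 0"
    unfolding cx.herm_unit_left[OF j(1) v(1)] j(2) using i by simp
  then have "cx.herm l v (unit_vec (2*l) (2*l - Suc i)) \<noteq> 0" by (subst cx_herm_skew) simp
  then show ?thesis by (rule bexI) simp
qed

definition nonzero_squares :: "nat \<Rightarrow> complex mat set" where
  "nonzero_squares l = {sym_square l v | v. \<exists>i<2*l. v i \<noteq> 0}"

text \<open>Transvections carry any nonzero vector to any other. The index set for k = 0 is empty,
  so \<open>fixed_perp l 0\<close> is the whole space, and nondegeneracy supplies the vectors that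
  \<open>transvection_transitive\<close> asks for.\<close>

lemma adjoint_orbit_sym_square:
  assumes v: "\<exists>i<2*l. v i \<noteq> 0"
  shows "adjoint_orbit l (sym_square l v) = nonzero_squares l"
proof
  let ?n = "2*l"
  have vn: "vec ?n v \<in> carrier_vec ?n" "vec ?n v \<noteq> 0\<^sub>v ?n"
    using v by (auto simp: vec_eq_iff)
  show "adjoint_orbit l (sym_square l v) \<subseteq> nonzero_squares l"
  proof
    fix z assume "z \<in> adjoint_orbit l (sym_square l v)"
    then obtain g where g: "cx.unitary l g" "z = g * sym_square l v * the (mat_inverse g)"
      by (auto simp: adjoint_orbit_def Sp_iff)
    have gc: "g \<in> carrier_mat ?n ?n" using g by simp
    have "\<exists>i<?n. (g *\<^sub>v vec ?n v) $ i \<noteq> 0"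
    proof (rule ccontr)
      assume "\<not> (\<exists>i<?n. (g *\<^sub>v vec ?n v) $ i \<noteq> 0)"
      then have 0: "g *\<^sub>v vec ?n v = 0\<^sub>v ?n" using gc by (intro eq_vecI) auto
      obtain w where w: "w \<in> carrier_vec ?n" "cx.herm l (vec ?n v) w \<noteq> 0" using herm_nondegenerate[OF vn] by blast
      have "cx.herm l (vec ?n v) w = cx.herm l (0\<^sub>v ?n) (g *\<^sub>v w)"
        unfolding 0[symmetric] by (rule cx.unitary_herm[OF g(1) vn(1) w(1), symmetric])
      then show False using w(2) by (simp add: cx.herm_def)
    qed
    then show "z \<in> nonzero_squares l" unfolding g(2) conj_sym_square[OF g(1)] nonzero_squares_def by blast
  qed
  show "nonzero_squares l \<subseteq> adjoint_orbit l (sym_square l v)"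
  proof
    fix z assume "z \<in> nonzero_squares l"
    then obtain w where w: "z = sym_square l w" "\<exists>i<?n. w i \<noteq> 0" by (auto simp: nonzero_squares_def)
    have wn: "vec ?n w \<in> carrier_vec ?n" "vec ?n w \<noteq> 0\<^sub>v ?n" using w by (auto simp: vec_eq_iff)
    have fp: "fixed_perp l 0 = carrier_vec ?n" by (auto simp: fixed_perp_def idx_def)
    obtain v' w' where "v' \<in> carrier_vec ?n" "cx.herm l (vec ?n v) v' \<noteq> 0" "w' \<in> carrier_vec ?n" "cx.herm l (vec ?n w) w' \<noteq> 0"
      using herm_nondegenerate[OF vn] herm_nondegenerate[OF wn] by blast
    then obtain g where g: "g \<in> fixer l 0" "g *\<^sub>v vec ?n v = vec ?n w"
      using transvection_transitive[of "vec ?n v" l 0 v' "vec ?n w" w'] vn(1) wn(1) unfolding fp by blast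
    then have gu: "cx.unitary l g" "det g = 1" by (auto simp: fixer_def)
    have "g * sym_square l v * the (mat_inverse g) = z"
      unfolding conj_sym_square[OF gu(1)] g(2) w(1) by (rule sym_square_cong) simp
    moreover have "g \<in> Sp l" using gu cx.unitary_carrier[OF gu(1)] by (auto simp: Sp_iff SL_def)
    ultimately show "z \<in> adjoint_orbit l (sym_square l v)" unfolding adjoint_orbit_def by blast
  qed
qed

section \<open>The Jordan type and the closure of its orbit\<close>

lemma jordan_matrix_zeros: "jordan_matrix (replicate m (1, 0 :: complex)) = 0\<^sub>m m m"
proof (induction m)
  case 0
  show ?case by (rule eq_matI) (auto simp: jordan_matrix_def)
next
  case (Suc m)
  have "jordan_matrix (replicate (Suc m) (1, 0 :: complex)) =
      four_block_mat (jordan_block 1 0) (0\<^sub>m 1 m) (0\<^sub>m m 1) (0\<^sub>m m m)"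
    using Suc by (simp add: jordan_matrix_def Let_def)
  also have "\<dots> = 0\<^sub>m (Suc m) (Suc m)" by (rule eq_matI) auto
  finally show ?case .
qed

lemma jordan_matrix_21:
  assumes "l \<ge> 1"
  shows "jordan_matrix ((2, 0 :: complex) # replicate (2*l - 2) (1, 0)) =
    mat (2*l) (2*l) (\<lambda>(i,j). if i = 0 \<and> j = 1 then 1 else 0)"
proof -
  have "jordan_matrix ((2, 0 :: complex) # replicate (2*l - 2) (1, 0)) =
      four_block_mat (jordan_block 2 0) (0\<^sub>m 2 (2*l - 2)) (0\<^sub>m (2*l - 2) 2) (0\<^sub>m (2*l - 2) (2*l - 2))"
    using jordan_matrix_zeros[of "2*l - 2"] by (simp add: jordan_matrix_def Let_def)
  also have "\<dots> = mat (2*l) (2*l) (\<lambda>(i,j). if i = 0 \<and> j = 1 then 1 else 0)"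
    using assms by (intro eq_matI) auto
  finally show ?thesis .
qed

text \<open>The Jordan matrix has a single nonzero entry, so e is the product of column 0 of P and
  row 1 of Q; being skew as well, it is a square, and it is nonzero because E is.\<close>

lemma jordan_nf_21_sym_square:
  assumes l: "l \<ge> 2" and e: "e \<in> sp l" and j: "jordan_nf e ((2, 0) # replicate (2*l - 2) (1, 0))"
  shows "\<exists>v. e = sym_square l v \<and> (\<exists>i<2*l. v i \<noteq> 0)"
proof -
  let ?n = "2*l"
  define E where "E = mat ?n ?n (\<lambda>(i,j). if i = 0 \<and> j = 1 then 1 else 0 :: complex)"
  have ec: "e \<in> carrier_mat ?n ?n" "cx.adj l e = - e" using e by (auto simp: sp_iff_adj sl_def)
  have "similar_mat e E" using j jordan_matrix_21[of l] l unfolding jordan_nf_def E_def by simp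
  then obtain P Q where "similar_mat_wit e E P Q" by (auto simp: similar_mat_def)
  from similar_mat_witD2[OF ec(1) this] have PQ: "P * Q = 1\<^sub>m ?n" "Q * P = 1\<^sub>m ?n" "e = P * E * Q"
    "E \<in> carrier_mat ?n ?n" "P \<in> carrier_mat ?n ?n" "Q \<in> carrier_mat ?n ?n" by auto
  have PE: "(P * E) $$ (i,k) = (if k = 1 then P $$ (i,0) else 0)" if "i < ?n" "k < ?n" for i k
    unfolding times_mat_index[OF PQ(5,4) that] using that l
    by (simp add: E_def if_distrib[of "\<lambda>x. _ * x"] cong: if_cong)
  have eij: "e $$ (i,j) = P $$ (i,0) * Q $$ (1,j)" if "i < ?n" "j < ?n" for i j
    unfolding PQ(3) times_mat_index[OF mult_carrier_mat[OF PQ(5,4)] PQ(6) that] using that l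
    by (simp add: PE if_distrib[of "\<lambda>x. x * _"] cong: if_cong del: index_mult_mat(1))
  have "outer ?n e" unfolding outer_def using eij by (intro exI[of _ "\<lambda>i. P $$ (i,0)"] exI[of _ "\<lambda>j. Q $$ (1,j)"]) auto
  then obtain v where v: "e = sym_square l v" using skew_outer_eq_sym_square[OF ec] by blast
  have "\<exists>i<?n. v i \<noteq> 0"
  proof (rule ccontr)
    assume "\<not> (\<exists>i<?n. v i \<noteq> 0)"
    then have e0: "e = 0\<^sub>m ?n ?n" unfolding v by (intro eq_matI) (auto simp: sym_square_def)
    have "E = Q * (P * E * Q) * P"
    proof -
      have "Q * (P * E * Q) * P = (Q * P) * E * (Q * P)" using PQ(4,5,6)
        by (simp add: assoc_mult_mat[of _ ?n ?n _ ?n _ ?n] mult_carrier_mat[of _ ?n ?n])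
      then show ?thesis using PQ by simp
    qed
    also have "\<dots> = 0\<^sub>m ?n ?n" unfolding PQ(3)[symmetric] e0 using PQ(5,6) by simp
    finally have "E $$ (0,1) = 0" using l by simp
    then show False using l by (simp add: E_def)
  qed
  then show ?thesis using v by blast
qed

text \<open>The square of the first unit vector is the matrix unit in the upper right corner.
  Conjugation by the transposition of 1 and 2l - 1 moves the corner to position (0,1).\<close>

lemma jordan_nf_highest_root:
  assumes l: "l \<ge> 2"
  shows "jordan_nf (sym_square l (\<lambda>i. if i = 0 then 1 else 0)) ((2, 0) # replicate (2*l - 2) (1, 0))"
proof -
  let ?n = "2*l" let ?e = "sym_square l (\<lambda>i. if i = 0 then 1 else 0)"
  define E where "E = mat ?n ?n (\<lambda>(i,j). if i = 0 \<and> j = 1 then 1 else 0 :: complex)"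
  define \<tau> where "\<tau> i = (if i = 1 then ?n - 1 else if i = ?n - 1 then 1 else i)" for i
  define P where "P = mat ?n ?n (\<lambda>(i,j). if i = \<tau> j then 1 else 0 :: complex)"
  have tt: "\<tau> (\<tau> i) = i" "\<tau> i < ?n \<longleftrightarrow> i < ?n" "i = \<tau> j \<longleftrightarrow> \<tau> i = j" for i j using l by (auto simp: \<tau>_def)
  have Pc: "P \<in> carrier_mat ?n ?n" and Ec: "E \<in> carrier_mat ?n ?n" by (auto simp: P_def E_def)
  have PM: "(P * M) $$ (i,j) = M $$ (\<tau> i, j)" if "M \<in> carrier_mat ?n ?n" "i < ?n" "j < ?n" for M i j
    unfolding times_mat_index[OF Pc that] using that tt(2)[of i]
    by (simp add: P_def tt(3) if_distrib[of "\<lambda>x. x * _"] cong: if_cong)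
  have MP: "(M * P) $$ (i,j) = M $$ (i, \<tau> j)" if "M \<in> carrier_mat ?n ?n" "i < ?n" "j < ?n" for M i j
    unfolding times_mat_index[OF that(1) Pc that(2,3)] using that tt(2)[of j]
    by (simp add: P_def if_distrib[of "\<lambda>x. _ * x"] cong: if_cong)
  have PP: "P * P = 1\<^sub>m ?n"
  proof (rule eq_matI)
    fix i j assume "i < dim_row (1\<^sub>m ?n :: complex mat)" "j < dim_col (1\<^sub>m ?n :: complex mat)"
    then show "(P * P) $$ (i,j) = 1\<^sub>m ?n $$ (i,j)"
      using tt(2)[of i] tt(3)[of "\<tau> i" j] tt(1)[of i] by (subst PM[OF Pc]) (auto simp: P_def tt)
  qed (use Pc in auto)
  have "?e = P * E * P"
  proof (rule eq_matI)
    fix i j assume "i < dim_row (P * E * P)" "j < dim_col (P * E * P)"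
    then have ij: "i < ?n" "j < ?n" using Pc by auto
    have "(P * E * P) $$ (i,j) = E $$ (\<tau> i, \<tau> j)"
      using MP[OF mult_carrier_mat[OF Pc Ec] ij] PM[OF Ec ij(1), of "\<tau> j"] tt(2)[of j] ij by simp
    also have "\<dots> = (if i = 0 \<and> j = ?n - 1 then 1 else 0)"
      using ij tt(2)[of i] tt(2)[of j] l by (auto simp: E_def \<tau>_def)
    also have "\<dots> = ?e $$ (i,j)" using ij l by (auto simp: sym_square_index)
    finally show "?e $$ (i,j) = (P * E * P) $$ (i,j)" ..
  qed (use Pc in \<open>auto simp: sym_square_def\<close>)
  then have "similar_mat ?e E" using Pc Ec PP by (intro similar_matI[of _ _ P P ?n]) auto
  then show ?thesis using jordan_matrix_21[of l] l unfolding jordan_nf_def E_def by auto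
qed

text \<open>The definite description is legitimate: the highest root vector shows existence, and
  every element of this Jordan type is a nonzero square, all of which lie in one orbit.\<close>

lemma orbit_21_eq:
  assumes l: "l \<ge> 2" shows "orbit_21 l = nonzero_squares l"
  unfolding orbit_21_def
proof (rule the_equality)
  let ?v = "\<lambda>i :: nat. if i = 0 then 1 else 0 :: complex"
  have "\<exists>i<2*l. ?v i \<noteq> 0" using l by (intro exI[of _ 0]) auto
  then show "\<exists>e\<in>sp l. jordan_nf e ((2, 0) # replicate (2*l - 2) (1, 0)) \<and> nonzero_squares l = adjoint_orbit l e"
    using jordan_nf_highest_root[OF l] sym_square_sp[of l ?v] adjoint_orbit_sym_square[of l ?v] by metis
next
  fix Orb assume "\<exists>e\<in>sp l. jordan_nf e ((2, 0) # replicate (2*l - 2) (1, 0)) \<and> Orb = adjoint_orbit l e"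
  then obtain e where e: "e \<in> sp l" "jordan_nf e ((2, 0) # replicate (2*l - 2) (1, 0))" "Orb = adjoint_orbit l e" by blast
  obtain v where "e = sym_square l v" "\<exists>i<2*l. v i \<noteq> 0" using jordan_nf_21_sym_square[OF l e(1,2)] by blast
  then show "Orb = nonzero_squares l" using e(3) adjoint_orbit_sym_square by blast
qed

text \<open>Rank at most one by the vanishing of 2 by 2 minors, the polynomial form needed for
  Zariski closedness. A nonzero entry at (k,m) serves as pivot for the factorisation.\<close>

lemma outer_iff_minors:
  "outer n y \<longleftrightarrow> (\<forall>i<n. \<forall>j<n. \<forall>k<n. \<forall>m<n. y $$ (i,j) * y $$ (k,m) = y $$ (i,m) * y $$ (k,j))"
proof
  assume "outer n y"
  then obtain u w where "\<And>i j. i < n \<Longrightarrow> j < n \<Longrightarrow> y $$ (i,j) = u i * w j" by (auto simp: outer_def)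
  then show "\<forall>i<n. \<forall>j<n. \<forall>k<n. \<forall>m<n. y $$ (i,j) * y $$ (k,m) = y $$ (i,m) * y $$ (k,j)" by (simp add: mult_ac)
next
  assume h: "\<forall>i<n. \<forall>j<n. \<forall>k<n. \<forall>m<n. y $$ (i,j) * y $$ (k,m) = y $$ (i,m) * y $$ (k,j)"
  show "outer n y"
  proof (cases "\<forall>i<n. \<forall>j<n. y $$ (i,j) = 0")
    case True
    then show ?thesis unfolding outer_def by (intro exI[of _ "\<lambda>_. 0"]) auto
  next
    case False
    then obtain k m where km: "k < n" "m < n" "y $$ (k,m) \<noteq> 0" by blast
    have "y $$ (i,j) = y $$ (i,m) * (y $$ (k,j) / y $$ (k,m))" if "i < n" "j < n" for i j
    proof -
      have "y $$ (i,j) * y $$ (k,m) = y $$ (i,m) * y $$ (k,j)" using h that km by blast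
      then show ?thesis using km(3) by (simp add: field_simps)
    qed
    then show ?thesis unfolding outer_def
      by (intro exI[of _ "\<lambda>i. y $$ (i,m)"] exI[of _ "\<lambda>j. y $$ (k,j) / y $$ (k,m)"] allI impI)
  qed
qed

text \<open>The curve runs from the zero matrix at t = 0 through multiples t^2 of one square; it is
  used to approach the zero matrix from within the orbit.\<close>

lemma polyfun_along_squares:
  assumes "f \<in> polyfun (mat_coords (2*l))"
  shows "\<exists>p. \<forall>t. f (sym_square l (\<lambda>i. t * v i)) = poly p t"
  using assms
proof induction
  case (const c)
  show ?case by (intro exI[of _ "[:c:]"]) simp
next
  case (coord f)
  then obtain i j where ij: "i < 2*l" "j < 2*l" "f = (\<lambda>A. A $$ (i,j))" by (auto simp: mat_coords_def)
  show ?case unfolding ij(3) sym_square_index[OF ij(1,2)]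
    by (intro exI[of _ "[:0, 0, v i * ((-1)^(2*l - Suc j) * v (2*l - Suc j)):]"]) (simp add: mult_ac)
next
  case (add f g)
  then obtain p q where "\<forall>t. f (sym_square l (\<lambda>i. t * v i)) = poly p t" "\<forall>t. g (sym_square l (\<lambda>i. t * v i)) = poly q t" by blast
  then show ?case by (intro exI[of _ "p + q"]) simp
next
  case (mult f g)
  then obtain p q where "\<forall>t. f (sym_square l (\<lambda>i. t * v i)) = poly p t" "\<forall>t. g (sym_square l (\<lambda>i. t * v i)) = poly q t" by blast
  then show ?case by (intro exI[of _ "p * q"]) simp
qed

lemma closure_orbit_21:
  assumes l: "l \<ge> 2"
  shows "zariski (mat_coords (2*l)) (sp l) closure_of orbit_21 l = fiber_model l (0\<^sub>m (2*l) (2*l))"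
proof
  let ?n = "2*l" let ?C = "mat_coords ?n"
  have coord: "(\<lambda>A. A $$ (i,j)) \<in> polyfun ?C" if "i < ?n" "j < ?n" for i j
    using that by (intro polyfun.coord) (auto simp: mat_coords_def)
  define F :: "(complex mat \<Rightarrow> complex) set" where "F = {\<lambda>A. A $$ (i,j) * A $$ (k,m) + (-1) * (A $$ (i,m) * A $$ (k,j)) | i j k m. i < ?n \<and> j < ?n \<and> k < ?n \<and> m < ?n}"
  have FC: "F \<subseteq> polyfun ?C"
  proof
    fix f assume "f \<in> F"
    then obtain i j k m where "i < ?n" "j < ?n" "k < ?n" "m < ?n"
      and f: "f = (\<lambda>A. A $$ (i,j) * A $$ (k,m) + (-1) * (A $$ (i,m) * A $$ (k,j)))"
      unfolding F_def by (elim CollectE exE conjE)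
    then show "f \<in> polyfun ?C"
      unfolding f by (intro polyfun.add polyfun.mult polyfun.const coord)
  qed
  have "range (sym_square l) = {z \<in> sp l. \<forall>f\<in>F. f z = 0}"
  proof
    show "range (sym_square l) \<subseteq> {z \<in> sp l. \<forall>f\<in>F. f z = 0}"
      using outer_sym_square sym_square_sp unfolding outer_iff_minors F_def by auto
    show "{z \<in> sp l. \<forall>f\<in>F. f z = 0} \<subseteq> range (sym_square l)"
    proof
      fix z assume z: "z \<in> {z \<in> sp l. \<forall>f\<in>F. f z = 0}"
      have "z $$ (i,j) * z $$ (k,m) = z $$ (i,m) * z $$ (k,j)" if "i < ?n" "j < ?n" "k < ?n" "m < ?n" for i j k m
      proof -
        have "(\<lambda>A. A $$ (i,j) * A $$ (k,m) + (-1) * (A $$ (i,m) * A $$ (k,j))) \<in> F" unfolding F_def using that by blast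
        then have "z $$ (i,j) * z $$ (k,m) + (-1) * (z $$ (i,m) * z $$ (k,j)) = 0" using z by fast
        then show ?thesis by simp
      qed
      then have "outer ?n z" by (simp add: outer_iff_minors)
      moreover have "z \<in> carrier_mat ?n ?n" "cx.adj l z = - z" using z by (auto simp: sp_iff_adj sl_def)
      ultimately show "z \<in> range (sym_square l)" using skew_outer_eq_sym_square by blast
    qed
  qed
  then have cl: "closedin (zariski ?C (sp l)) (range (sym_square l))" unfolding closedin_zariski using FC by blast
  have sub: "nonzero_squares l \<subseteq> range (sym_square l)" by (auto simp: nonzero_squares_def)
  show "zariski ?C (sp l) closure_of orbit_21 l \<subseteq> fiber_model l (0\<^sub>m ?n ?n)"
    unfolding fiber_model_0 orbit_21_eq[OF l] by (rule closure_of_minimal[OF sub cl])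
  show "fiber_model l (0\<^sub>m ?n ?n) \<subseteq> zariski ?C (sp l) closure_of orbit_21 l"
    unfolding fiber_model_0 orbit_21_eq[OF l]
  proof
    fix z assume "z \<in> range (sym_square l)"
    then obtain v where v: "z = sym_square l v" by blast
    show "z \<in> zariski ?C (sp l) closure_of nonzero_squares l"
      unfolding in_closure_of topspace_zariski
    proof (intro conjI allI impI)
      show "z \<in> sp l" unfolding v by (rule sym_square_sp)
      fix U assume U: "z \<in> U \<and> openin (zariski ?C (sp l)) U"
      show "\<exists>y. y \<in> nonzero_squares l \<and> y \<in> U"
      proof (cases "\<exists>i<?n. v i \<noteq> 0")
        case True
        then show ?thesis using U v unfolding nonzero_squares_def by blast
      next
        case False
        \<comment> \<open>The only square outside the orbit is the zero matrix. It is reached along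
          the multiples of the all-ones vector, for which any other nonzero vector would do.\<close>
        define w where "w i = (1 :: complex)" for i :: nat
        have z0: "z = sym_square l (\<lambda>i. 0 * w i)" unfolding v by (rule sym_square_cong) (use False in auto)
        obtain G where G: "G \<subseteq> polyfun ?C" "U = {a \<in> sp l. \<exists>f\<in>G. f a \<noteq> 0}" using U unfolding openin_zariski by blast
        then obtain f where f: "f \<in> G" "f z \<noteq> 0" using U by blast
        obtain p where p: "\<forall>t. f (sym_square l (\<lambda>i. t * w i)) = poly p t" using polyfun_along_squares f G by blast
        have "poly p 0 \<noteq> 0" using p f(2) unfolding z0 by metis
        \<comment> \<open>The additional factor t makes sure that the parameter found is not 0, so
          that the point lies in the orbit.\<close>
        then have "p * [:0, 1:] \<noteq> 0" by auto
        then obtain t where t: "poly (p * [:0, 1:]) t \<noteq> 0" using poly_all_0_iff_0 by blast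
        then have t': "t \<noteq> 0" "poly p t \<noteq> 0" by auto
        let ?y = "sym_square l (\<lambda>i. t * w i)"
        have "?y \<in> nonzero_squares l" unfolding nonzero_squares_def
          using t' l by (auto simp: w_def intro!: exI[of _ "\<lambda>i. t * w i"] exI[of _ 0])
        moreover have "f ?y \<noteq> 0" using p t' by simp
        then have "?y \<in> U" unfolding G(2) using f(1) sym_square_sp by auto
        ultimately show ?thesis by blast
      qed
    qed
  qed
qed

section \<open>Dimension of the central fibre\<close>

lemma pi_fiber_0:
  assumes l: "l \<ge> 2"
  shows "pi_fiber l (0\<^sub>m (2*l) (2*l)) = range (\<lambda>v. gr_pt l (quad_loop l (0\<^sub>m (2*l) (2*l)) (sym_square l v)))"
proof -
  let ?n = "2*l" let ?Z = "0\<^sub>m ?n ?n :: complex mat"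
  have "\<exists>v. y = sym_square l v" if g: "small_pair l ?Z y" for y
  proof -
    have yc: "y \<in> carrier_mat ?n ?n" by (rule small_pairD(2)[OF g])
    have s: "y + cx.adj l y = ?Z" using small_pairD(5)[OF g] by simp
    have o: "outer ?n y" by (rule small_pairD(4)[OF g])
    have "cx.adj l y = - y"
    proof (rule eq_matI)
      fix i j assume "i < dim_row (- y)" "j < dim_col (- y)"
      then have ij: "i < ?n" "j < ?n" using yc by auto
      have "(y + cx.adj l y) $$ (i,j) = 0" unfolding s using ij by simp
      then show "cx.adj l y $$ (i,j) = (- y) $$ (i,j)"
        using ij yc by (simp add: eq_neg_iff_add_eq_0 add.commute)
    qed (use yc in auto)
    then show ?thesis by (rule skew_outer_eq_sym_square[OF yc _ o])
  qed
  then show ?thesis unfolding pi_fiber_eq[OF l] using small_pair_sym_square by blast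
qed

text \<open>Pulled back to the vector v, a coordinate is constant or a multiple of a product of two
  entries. Both dimension bounds use the coordinates only in this form.\<close>

lemma gr_coords_sym_square:
  assumes "c \<in> gr_coords l"
  shows "(\<exists>b. \<forall>v. c (gr_pt l (quad_loop l (0\<^sub>m (2*l) (2*l)) (sym_square l v))) = b) \<or>
    (\<exists>b i j. i < 2*l \<and> j < 2*l \<and> (\<forall>v. c (gr_pt l (quad_loop l (0\<^sub>m (2*l) (2*l)) (sym_square l v))) = b * (v i * v j)))"
proof -
  let ?n = "2*l"
  from assms obtain i j k where ij: "i < ?n" "j < ?n" and c: "c = (\<lambda>p. fls_nth (gr_rep l p $$ (i,j)) (- int k))"
    by (auto simp: gr_coords_def)
  have e: "- int k = - 2 \<longleftrightarrow> k = 2" "- int k = - 1 \<longleftrightarrow> k = 1" by auto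
  have val: "c (gr_pt l (quad_loop l (0\<^sub>m ?n ?n) (sym_square l v))) =
      (if k = 0 then (if i = j then 1 else 0) else if k = 1 then 0 else if k = 2 then sym_square l v $$ (i,j) else 0)" for v
    unfolding c gr_rep_quad_loop[OF small_pair_sym_square] quad_loop_nth[OF ij] e using ij by simp
  show ?thesis
  proof (cases "k = 2")
    case True
    have "c (gr_pt l (quad_loop l (0\<^sub>m ?n ?n) (sym_square l v))) = (-1)^(?n - Suc j) * (v i * v (?n - Suc j))" for v
      unfolding val sym_square_index[OF ij] using True by simp
    moreover have "?n - Suc j < ?n" using ij by simp
    ultimately show ?thesis using ij(1) by blast
  next
    case False
    then have "c (gr_pt l (quad_loop l (0\<^sub>m ?n ?n) (sym_square l v))) = (if k = 0 \<and> i = j then 1 else 0)" for v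
      unfolding val by simp
    then show ?thesis by blast
  qed
qed

text \<open>The fibre is the image of affine space of dimension 2l under a quadratic map. The degree
  in each variable is bounded, which gives the upper bound, and the coordinate subspaces map to a
  chain with 2l strict steps.\<close>

lemma krull_dim_central_fiber:
  assumes l: "l \<ge> 2"
  shows "krull_dim (zariski (gr_coords l) (pi_fiber l (0\<^sub>m (2*l) (2*l)))) = enat (2*l)"
proof (rule antisym)
  let ?n = "2*l" let ?C = "gr_coords l" let ?X = "pi_fiber l (0\<^sub>m ?n ?n)"
  define \<rho> where "\<rho> v = gr_pt l (quad_loop l (0\<^sub>m ?n ?n) (sym_square l v))" for v
  have X: "?X = range \<rho>" unfolding pi_fiber_0[OF l] \<rho>_def ..
  note C = gr_coords_sym_square[of _ l, folded \<rho>_def]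
  have lin: "deg_bounded ?n 1 (\<lambda>v. v i)" if i: "i < ?n" for i
  proof (rule deg_boundedI)
    fix j and v :: "nat \<Rightarrow> complex"
    show "\<exists>p. degree p \<le> 1 \<and> (\<forall>t. (v(j := t)) i = poly p t)"
      by (cases "i = j") (auto intro: exI[of _ "[:0, 1:]"] exI[of _ "[:v i:]"])
  qed (use i in auto)
  show "krull_dim (zariski ?C ?X) \<le> enat ?n"
  proof (rule krull_dim_le[OF X])
    fix c assume "c \<in> ?C"
    from C[OF this] show "\<exists>B. deg_bounded ?n B (c \<circ> \<rho>)"
    proof (elim disjE exE conjE)
      fix b assume "\<forall>v. c (\<rho> v) = b"
      then have "c \<circ> \<rho> = (\<lambda>_. b)" by auto
      then show ?thesis using deg_bounded_const by metis
    next
      fix b i j assume ij: "i < ?n" "j < ?n" "\<forall>v. c (\<rho> v) = b * (v i * v j)"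
      have "deg_bounded ?n (0 + (1 + 1)) (\<lambda>v. b * (v i * v j))"
        by (intro deg_bounded_mult deg_bounded_const lin ij)
      moreover have "c \<circ> \<rho> = (\<lambda>v. b * (v i * v j))" using ij by auto
      ultimately show ?thesis by metis
    qed
  qed
  define V where "V i = {v :: nat \<Rightarrow> complex. \<forall>k. i \<le> k \<and> k < ?n \<longrightarrow> v k = 0}" for i
  \<comment> \<open>The entry of the square at (a, 2l - 1 - a) is v_a^2 up to sign. It vanishes
    exactly when v_a does, so these functions cut out the images of the coordinate subspaces
    although v and -v have the same image.\<close>
  define q where "q a p = fls_nth (gr_rep l p $$ (a, ?n - Suc a)) (- int 2)" for a p
  have qC: "q a \<in> ?C" if "a < ?n" for a
    unfolding gr_coords_def q_def[abs_def] using that by (intro CollectI exI[of _ a] exI[of _ "?n - Suc a"] exI[of _ 2]) auto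
  have q\<rho>: "q a (\<rho> v) = 0 \<longleftrightarrow> v a = 0" if a: "a < ?n" for a v
  proof -
    have k: "?n - Suc a < ?n" "?n - Suc (?n - Suc a) = a" using a by auto
    show ?thesis unfolding q_def \<rho>_def gr_rep_quad_loop[OF small_pair_sym_square] quad_loop_nth[OF a k(1)] sym_square_index[OF a k(1)] k(2)
      by simp
  qed
  have closed: "closedin (zariski ?C ?X) (\<rho> ` V i)" for i
  proof -
    have "\<rho> ` V i = {p \<in> ?X. \<forall>f\<in>q ` {i..<?n}. f p = 0}"
      unfolding X by (auto simp: V_def q\<rho>)
    moreover have "q ` {i..<?n} \<subseteq> polyfun ?C" using qC by (auto intro: polyfun.coord)
    ultimately show ?thesis unfolding closedin_zariski by blast
  qed
  have irr: "irreducible_in (zariski ?C ?X) (\<rho> ` V i)" for i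
  proof (rule irreducible_image_of_lines)
    show "V i \<noteq> {}" unfolding V_def by (auto intro: exI[of _ "\<lambda>_. 0"])
    show "\<rho> ` V i \<subseteq> ?X" unfolding X by auto
    show "(\<lambda>k. v k + t * w k) \<in> V i" if "v \<in> V i" "w \<in> V i" for v w t using that by (auto simp: V_def)
    fix c v w assume "c \<in> ?C"
    from C[OF this] show "\<exists>p. \<forall>t. c (\<rho> (\<lambda>k. v k + t * w k)) = poly p t"
    proof (elim disjE exE conjE)
      fix b assume "\<forall>v. c (\<rho> v) = b"
      then show ?thesis by (intro exI[of _ "[:b:]"]) simp
    next
      fix b i j assume "\<forall>v. c (\<rho> v) = b * (v i * v j)"
      then show ?thesis by (intro exI[of _ "[:b:] * ([:v i, w i:] * [:v j, w j:])"]) (simp add: algebra_simps)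
    qed
  qed
  have strict: "\<rho> ` V i \<subset> \<rho> ` V (Suc i)" if i: "i < ?n" for i
  proof
    show "\<rho> ` V i \<subseteq> \<rho> ` V (Suc i)" by (intro image_mono) (auto simp: V_def)
    let ?v = "\<lambda>k. if k = i then 1 else 0 :: complex"
    have "\<rho> ?v \<in> \<rho> ` V (Suc i)" by (intro imageI) (auto simp: V_def)
    moreover have "\<rho> ?v \<notin> \<rho> ` V i"
    proof
      assume "\<rho> ?v \<in> \<rho> ` V i"
      then obtain v where "v \<in> V i" "\<rho> ?v = \<rho> v" by blast
      then have "q i (\<rho> ?v) = 0" using q\<rho>[OF i, of v] i by (simp add: V_def)
      then show False using q\<rho>[OF i, of ?v] by simp
    qed
    ultimately show "\<rho> ` V i \<noteq> \<rho> ` V (Suc i)" by blast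
  qed
  show "enat ?n \<le> krull_dim (zariski ?C ?X)"
    unfolding krull_dim_def
  proof (rule Sup_upper, intro CollectI exI[of _ ?n] exI[of _ "\<lambda>i. \<rho> ` V i"] conjI allI impI refl)
    show "closedin (zariski ?C ?X) (\<rho> ` V i)" for i by (rule closed)
    show "irreducible_in (zariski ?C ?X) (\<rho> ` V i)" for i by (rule irr)
    show "\<rho> ` V i \<subset> \<rho> ` V (Suc i)" if "i < ?n" for i by (rule strict[OF that])
  qed
qed

theorem proposition4p11:
  fixes l :: nat
  assumes "l \<ge> 2"
  shows "(\<forall>x \<in> pi_map l ` M_small l.
            variety_isomorphic (gr_coords l) (pi_fiber l x) (mat_coords (2*l)) (fiber_model l x)) \<and>
         variety_isomorphic (gr_coords l) (pi_fiber l (0\<^sub>m (2*l) (2*l)))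
            (mat_coords (2*l)) (zariski (mat_coords (2*l)) (sp l) closure_of orbit_21 l) \<and>
         krull_dim (zariski (gr_coords l) (pi_fiber l (0\<^sub>m (2*l) (2*l)))) = enat (2*l)"
proof (intro conjI ballI)
  have "0\<^sub>m (2*l) (2*l) = pi_map l (gr_pt l (quad_loop l (0\<^sub>m (2*l) (2*l)) (sym_square l (\<lambda>_. 0))))"
    by (rule pi_map_quad_loop[OF small_pair_sym_square, symmetric])
  moreover have "gr_pt l (quad_loop l (0\<^sub>m (2*l) (2*l)) (sym_square l (\<lambda>_. 0))) \<in> M_small l"
    unfolding M_small_eq[OF assms] using small_pair_sym_square[of l "\<lambda>_. 0"] by blast
  ultimately have "0\<^sub>m (2*l) (2*l) \<in> pi_map l ` M_small l" by (rule image_eqI)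
  then show "variety_isomorphic (gr_coords l) (pi_fiber l (0\<^sub>m (2*l) (2*l)))
      (mat_coords (2*l)) (zariski (mat_coords (2*l)) (sp l) closure_of orbit_21 l)"
    unfolding closure_orbit_21[OF assms] by (rule fiber_isomorphic[OF assms])
qed (rule fiber_isomorphic[OF assms] krull_dim_central_fiber[OF assms]; assumption?)+

end
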